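(* Let $p$ be a prime number. If $G$ is a non-abelian $p$-group of order $p^3$ and $K$ is a field containing a primitive $p$-th root of unity, then $K(G)$ is rational over $K$.
   Context: For a field $K$ and a finite group $G$, let $K(x_g : g\in G)$ be the rational function field over $K$ in $|G|$ algebraically independent variables $x_g$ indexed by the elements of $G$. The group $G$ acts on it by $K$-automorphisms determined by $h\cdot x_g=x_{hg}$ for all $g,h\in G$. The field $K(G)$ denotes the fixed field $K(x_g:g\in G)^G$ of this action. A field extension $L$ of $K$ is called rational over $K$ if $L$ is purely transcendental over $K$, i.e. $L$ is isomorphic over $K$ to the rational function field $K(x_1,\ldots,x_m)$ for some integer $m$. Saying that $K$ contains a primitive $p$-th root of unity includes the assumption that $\operatorname{char}K\ne p$. *)

theory Defs
  imports
    "HOL-Library.Poly_Mapping"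
    "HOL-Library.FuncSet"
    "HOL-Computational_Algebra.Fraction_Field"
    "HOL-Computational_Algebra.Factorial_Ring"
    "HOL-Algebra.Coset"
begin

section \<open>Rational functions in a family of variables\<close>

text \<open>
  The integral domain structure of \<^theory>\<open>HOL-Library.Poly_Mapping\<close> needs a linear order on the
  variables. Wrapping the index type in a datatype and ordering the wrapper by an arbitrary
  choice makes every type available as index type; nothing below depends on the chosen order.
\<close>

datatype 'v indet = Indet 'v

definition some_order :: "'a rel" where
  "some_order = (SOME r. linear_order_on UNIV r)"

lemma some_order_linear: "linear_order_on UNIV some_order"
proof -
  have "\<exists>r :: 'a rel. linear_order_on UNIV r"
    using well_order_on[of "UNIV :: 'a set"] unfolding well_order_on_def by blast
  then show "linear_order_on UNIV (some_order :: 'a rel)"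
    unfolding some_order_def by (rule someI_ex)
qed

instantiation indet :: (type) linorder
begin

definition less_eq_indet :: "'a indet \<Rightarrow> 'a indet \<Rightarrow> bool" where
  "x \<le> y \<longleftrightarrow> (x :: 'a indet, y) \<in> some_order"

definition less_indet :: "'a indet \<Rightarrow> 'a indet \<Rightarrow> bool" where
  "x < (y :: 'a indet) \<longleftrightarrow> x \<le> y \<and> \<not> y \<le> x"

instance
proof
  have lin: "refl (some_order :: 'a indet rel)" "trans (some_order :: 'a indet rel)"
    "antisym (some_order :: 'a indet rel)" "total (some_order :: 'a indet rel)"
    using some_order_linear[where 'a = "'a indet"]
    by (simp_all add: linear_order_on_def partial_order_on_def preorder_on_def)
  fix x y z :: "'a indet"
  show "x < y \<longleftrightarrow> x \<le> y \<and> \<not> y \<le> x" by (rule less_indet_def)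
  show "x \<le> x" using lin(1) unfolding less_eq_indet_def by (rule reflD)
  show "x \<le> y \<Longrightarrow> y \<le> z \<Longrightarrow> x \<le> z" using lin(2) unfolding less_eq_indet_def by (rule transD)
  show "x \<le> y \<Longrightarrow> y \<le> x \<Longrightarrow> x = y" using lin(3) unfolding less_eq_indet_def by (rule antisymD)
  show "x \<le> y \<or> y \<le> x"
    using lin(1,4) unfolding less_eq_indet_def by (metis UNIV_I reflD total_on_def)
qed

end

type_synonym ('v, 'k) mpoly = "('v indet \<Rightarrow>\<^sub>0 nat) \<Rightarrow>\<^sub>0 'k"

type_synonym ('v, 'k) ratfun = "('v, 'k) mpoly fract"

definition const_fun :: "'k::field \<Rightarrow> ('v, 'k) ratfun" where
  "const_fun c = Fract (Poly_Mapping.single 0 c) 1"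

definition var_fun :: "'v \<Rightarrow> ('v, 'k::field) ratfun" where
  "var_fun v = Fract (Poly_Mapping.single (Poly_Mapping.single (Indet v) 1) 1) 1"

definition polys_in :: "'v set \<Rightarrow> ('v, 'k::field) mpoly set" where
  "polys_in V = {p. \<forall>m \<in> Poly_Mapping.keys p. Poly_Mapping.keys m \<subseteq> Indet ` V}"

text \<open>The field \<open>K(x\<^sub>v : v \<in> V)\<close>, where \<open>K\<close> is the type \<open>'k\<close>.\<close>

definition ratfuns_in :: "'v set \<Rightarrow> ('v, 'k::field) ratfun set" where
  "ratfuns_in V = {Fract p q | p q. p \<in> polys_in V \<and> q \<in> polys_in V \<and> q \<noteq> 0}"

definition K_isomorphism ::
    "(('v, 'k::field) ratfun \<Rightarrow> ('w, 'k) ratfun) \<Rightarrow> ('v, 'k) ratfun set \<Rightarrow> ('w, 'k) ratfun set \<Rightarrow> bool"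
  where
  "K_isomorphism \<phi> E F \<longleftrightarrow>
     bij_betw \<phi> E F \<and>
     (\<forall>f\<in>E. \<forall>g\<in>E. \<phi> (f + g) = \<phi> f + \<phi> g \<and> \<phi> (f * g) = \<phi> f * \<phi> g) \<and>
     (\<forall>c. \<phi> (const_fun c) = const_fun c)"

text \<open>Meaningful for an intermediate field \<open>F\<close> of \<open>K(x\<^sub>v : v)\<close> over \<open>K\<close>.\<close>

definition rational_over_K :: "('v, 'k::field) ratfun set \<Rightarrow> bool" where
  "rational_over_K F \<longleftrightarrow>
     (\<exists>(m::nat) (\<phi> :: ('v, 'k) ratfun \<Rightarrow> (nat, 'k) ratfun). K_isomorphism \<phi> F (ratfuns_in {..<m}))"


section \<open>The fixed field \<open>K(G)\<close>\<close>

definition is_translation ::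
    "('g, 'b) monoid_scheme \<Rightarrow> 'g \<Rightarrow> (('g, 'k::field) ratfun \<Rightarrow> ('g, 'k) ratfun) \<Rightarrow> bool" where
  "is_translation G h \<sigma> \<longleftrightarrow>
     K_isomorphism \<sigma> (ratfuns_in (carrier G)) (ratfuns_in (carrier G)) \<and>
     (\<forall>g\<in>carrier G. \<sigma> (var_fun g) = var_fun (h \<otimes>\<^bsub>G\<^esub> g))"

text \<open>
  The action of \<open>h\<close> on \<open>K(x\<^sub>g : g \<in> G)\<close>; it is well defined by the lemma \<open>translation_unique\<close> below.
\<close>

definition translation :: "('g, 'b) monoid_scheme \<Rightarrow> 'g \<Rightarrow> ('g, 'k::field) ratfun \<Rightarrow> ('g, 'k) ratfun" where
  "translation G h = (THE \<sigma>. \<sigma> \<in> extensional (ratfuns_in (carrier G)) \<and> is_translation G h \<sigma>)"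

definition fixed_field :: "('g, 'b) monoid_scheme \<Rightarrow> ('g, 'k::field) ratfun set" where
  "fixed_field G =
     {f \<in> ratfuns_in (carrier G). \<forall>h\<in>carrier G. translation G h f = f}"

definition primitive_root_of_unity :: "nat \<Rightarrow> 'k::field \<Rightarrow> bool" where
  "primitive_root_of_unity n \<zeta> \<longleftrightarrow> n > 0 \<and> \<zeta> ^ n = 1 \<and> (\<forall>k. 0 < k \<and> k < n \<longrightarrow> \<zeta> ^ k \<noteq> 1)"


section \<open>The translations exist and are unique\<close>

lemma Sum_any_bij:
  assumes "bij l"
  shows "Sum_any g = (\<Sum>a. g (l a))"
  by (rule Sum_any.reindex_cong[OF assms]) (simp add: fun_eq_iff)

definition rename_poly :: "('v indet \<Rightarrow> 'v indet) \<Rightarrow> ('v, 'k::field) mpoly \<Rightarrow> ('v, 'k) mpoly" where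
  "rename_poly \<pi> = Poly_Mapping.map_key (Poly_Mapping.map_key \<pi>)"

context
  fixes \<pi> :: "'v indet \<Rightarrow> 'v indet"
  assumes bij_renaming: "bij \<pi>"
begin

lemma renaming_inj: "inj \<pi>" "inj (inv_into UNIV \<pi>)"
  using bij_renaming by (auto simp: bij_is_inj bij_imp_bij_inv)

lemma map_key_inv: "Poly_Mapping.map_key \<pi> (Poly_Mapping.map_key (inv_into UNIV \<pi>) m) = m"
proof -
  have "inv_into UNIV \<pi> \<circ> \<pi> = (\<lambda>x. x)" using renaming_inj(1) by (auto simp: fun_eq_iff)
  then show ?thesis using map_key_compose[OF renaming_inj, of m] by (simp add: map_key_id)
qed

lemma map_key_inv': "Poly_Mapping.map_key (inv_into UNIV \<pi>) (Poly_Mapping.map_key \<pi> m) = m"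
proof -
  have "\<pi> \<circ> inv_into UNIV \<pi> = (\<lambda>x. x)" using bij_renaming by (auto simp: fun_eq_iff bij_is_surj surj_f_inv_f)
  then show ?thesis using map_key_compose[OF renaming_inj(2,1), of m] by (simp add: map_key_id)
qed

lemma bij_map_key: "bij (Poly_Mapping.map_key \<pi> :: ('v indet \<Rightarrow>\<^sub>0 nat) \<Rightarrow> _)"
  by (rule o_bij[of "Poly_Mapping.map_key (inv_into UNIV \<pi>)"]) (auto simp: fun_eq_iff map_key_inv map_key_inv')

lemma lookup_rename: "Poly_Mapping.lookup (rename_poly \<pi> p) m = Poly_Mapping.lookup p (Poly_Mapping.map_key \<pi> m)"
  unfolding rename_poly_def using bij_is_inj[OF bij_map_key] by (simp add: map_key.rep_eq)

lemma rename_poly_0 [simp]: "rename_poly \<pi> 0 = 0"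
  by (rule poly_mapping_eqI) (simp add: lookup_rename)

lemma rename_poly_add: "rename_poly \<pi> (p + q) = rename_poly \<pi> p + rename_poly \<pi> q"
  by (rule poly_mapping_eqI) (simp add: lookup_rename lookup_add)

lemma rename_poly_mult: "rename_poly \<pi> (p * q) = rename_poly \<pi> p * rename_poly \<pi> q"
proof (rule poly_mapping_eqI)
  fix m
  let ?F = "Poly_Mapping.map_key \<pi> :: ('v indet \<Rightarrow>\<^sub>0 nat) \<Rightarrow> _"
  have F_eq: "?F a = ?F b + ?F c \<longleftrightarrow> a = b + c" for a b c
    using bij_is_inj[OF bij_map_key] by (simp add: inj_eq flip: map_key_plus[OF renaming_inj(1)])
  have "Poly_Mapping.lookup (rename_poly \<pi> (p * q)) m =
      (\<Sum>l. Poly_Mapping.lookup p l * (\<Sum>n. Poly_Mapping.lookup q n when ?F m = l + n))"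
    by (simp add: lookup_rename lookup_mult)
  also have "\<dots> = (\<Sum>l. Poly_Mapping.lookup p (?F l) *
      (\<Sum>n. Poly_Mapping.lookup q n when ?F m = ?F l + n))"
    by (rule Sum_any_bij[OF bij_map_key])
  also have "\<dots> = (\<Sum>l. Poly_Mapping.lookup p (?F l) *
      (\<Sum>n. Poly_Mapping.lookup q (?F n) when ?F m = ?F l + ?F n))"
    by (subst Sum_any_bij[OF bij_map_key, of "\<lambda>n. Poly_Mapping.lookup q n when ?F m = ?F l + n" for l]) (rule refl)
  also have "\<dots> = Poly_Mapping.lookup (rename_poly \<pi> p * rename_poly \<pi> q) m"
    by (simp add: lookup_rename lookup_mult F_eq)
  finally show "Poly_Mapping.lookup (rename_poly \<pi> (p * q)) m =
      Poly_Mapping.lookup (rename_poly \<pi> p * rename_poly \<pi> q) m" .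
qed

lemma rename_poly_const [simp]:
  "rename_poly \<pi> (Poly_Mapping.single 0 c) = Poly_Mapping.single 0 c"
proof -
  have "Poly_Mapping.map_key \<pi> (0 :: _ \<Rightarrow>\<^sub>0 nat) = 0" by (rule map_key_zero[OF renaming_inj(1)])
  then show ?thesis
    using map_key_single[OF bij_is_inj[OF bij_map_key], of 0 c] unfolding rename_poly_def by simp
qed

lemma rename_poly_1 [simp]: "rename_poly \<pi> 1 = 1"
  using rename_poly_const[of 1] by simp

lemma rename_poly_var:
  "rename_poly \<pi> (Poly_Mapping.single (Poly_Mapping.single v 1) c) =
    Poly_Mapping.single (Poly_Mapping.single (\<pi> v) 1) c"
proof -
  have "Poly_Mapping.map_key \<pi> (Poly_Mapping.single (\<pi> v) 1) = Poly_Mapping.single v 1"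
    by (rule map_key_single[OF renaming_inj(1)])
  then show ?thesis
    using map_key_single[OF bij_is_inj[OF bij_map_key], of "Poly_Mapping.single (\<pi> v) 1" c]
    unfolding rename_poly_def by metis
qed

end

lemma rename_poly_inv:
  assumes "bij \<pi>"
  shows "rename_poly (inv_into UNIV \<pi>) (rename_poly \<pi> p) = p"
  by (rule poly_mapping_eqI)
    (simp add: lookup_rename[OF assms] lookup_rename[OF bij_imp_bij_inv[OF assms]] map_key_inv[OF assms])

lemma rename_poly_inv':
  assumes "bij \<pi>"
  shows "rename_poly \<pi> (rename_poly (inv_into UNIV \<pi>) p) = p"
  using rename_poly_inv[OF bij_imp_bij_inv[OF assms]] assms by (simp add: inv_inv_eq)

lemma rename_poly_eq_0_iff [simp]: "bij \<pi> \<Longrightarrow> rename_poly \<pi> p = 0 \<longleftrightarrow> p = 0"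
  by (metis rename_poly_inv rename_poly_0 bij_imp_bij_inv)

lemma polys_in_const: "Poly_Mapping.single 0 c \<in> polys_in V"
  by (auto simp: polys_in_def split: if_splits)

lemma polys_in_1: "1 \<in> polys_in V"
  using polys_in_const[of 1 V] by simp

lemma polys_in_monom: "Poly_Mapping.single m c \<in> polys_in V" if "Poly_Mapping.keys m \<subseteq> Indet ` V"
  using that by (auto simp: polys_in_def split: if_splits)

lemma polys_in_var: "v \<in> V \<Longrightarrow> Poly_Mapping.single (Poly_Mapping.single (Indet v) 1) c \<in> polys_in V"
  by (rule polys_in_monom) auto

lemma polys_in_add: "p \<in> polys_in V \<Longrightarrow> q \<in> polys_in V \<Longrightarrow> p + q \<in> polys_in V"
  using Poly_Mapping.keys_add[of p q] unfolding polys_in_def by blast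

lemma polys_in_mult:
  assumes "p \<in> polys_in V" "q \<in> polys_in V"
  shows "p * q \<in> polys_in V"
  unfolding polys_in_def
proof (clarify)
  fix m v assume m: "m \<in> Poly_Mapping.keys (p * q)" and v: "v \<in> Poly_Mapping.keys m"
  obtain a b where "m = a + b" "a \<in> Poly_Mapping.keys p" "b \<in> Poly_Mapping.keys q"
    using m keys_mult[of p q] by blast
  then show "v \<in> Indet ` V"
    using assms v Poly_Mapping.keys_add[of a b] unfolding polys_in_def by blast
qed

lemma rename_poly_in:
  assumes "bij \<pi>" "\<pi> ` Indet ` V = Indet ` V" "p \<in> polys_in V"
  shows "rename_poly \<pi> p \<in> polys_in V"
  unfolding polys_in_def
proof clarify
  fix m v assume m: "m \<in> Poly_Mapping.keys (rename_poly \<pi> p)" and v: "v \<in> Poly_Mapping.keys m"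
  have "Poly_Mapping.map_key \<pi> m \<in> Poly_Mapping.keys p"
    using m by (simp add: in_keys_iff lookup_rename[OF assms(1)])
  then have "\<pi> -` Poly_Mapping.keys m \<subseteq> Indet ` V"
    using assms(3) keys_map_key[OF bij_is_inj[OF assms(1)], of m] unfolding polys_in_def by blast
  then have "inv_into UNIV \<pi> v \<in> Indet ` V"
    using v assms(1) by (auto simp: bij_is_surj surj_f_inv_f)
  then show "v \<in> Indet ` V"
    using assms(1,2) by (metis bij_is_surj image_eqI surj_f_inv_f)
qed

lemma Fract_in: "p \<in> polys_in V \<Longrightarrow> q \<in> polys_in V \<Longrightarrow> q \<noteq> 0 \<Longrightarrow> Fract p q \<in> ratfuns_in V"
  unfolding ratfuns_in_def by blast

lemma ratfuns_in_cases:
  assumes "f \<in> ratfuns_in V"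
  obtains p q where "f = Fract p q" "p \<in> polys_in V" "q \<in> polys_in V" "q \<noteq> 0"
  using assms unfolding ratfuns_in_def by blast

lemma const_fun_in: "const_fun c \<in> ratfuns_in V"
  unfolding const_fun_def by (rule Fract_in[OF polys_in_const polys_in_1 one_neq_zero])

lemma var_fun_in: "v \<in> V \<Longrightarrow> var_fun v \<in> ratfuns_in V"
  unfolding var_fun_def by (rule Fract_in[OF polys_in_var polys_in_1 one_neq_zero])

lemma ratfuns_in_add: "f \<in> ratfuns_in V \<Longrightarrow> g \<in> ratfuns_in V \<Longrightarrow> f + g \<in> ratfuns_in V"
  by (elim ratfuns_in_cases) (simp add: Fract_in polys_in_add polys_in_mult)

lemma ratfuns_in_mult: "f \<in> ratfuns_in V \<Longrightarrow> g \<in> ratfuns_in V \<Longrightarrow> f * g \<in> ratfuns_in V"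
  by (elim ratfuns_in_cases) (simp add: Fract_in polys_in_mult)

definition rename_ratfun :: "('v indet \<Rightarrow> 'v indet) \<Rightarrow> ('v, 'k::field) ratfun \<Rightarrow> ('v, 'k) ratfun" where
  "rename_ratfun \<pi> f =
     (THE r. \<exists>p q. q \<noteq> 0 \<and> f = Fract p q \<and> r = Fract (rename_poly \<pi> p) (rename_poly \<pi> q))"

lemma rename_ratfun_Fract:
  assumes "bij \<pi>" "q \<noteq> 0"
  shows "rename_ratfun \<pi> (Fract p q) = Fract (rename_poly \<pi> p) (rename_poly \<pi> q)"
  unfolding rename_ratfun_def
proof (rule the_equality)
  show "\<exists>p' q'. q' \<noteq> 0 \<and> Fract p q = Fract p' q' \<and>
      Fract (rename_poly \<pi> p) (rename_poly \<pi> q) = Fract (rename_poly \<pi> p') (rename_poly \<pi> q')"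
    using assms(2) by blast
next
  fix r assume "\<exists>p' q'. q' \<noteq> 0 \<and> Fract p q = Fract p' q' \<and> r = Fract (rename_poly \<pi> p') (rename_poly \<pi> q')"
  then obtain p' q' where q': "q' \<noteq> 0" "Fract p q = Fract p' q'"
    and r: "r = Fract (rename_poly \<pi> p') (rename_poly \<pi> q')" by blast
  have "p * q' = p' * q" using q' assms(2) by (simp add: eq_fract)
  then have "rename_poly \<pi> p * rename_poly \<pi> q' = rename_poly \<pi> p' * rename_poly \<pi> q"
    by (simp flip: rename_poly_mult[OF assms(1)])
  then show "r = Fract (rename_poly \<pi> p) (rename_poly \<pi> q)"
    unfolding r using assms q' by (simp add: eq_fract)
qed

lemma rename_ratfun_inv:
  assumes "bij \<pi>"
  shows "rename_ratfun (inv_into UNIV \<pi>) (rename_ratfun \<pi> f) = f"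
    and "rename_ratfun \<pi> (rename_ratfun (inv_into UNIV \<pi>) f) = f"
  by (cases f; simp add: rename_ratfun_Fract assms bij_imp_bij_inv rename_poly_inv rename_poly_inv')+

lemma rename_ratfun_in:
  assumes "bij \<pi>" "\<pi> ` Indet ` V = Indet ` V" "f \<in> ratfuns_in V"
  shows "rename_ratfun \<pi> f \<in> ratfuns_in V"
  using assms(3)
proof (rule ratfuns_in_cases)
  fix p q assume *: "f = Fract p q" "p \<in> polys_in V" "q \<in> polys_in V" "q \<noteq> 0"
  show ?thesis
    unfolding *(1) rename_ratfun_Fract[OF assms(1) *(4)]
    by (intro Fract_in rename_poly_in[OF assms(1,2)] *) (simp add: assms(1) *(4))
qed

lemma K_isomorphism_rename_ratfun:
  assumes "bij \<pi>" "\<pi> ` Indet ` V = Indet ` V"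
  shows "K_isomorphism (rename_ratfun \<pi>) (ratfuns_in V) (ratfuns_in V)"
  unfolding K_isomorphism_def
proof (intro conjI ballI allI)
  have i: "bij (inv_into UNIV \<pi>)" using assms(1) by (rule bij_imp_bij_inv)
  have "inv_into UNIV \<pi> ` Indet ` V = Indet ` V"
    using assms by (metis bij_is_inj image_inv_f_f)
  then show "bij_betw (rename_ratfun \<pi>) (ratfuns_in V) (ratfuns_in V)"
    by (intro bij_betwI[where g = "rename_ratfun (inv_into UNIV \<pi>)"])
      (auto simp: rename_ratfun_inv assms rename_ratfun_in i)
next
  fix f g :: "('a, 'b) ratfun"
  show "rename_ratfun \<pi> (f + g) = rename_ratfun \<pi> f + rename_ratfun \<pi> g"
    by (cases f; cases g)
      (simp add: rename_ratfun_Fract assms rename_poly_add rename_poly_mult)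
  show "rename_ratfun \<pi> (f * g) = rename_ratfun \<pi> f * rename_ratfun \<pi> g"
    by (cases f; cases g) (simp add: rename_ratfun_Fract assms rename_poly_mult)
next
  fix c :: 'b
  show "rename_ratfun \<pi> (const_fun c) = const_fun c"
    unfolding const_fun_def by (simp add: rename_ratfun_Fract assms)
qed

lemma rename_ratfun_var: "bij \<pi> \<Longrightarrow> \<pi> (Indet v) = Indet w \<Longrightarrow> rename_ratfun \<pi> (var_fun v) = var_fun w"
  unfolding var_fun_def by (simp only: rename_ratfun_Fract rename_poly_var rename_poly_1 one_neq_zero not_False_eq_True)

lemma ex_translation:
  assumes "group G" "h \<in> carrier G"
  shows "\<exists>\<sigma>. is_translation G h \<sigma>"
proof -
  interpret group G by fact
  define t where "t h g = (if g \<in> carrier G then h \<otimes>\<^bsub>G\<^esub> g else g)" for h g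
  define \<pi> where "\<pi> = (\<lambda>i. case i of Indet g \<Rightarrow> Indet (t h g))"
  define \<pi>' where "\<pi>' = (\<lambda>i. case i of Indet g \<Rightarrow> Indet (t (inv\<^bsub>G\<^esub> h) g))"
  have "\<pi> (\<pi>' i) = i" "\<pi>' (\<pi> i) = i" for i
    using assms(2) by (cases i; auto simp: \<pi>_def \<pi>'_def t_def simp flip: m_assoc)+
  then have bij: "bij \<pi>" and img: "i = \<pi> (\<pi>' i)" for i
    by (auto intro!: o_bij[of \<pi>'] simp: fun_eq_iff)
  have "\<pi> ` Indet ` carrier G = Indet ` carrier G"
  proof
    show "\<pi> ` Indet ` carrier G \<subseteq> Indet ` carrier G"
      using assms(2) by (auto simp: \<pi>_def t_def)
    show "Indet ` carrier G \<subseteq> \<pi> ` Indet ` carrier G"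
    proof
      fix i assume i: "i \<in> Indet ` carrier G"
      then have "\<pi>' i \<in> Indet ` carrier G" using assms(2) by (auto simp: \<pi>'_def t_def)
      then show "i \<in> \<pi> ` Indet ` carrier G" using img[of i] by blast
    qed
  qed
  moreover have "rename_ratfun \<pi> (var_fun g) = var_fun (h \<otimes>\<^bsub>G\<^esub> g)" if "g \<in> carrier G" for g
    by (rule rename_ratfun_var[OF bij]) (simp add: \<pi>_def t_def that)
  ultimately show ?thesis
    unfolding is_translation_def using K_isomorphism_rename_ratfun[OF bij] by blast
qed

lemma update_eq_add: "a \<notin> Poly_Mapping.keys f \<Longrightarrow> Poly_Mapping.update a b f = f + Poly_Mapping.single a b"
  for b :: "'b::comm_monoid_add"
  by (rule poly_mapping_eqI)
    (auto simp: lookup_update lookup_add lookup_single in_keys_iff when_def)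

lemma translations_agree:
  fixes \<sigma> \<tau> :: "('g, 'k::field) ratfun \<Rightarrow> ('g, 'k) ratfun"
  assumes "is_translation G h \<sigma>" "is_translation G h \<tau>" "f \<in> ratfuns_in (carrier G)"
  shows "\<sigma> f = \<tau> f"
proof -
  let ?L = "ratfuns_in (carrier G) :: ('g, 'k) ratfun set"
  have poly_in: "Fract p 1 \<in> ?L" if "p \<in> polys_in (carrier G)" for p :: "('g, 'k) mpoly"
    by (rule Fract_in[OF that polys_in_1 one_neq_zero])
  have add: "\<rho> (Fract (p + q) 1) = \<rho> (Fract p 1) + \<rho> (Fract q 1)"
    and mult: "\<rho> (Fract (p * q) 1) = \<rho> (Fract p 1) * \<rho> (Fract q 1)"
    if "is_translation G h \<rho>" "p \<in> polys_in (carrier G)" "q \<in> polys_in (carrier G)"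
      for \<rho> :: "('g, 'k) ratfun \<Rightarrow> ('g, 'k) ratfun" and p q
  proof -
    have eq: "Fract (p + q) 1 = Fract p 1 + Fract q 1" "Fract (p * q) 1 = Fract p 1 * Fract q 1"
      by simp_all
    show "\<rho> (Fract (p + q) 1) = \<rho> (Fract p 1) + \<rho> (Fract q 1)"
      "\<rho> (Fract (p * q) 1) = \<rho> (Fract p 1) * \<rho> (Fract q 1)"
      unfolding eq using that(1) poly_in[OF that(2)] poly_in[OF that(3)]
      unfolding is_translation_def K_isomorphism_def by blast+
  qed
  have agree_const: "\<sigma> (Fract (Poly_Mapping.single 0 c) 1) = \<tau> (Fract (Poly_Mapping.single 0 c) 1)" for c
    using assms(1,2) unfolding is_translation_def K_isomorphism_def const_fun_def by simp
  have power: "\<sigma> (Fract (Poly_Mapping.single (Poly_Mapping.single i n) 1) 1) =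
      \<tau> (Fract (Poly_Mapping.single (Poly_Mapping.single i n) 1) 1)"
    if i: "i \<in> Indet ` carrier G" for i n
  proof (induction n)
    case 0
    show ?case using agree_const[of 1] by simp
  next
    case (Suc n)
    obtain g where g: "i = Indet g" "g \<in> carrier G" using i by blast
    let ?x = "\<lambda>n. Poly_Mapping.single (Poly_Mapping.single i n) 1 :: ('g, 'k) mpoly"
    have eq: "?x (Suc n) = ?x n * ?x 1"
      by (simp add: mult_single flip: single_add)
    have "?x n \<in> polys_in (carrier G)" "?x 1 \<in> polys_in (carrier G)"
      by (rule polys_in_monom; use i in auto)+
    moreover have "\<sigma> (Fract (?x 1) 1) = \<tau> (Fract (?x 1) 1)"
      using assms(1,2) g(2) unfolding is_translation_def var_fun_def g(1) by metis
    ultimately show ?case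
      unfolding eq by (simp only: mult[OF assms(1)] mult[OF assms(2)] Suc.IH)
  qed
  have monom: "\<sigma> (Fract (Poly_Mapping.single m 1) 1) = \<tau> (Fract (Poly_Mapping.single m 1) 1)"
    if "Poly_Mapping.keys m \<subseteq> Indet ` carrier G" for m
    using that
  proof (induction m rule: Poly_Mapping.update_induct)
    case const
    show ?case by (rule agree_const)
  next
    case (update m i n)
    have k: "Poly_Mapping.keys m \<subseteq> Indet ` carrier G" "i \<in> Indet ` carrier G"
      using update.prems update.hyps by (auto simp: keys_update split: if_splits)
    have eq: "Poly_Mapping.single (Poly_Mapping.update i n m) 1 =
        Poly_Mapping.single m 1 * Poly_Mapping.single (Poly_Mapping.single i n) (1::'k)"
      using update.hyps by (simp add: update_eq_add mult_single)
    have m: "(Poly_Mapping.single m 1 :: ('g, 'k) mpoly) \<in> polys_in (carrier G)"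
      "(Poly_Mapping.single (Poly_Mapping.single i n) 1 :: ('g, 'k) mpoly) \<in> polys_in (carrier G)"
      by (rule polys_in_monom; use k in auto)+
    show ?case
      unfolding eq mult[OF assms(1) m] mult[OF assms(2) m] update.IH[OF k(1)] power[OF k(2)] ..
  qed
  have poly: "\<sigma> (Fract p 1) = \<tau> (Fract p 1)" if "p \<in> polys_in (carrier G)" for p
    using that
  proof (induction p rule: Poly_Mapping.update_induct)
    case const
    show ?case using agree_const[of 0] by simp
  next
    case (update p m c)
    have k: "p \<in> polys_in (carrier G)" "Poly_Mapping.keys m \<subseteq> Indet ` carrier G"
      using update.prems update.hyps by (auto simp: polys_in_def keys_update split: if_splits)
    have eq: "Poly_Mapping.single m c = Poly_Mapping.single 0 c * Poly_Mapping.single m 1"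
      by (simp add: mult_single)
    have m: "(Poly_Mapping.single m 1 :: ('g, 'k) mpoly) \<in> polys_in (carrier G)"
      "Poly_Mapping.single m c \<in> polys_in (carrier G)"
      by (rule polys_in_monom; use k in auto)+
    have "\<sigma> (Fract (Poly_Mapping.single m c) 1) = \<tau> (Fract (Poly_Mapping.single m c) 1)"
      unfolding eq mult[OF assms(1) polys_in_const m(1)] mult[OF assms(2) polys_in_const m(1)]
        agree_const monom[OF k(2)] ..
    then show ?case
      unfolding update_eq_add[OF update.hyps(1)] add[OF assms(1) k(1) m(2)] add[OF assms(2) k(1) m(2)]
        update.IH[OF k(1)] by simp
  qed
  obtain p q where f: "f = Fract p q" and p: "p \<in> polys_in (carrier G)"
    and q: "q \<in> polys_in (carrier G)" "q \<noteq> 0"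
    using assms(3) by (rule ratfuns_in_cases)
  have f_q: "f * Fract q 1 = Fract p 1" using q(2) by (simp add: f eq_fract)
  have prod: "\<rho> f * \<rho> (Fract q 1) = \<rho> (Fract p 1)"
    if "is_translation G h \<rho>" for \<rho> :: "('g, 'k) ratfun \<Rightarrow> ('g, 'k) ratfun"
    unfolding f_q[symmetric]
    using that assms(3) poly_in[OF q(1)] unfolding is_translation_def K_isomorphism_def by simp
  have zero: "\<sigma> 0 = 0" "0 \<in> ?L"
  proof -
    have c: "0 = (const_fun 0 :: ('g, 'k) ratfun)" by (simp add: const_fun_def Zero_fract_def)
    show "\<sigma> 0 = 0"
      unfolding c using assms(1) unfolding is_translation_def K_isomorphism_def by blast
    show "0 \<in> ?L" unfolding c by (rule const_fun_in)
  qed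
  have "inj_on \<sigma> ?L"
    using assms(1) unfolding is_translation_def K_isomorphism_def bij_betw_def by blast
  moreover have "Fract q 1 \<noteq> 0" using q(2) by (simp add: Zero_fract_def eq_fract)
  ultimately have "\<sigma> (Fract q 1) \<noteq> 0"
    using zero poly_in[OF q(1)] by (metis inj_onD)
  moreover have "\<sigma> f * \<sigma> (Fract q 1) = \<tau> f * \<sigma> (Fract q 1)"
    using prod[OF assms(1)] prod[OF assms(2)] poly[OF p] poly[OF q(1)] by simp
  ultimately show ?thesis by simp
qed

lemma is_translation_restrict:
  assumes "is_translation G h \<sigma>" "group G" "h \<in> carrier G"
  shows "is_translation G h (restrict \<sigma> (ratfuns_in (carrier G)))"
proof -
  interpret group G by fact
  show ?thesis
    using assms(1,3) unfolding is_translation_def K_isomorphism_def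
    by (simp add: const_fun_in var_fun_in ratfuns_in_add ratfuns_in_mult)
qed

lemma translation_unique:
  assumes "group G" "h \<in> carrier G"
  shows "\<exists>!\<sigma> :: ('g, 'k::field) ratfun \<Rightarrow> ('g, 'k) ratfun.
    \<sigma> \<in> extensional (ratfuns_in (carrier G)) \<and> is_translation G h \<sigma>"
proof (rule ex_ex1I)
  show "\<exists>\<sigma> :: ('g, 'k) ratfun \<Rightarrow> ('g, 'k) ratfun.
      \<sigma> \<in> extensional (ratfuns_in (carrier G)) \<and> is_translation G h \<sigma>"
    using ex_translation[OF assms] is_translation_restrict[OF _ assms] restrict_extensional by metis
next
  fix \<sigma> \<tau> :: "('g, 'k) ratfun \<Rightarrow> ('g, 'k) ratfun"
  assume "\<sigma> \<in> extensional (ratfuns_in (carrier G)) \<and> is_translation G h \<sigma>"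
    and "\<tau> \<in> extensional (ratfuns_in (carrier G)) \<and> is_translation G h \<tau>"
  then have \<sigma>: "\<sigma> \<in> extensional (ratfuns_in (carrier G))" "is_translation G h \<sigma>"
    and \<tau>: "\<tau> \<in> extensional (ratfuns_in (carrier G))" "is_translation G h \<tau>"
    by simp_all
  show "\<sigma> = \<tau>"
    by (rule extensionalityI[OF \<sigma>(1) \<tau>(1)]) (rule translations_agree[OF \<sigma>(2) \<tau>(2)])
qed

lemma is_translation_translation:
  assumes "group G" "h \<in> carrier G"
  shows "is_translation G h (translation G h :: ('g, 'k::field) ratfun \<Rightarrow> ('g, 'k) ratfun)"
  unfolding translation_def by (rule theI'[OF translation_unique[OF assms], THEN conjunct2])

end

theory Submission
  imports
    Defs
    "HOL-Computational_Algebra.Polynomial"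
    "HOL-Computational_Algebra.Primes"
    "HOL-Algebra.Group_Action"
begin

hide_const (open) Polynomial.order Rat.Fract
hide_fact (open) Polynomial.order_def

text \<open>
  A non-abelian group of order \<open>p\<^sup>3\<close> other than the quaternion group contains \<open>s\<close>, \<open>t\<close> and a central
  \<open>z\<close> of order \<open>p\<close> with \<open>t s = s t z\<close> and \<open>t\<^sup>p = 1\<close>, hence a normal subgroup \<open>\<langle>z, t\<rangle>\<close> of type \<open>(p, p)\<close>
  whose characters are defined over \<open>K\<close>. Let \<open>X\<^sub>i\<close> (\<open>i < p\<close>) be the basis of the induced
  \<open>p\<close>-dimensional representation inside the regular one: \<open>z X\<^sub>i = \<zeta> X\<^sub>i\<close>, \<open>t X\<^sub>i = \<zeta>\<^sup>i X\<^sub>i\<close>,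
  \<open>s X\<^sub>i = X\<^sub>i\<^sub>+\<^sub>1\<close>. The quotients \<open>y\<^sub>i = X\<^sub>i\<^sub>+\<^sub>1 / X\<^sub>i\<close> are cyclically permuted by \<open>s\<close>, and the Lagrange
  resolvents \<open>e\<^sub>j\<close> of the \<open>y\<^sub>i\<close> satisfy \<open>s e\<^sub>j = \<zeta>\<^sup>j e\<^sub>j\<close>, \<open>t e\<^sub>j = \<zeta> e\<^sub>j\<close>, \<open>z e\<^sub>j = e\<^sub>j\<close>. Put \<open>l = e\<^sub>1 / e\<^sub>0\<close>.
  The monomials in \<open>X\<^sub>0\<close>, \<open>e\<^sub>0\<close>, \<open>l\<close> realise all the characters needed to turn every other
  eigenvector of the regular representation into an invariant. This gives an explicit set of at
  most \<open>p\<^sup>3\<close> invariants generating a field \<open>F\<^sub>0\<close>, and the whole function field is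
  the Kummer tower \<open>F\<^sub>0(l)(e\<^sub>0)(X\<^sub>0)\<close>, on whose steps \<open>s\<close>, \<open>t\<close> and \<open>z\<close> act by multiplication
  with \<open>\<zeta>\<close>. Therefore \<open>F\<^sub>0\<close> is the fixed field, and comparing transcendence degrees (Steinitz
  exchange) shows that the generators are algebraically independent.

  For the quaternion group acting on itself by left multiplication, the rows of the rotation
  matrix of the generic quaternion play the same role: they are invariant up to sign.
\<close>

section \<open>Subfields, generators and finite extensions\<close>

text \<open>Only \<open>p\<close>-th roots of unity are available, so the abelian normal subgroup of
  order p^2 must have exponent \<open>p\<close>. This forces \<open>t\<close> to have order
  \<open>p\<close>, while \<open>s\<close> may have order p^2: its \<open>p\<close>-th power is felt
  only through the scalar \<open>\<zeta> ^ r\<close> with s^p = z^r. The quaternion group has a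
  single involution and hence no such subgroup. The quotients \<open>y i\<close> lose one parameter,
  since their product around the cycle is \<open>\<zeta> ^ r\<close>. The same relation puts the
  \<open>p\<close>-th power of \<open>e 0\<close> into F0(l), and the lost parameter returns through
  the orbit sum of the \<open>p\<close>-th power of \<open>X 0\<close>. The tally is 2 + (p - 2) +
  (p^2 - 1) p = p^3, and independence asks for this bound alone: a dependent set that small could
  not carry the transcendence degree. Denominators are seen to be nonzero by viewing them as
  polynomials in one quantity transcendental over the rest. The Kummer steps are settled by
  averaging over the powers of an automorphism, in place of degrees and a Galois
  correspondence.\<close>

definition is_subfield :: "'a::field set \<Rightarrow> bool" where
  "is_subfield F \<longleftrightarrow> 0 \<in> F \<and> 1 \<in> F \<and> (\<forall>x\<in>F. \<forall>y\<in>F. x + y \<in> F \<and> x * y \<in> F) \<and>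
     (\<forall>x\<in>F. - x \<in> F \<and> inverse x \<in> F)"

definition gen_field :: "'a::field set \<Rightarrow> 'a set" where
  "gen_field S = \<Inter> {F. is_subfield F \<and> S \<subseteq> F}"

lemma subfield_0: "is_subfield F \<Longrightarrow> 0 \<in> F"
  and subfield_1: "is_subfield F \<Longrightarrow> 1 \<in> F"
  and subfield_add: "is_subfield F \<Longrightarrow> x \<in> F \<Longrightarrow> y \<in> F \<Longrightarrow> x + y \<in> F"
  and subfield_mult: "is_subfield F \<Longrightarrow> x \<in> F \<Longrightarrow> y \<in> F \<Longrightarrow> x * y \<in> F"
  and subfield_uminus: "is_subfield F \<Longrightarrow> x \<in> F \<Longrightarrow> - x \<in> F"
  and subfield_inverse: "is_subfield F \<Longrightarrow> x \<in> F \<Longrightarrow> inverse x \<in> F"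
  by (auto simp: is_subfield_def)

lemma subfield_diff: "is_subfield F \<Longrightarrow> x \<in> F \<Longrightarrow> y \<in> F \<Longrightarrow> x - y \<in> F"
  unfolding diff_conv_add_uminus by (intro subfield_add subfield_uminus)

lemma subfield_divide: "is_subfield F \<Longrightarrow> x \<in> F \<Longrightarrow> y \<in> F \<Longrightarrow> x / y \<in> F"
  by (simp add: divide_inverse subfield_mult subfield_inverse)

lemma subfield_sum: "is_subfield F \<Longrightarrow> (\<And>i. i \<in> I \<Longrightarrow> f i \<in> F) \<Longrightarrow> sum f I \<in> F"
  by (induction I rule: infinite_finite_induct) (auto simp: subfield_0 subfield_add)

lemma subfield_prod: "is_subfield F \<Longrightarrow> (\<And>i. i \<in> I \<Longrightarrow> f i \<in> F) \<Longrightarrow> prod f I \<in> F"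
  by (induction I rule: infinite_finite_induct) (auto simp: subfield_1 subfield_mult)

lemma subfield_power: "is_subfield F \<Longrightarrow> x \<in> F \<Longrightarrow> x ^ n \<in> F"
  by (induction n) (auto simp: subfield_1 subfield_mult)

lemma subfield_of_nat: "is_subfield F \<Longrightarrow> of_nat n \<in> F"
  by (induction n) (auto simp: subfield_0 subfield_1 subfield_add)

lemma subfield_numeral: "is_subfield F \<Longrightarrow> numeral n \<in> F"
  using subfield_of_nat[of F "numeral n"] by simp

lemmas subfield_closed = subfield_0 subfield_1 subfield_add subfield_mult subfield_uminus
  subfield_inverse subfield_diff subfield_divide subfield_sum subfield_prod subfield_power
  subfield_of_nat subfield_numeral

lemma is_subfield_gen_field: "is_subfield (gen_field S)"
  unfolding gen_field_def is_subfield_def by auto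

lemma gen_field_superset: "S \<subseteq> gen_field S"
  unfolding gen_field_def by auto

lemma gen_field_least: "is_subfield F \<Longrightarrow> S \<subseteq> F \<Longrightarrow> gen_field S \<subseteq> F"
  unfolding gen_field_def by auto

lemma gen_field_mono: "S \<subseteq> T \<Longrightarrow> gen_field S \<subseteq> gen_field T"
  unfolding gen_field_def by auto

lemma gen_field_insert_gen_field: "gen_field (insert y (gen_field S)) = gen_field (insert y S)"
proof
  show "gen_field (insert y (gen_field S)) \<subseteq> gen_field (insert y S)"
    using gen_field_mono[of S "insert y S"] gen_field_superset[of "insert y S"]
    by (intro gen_field_least is_subfield_gen_field) auto
  show "gen_field (insert y S) \<subseteq> gen_field (insert y (gen_field S))"
    using gen_field_superset[of S] by (intro gen_field_mono) auto
qed

section \<open>Linear spans and finite extensions\<close>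

inductive_set lin_span :: "'a::field set \<Rightarrow> 'a set \<Rightarrow> 'a set" for F B where
  lin_span_0: "0 \<in> lin_span F B"
| lin_span_step: "x \<in> lin_span F B \<Longrightarrow> k \<in> F \<Longrightarrow> b \<in> B \<Longrightarrow> x + k * b \<in> lin_span F B"

text \<open>The spanning set \<open>B\<close> may lie outside \<open>W\<close>, and \<open>W\<close>
  may be any set; so the notion passes to subsets at once.\<close>

definition fin_ext :: "'a::field set \<Rightarrow> 'a set \<Rightarrow> bool" where
  "fin_ext F W \<longleftrightarrow> (\<exists>B. finite B \<and> W \<subseteq> lin_span F B)"

lemma lin_span_add:
  assumes "x \<in> lin_span F B" "y \<in> lin_span F B"
  shows "x + y \<in> lin_span F B"
  using assms(2)
  by (induction rule: lin_span.induct) (auto simp: assms(1) lin_span_step simp flip: add.assoc)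

lemma lin_span_smult:
  assumes "is_subfield F" "k \<in> F" "x \<in> lin_span F B"
  shows "k * x \<in> lin_span F B"
  using assms(3)
proof (induction rule: lin_span.induct)
  case lin_span_0
  show ?case by (simp add: lin_span.lin_span_0)
next
  case (lin_span_step x l b)
  then show ?case
    using lin_span.lin_span_step[of "k * x" F B "k * l" b] assms
    by (simp add: algebra_simps subfield_mult)
qed

lemma lin_span_base: "k \<in> F \<Longrightarrow> b \<in> B \<Longrightarrow> k * b \<in> lin_span F B"
  using lin_span_step[OF lin_span_0] by force

lemma lin_span_sum: "(\<And>i. i \<in> I \<Longrightarrow> f i \<in> lin_span F B) \<Longrightarrow> sum f I \<in> lin_span F B"
  by (induction I rule: infinite_finite_induct) (auto simp: lin_span_0 lin_span_add)

text \<open>As in the tower law, the products \<open>b * c\<close> span over the ground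
  field.\<close>

lemma lin_span_trans:
  assumes "F \<subseteq> lin_span E B"
  shows "lin_span F C \<subseteq> lin_span E ((\<lambda>(b, c). b * c) ` (B \<times> C))"
proof
  let ?D = "(\<lambda>(b, c). b * c) ` (B \<times> C)"
  fix x assume "x \<in> lin_span F C"
  then show "x \<in> lin_span E ?D"
  proof (induction rule: lin_span.induct)
    case lin_span_0
    show ?case by (rule lin_span.lin_span_0)
  next
    case (lin_span_step x k c)
    have "k \<in> lin_span E B" using lin_span_step assms by auto
    then have "k * c \<in> lin_span E ?D"
    proof (induction rule: lin_span.induct)
      case lin_span_0
      show ?case by (simp add: lin_span.lin_span_0)
    next
      case (lin_span_step y l b)
      then have "y * c + l * (b * c) \<in> lin_span E ?D"
        using \<open>c \<in> C\<close> by (intro lin_span.lin_span_step) auto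
      then show ?case by (simp add: algebra_simps)
    qed
    then show ?case using lin_span_step.IH by (rule lin_span_add[rotated])
  qed
qed

lemma fin_ext_trans: "fin_ext E F \<Longrightarrow> fin_ext F W \<Longrightarrow> fin_ext E W"
  unfolding fin_ext_def using lin_span_trans by (metis (no_types, lifting) finite_SigmaI finite_imageI subset_trans)

lemma fin_ext_mono: "fin_ext F W \<Longrightarrow> V \<subseteq> W \<Longrightarrow> fin_ext F V"
  unfolding fin_ext_def by blast

lemma fin_ext_mono_base:
  assumes "fin_ext E W" "E \<subseteq> F"
  shows "fin_ext F W"
proof -
  have "lin_span E B \<subseteq> lin_span F B" for B
  proof
    fix x assume "x \<in> lin_span E B"
    then show "x \<in> lin_span F B"
      by induction (use assms(2) in \<open>auto intro: lin_span.intros\<close>)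
  qed
  then show ?thesis using assms(1) unfolding fin_ext_def by blast
qed

lemma fin_ext_refl: "fin_ext F F"
  unfolding fin_ext_def
  by (rule exI[of _ "{1}"]) (auto intro: lin_span_base[of _ F 1 "{1}", simplified])

lemma lin_span_insertD:
  assumes "is_subfield F" "x \<in> lin_span F (insert b B)"
  shows "\<exists>c\<in>F. x - c * b \<in> lin_span F B"
  using assms(2)
proof (induction rule: lin_span.induct)
  case lin_span_0
  show ?case by (rule bexI[of _ 0]) (auto simp: lin_span.lin_span_0 subfield_0 assms)
next
  case (lin_span_step x k d)
  then obtain c where c: "c \<in> F" "x - c * b \<in> lin_span F B" by blast
  show ?case
  proof (cases "d \<in> B")
    case True
    then show ?thesis using lin_span.lin_span_step[OF c(2) lin_span_step.hyps(2) True] c(1)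
      by (intro bexI[of _ c]) (auto simp: algebra_simps)
  next
    case False
    then have "d = b" using lin_span_step by auto
    then show ?thesis using c lin_span_step.hyps(2) assms(1)
      by (intro bexI[of _ "c + k"]) (auto simp: algebra_simps subfield_add)
  qed
qed

text \<open>Gaussian elimination by induction on the spanning set: a vector with nonzero coefficient
  at the removed \<open>b\<close> is the pivot and clears \<open>b\<close> from all the
  others.\<close>

lemma linear_dependence:
  assumes "is_subfield F" "finite B" "finite I" "card I > card B" "\<And>i. i \<in> I \<Longrightarrow> w i \<in> lin_span F B"
  shows "\<exists>k. (\<forall>i\<in>I. k i \<in> F) \<and> (\<exists>i\<in>I. k i \<noteq> 0) \<and> (\<Sum>i\<in>I. k i * w i) = 0"
  using assms(2-5)
proof (induction B arbitrary: I w rule: finite_induct)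
  case empty
  have "w i = 0" if "i \<in> I" for i
    using empty.prems(3)[OF that] by (cases rule: lin_span.cases) auto
  moreover have "I \<noteq> {}" using empty.prems by auto
  ultimately show ?case by (intro exI[of _ "\<lambda>_. 1"]) (auto simp: assms subfield_1)
next
  case (insert b B)
  have "\<forall>i\<in>I. \<exists>c\<in>F. w i - c * b \<in> lin_span F B"
    using insert.prems lin_span_insertD[OF assms(1)] by blast
  then obtain c where c: "\<And>i. i \<in> I \<Longrightarrow> c i \<in> F" "\<And>i. i \<in> I \<Longrightarrow> w i - c i * b \<in> lin_span F B"
    by metis
  show ?case
  proof (cases "\<forall>i\<in>I. c i = 0")
    case True
    then show ?thesis using insert.IH[of I w] insert.prems insert.hyps c(2) by simp
  next
    case False
    then obtain j where j: "j \<in> I" "c j \<noteq> 0" by blast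
    define v where "v i = w i - (c i / c j) * w j" for i
    have "v i \<in> lin_span F B" if "i \<in> I" for i
    proof -
      have "v i = (w i - c i * b) + (- (c i / c j)) * (w j - c j * b)"
        using j by (simp add: v_def field_simps)
      moreover have "- (c i / c j) \<in> F" using c(1) that j by (simp add: assms(1) subfield_closed)
      ultimately show ?thesis
        using c(2)[OF that] c(2)[OF j(1)] by (metis lin_span_add lin_span_smult[OF assms(1)])
    qed
    moreover have "card (I - {j}) > card B"
      using insert.prems insert.hyps j by simp
    ultimately obtain k where k: "\<forall>i\<in>I-{j}. k i \<in> F" "\<exists>i\<in>I-{j}. k i \<noteq> 0" "(\<Sum>i\<in>I-{j}. k i * v i) = 0"
      using insert.IH[of "I - {j}" v] insert.prems(1) by auto
    \<comment> \<open>The coefficient at the pivot \<open>j\<close> compensates the multiples of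
      \<open>w j\<close> contained in the \<open>v i\<close>.\<close>
    define l where "l = k(j := - (\<Sum>i\<in>I-{j}. k i * (c i / c j)))"
    have "(\<Sum>i\<in>I. l i * w i) = l j * w j + (\<Sum>i\<in>I-{j}. l i * w i)"
      using insert.prems(1) j(1) by (rule sum.remove)
    also have "(\<Sum>i\<in>I-{j}. l i * w i) = (\<Sum>i\<in>I-{j}. k i * w i)"
      by (rule sum.cong) (auto simp: l_def)
    also have "\<dots> = (\<Sum>i\<in>I-{j}. k i * v i + k i * (c i / c j) * w j)"
      by (rule sum.cong) (auto simp: v_def algebra_simps)
    also have "\<dots> = (\<Sum>i\<in>I-{j}. k i * (c i / c j)) * w j"
      unfolding sum.distrib k(3) sum_distrib_right by simp
    also have "l j * w j + \<dots> = 0" by (simp add: l_def)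
    finally have "(\<Sum>i\<in>I. l i * w i) = 0" .
    moreover have "\<forall>i\<in>I. l i \<in> F"
      using k(1) c(1) j(1) unfolding l_def by (auto intro!: subfield_closed assms(1))
    moreover have "\<exists>i\<in>I. l i \<noteq> 0" using k(2) by (auto simp: l_def)
    ultimately show ?thesis by blast
  qed
qed

section \<open>Elements algebraic over a subfield\<close>

definition polys_over :: "'a::field set \<Rightarrow> 'a poly set" where
  "polys_over F = {P. \<forall>i. coeff P i \<in> F}"

definition algebraic_over :: "'a::field set \<Rightarrow> 'a \<Rightarrow> bool" where
  "algebraic_over F a \<longleftrightarrow> (\<exists>P\<in>polys_over F. P \<noteq> 0 \<and> poly P a = 0)"

lemma polys_over_closed:
  assumes "is_subfield F"
  shows "P \<in> polys_over F \<Longrightarrow> Q \<in> polys_over F \<Longrightarrow> P + Q \<in> polys_over F"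
    and "P \<in> polys_over F \<Longrightarrow> Q \<in> polys_over F \<Longrightarrow> P * Q \<in> polys_over F"
    and "P \<in> polys_over F \<Longrightarrow> - P \<in> polys_over F"
    and "c \<in> F \<Longrightarrow> [:c:] \<in> polys_over F"
    and "c \<in> F \<Longrightarrow> P \<in> polys_over F \<Longrightarrow> pCons c P \<in> polys_over F"
    and "0 \<in> polys_over F" and "1 \<in> polys_over F"
  by (auto simp: polys_over_def coeff_mult coeff_pCons coeff_1 subfield_closed[OF assms] split: nat.split)

lemma polys_over_prod:
  assumes "is_subfield F" "\<And>i. i \<in> I \<Longrightarrow> P i \<in> polys_over F"
  shows "prod P I \<in> polys_over F"
  using assms(2)
  by (induction I rule: infinite_finite_induct) (auto simp: polys_over_closed[OF assms(1)])

lemma polys_over_mono: "F \<subseteq> E \<Longrightarrow> polys_over F \<subseteq> polys_over E"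
  by (auto simp: polys_over_def)

lemma algebraic_over_mono: "algebraic_over F a \<Longrightarrow> F \<subseteq> E \<Longrightarrow> algebraic_over E a"
  unfolding algebraic_over_def using polys_over_mono by blast

lemma poly_sum_atMost: "degree (P :: 'a::field poly) \<le> n \<Longrightarrow> poly P x = (\<Sum>i\<le>n. coeff P i * x ^ i)"
  unfolding poly_altdef
  by (intro sum.mono_neutral_left) (auto simp: coeff_eq_0)

lemma coeff_sum_monom: "coeff (\<Sum>i\<le>n. monom (c i) i) j = (if j \<le> n then c j else 0)"
  by (simp add: coeff_sum if_distrib sum.delta)

lemma algebraic_over_sum:
  assumes "is_subfield F" "\<And>i. i \<le> n \<Longrightarrow> c i \<in> F" "j \<le> n" "c j \<noteq> 0" "(\<Sum>i\<le>n. c i * a ^ i) = 0"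
  shows "algebraic_over F a"
  unfolding algebraic_over_def
proof (intro bexI conjI)
  let ?P = "\<Sum>i\<le>n. monom (c i) i"
  show "?P \<in> polys_over F"
    unfolding polys_over_def using assms(1,2) by (auto simp: coeff_sum_monom subfield_0)
  show "?P \<noteq> 0" using assms(3,4) coeff_sum_monom[of c n j] by auto
  show "poly ?P a = 0" using assms(5) by (simp add: poly_sum poly_monom)
qed

text \<open>The span of the powers of \<open>c\<close> is itself a field: \<open>c ^ n\<close> in
  the span gives closure under products, and a linear relation among the powers of a nonzero
  \<open>x\<close> yields its inverse.\<close>

lemma gen_field_subset_lin_span:
  assumes F: "is_subfield F" and pow: "c ^ n \<in> lin_span F ((\<lambda>i. c ^ i) ` {..<n})" and n: "n > 0"
  shows "gen_field (insert c F) \<subseteq> lin_span F ((\<lambda>i. c ^ i) ` {..<n})"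
proof -
  let ?B = "(\<lambda>i. c ^ i) ` {..<n}"
  let ?R = "lin_span F ?B"
  have c_mult: "c * x \<in> ?R" if "x \<in> ?R" for x
    using that
  proof (induction rule: lin_span.induct)
    case lin_span_0
    show ?case by (simp add: lin_span.lin_span_0)
  next
    case (lin_span_step x k b)
    then obtain i where i: "i < n" "b = c ^ i" by auto
    have "k * c ^ Suc i \<in> ?R"
    proof (cases "Suc i < n")
      case True
      then show ?thesis using lin_span_step by (intro lin_span_base imageI) auto
    next
      case False
      then have "Suc i = n" using i by simp
      then show ?thesis using pow lin_span_step by (simp add: lin_span_smult[OF F] del: power_Suc)
    qed
    then show ?case using lin_span_add[OF lin_span_step.IH] by (simp add: i distrib_left mult.left_commute)
  qed
  have F_sub: "k \<in> ?R" if "k \<in> F" for k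
    using lin_span_base[of k F "c ^ 0" ?B] that n by force
  have one: "1 \<in> ?R" using F_sub subfield_1[OF F] by simp
  have c_pow: "c ^ i * x \<in> ?R" if "x \<in> ?R" for i x
    by (induction i) (auto simp: that c_mult mult.assoc)
  have mult: "x * y \<in> ?R" if "x \<in> ?R" "y \<in> ?R" for x y
    using that(1)
  proof (induction rule: lin_span.induct)
    case lin_span_0
    show ?case by (simp add: lin_span.lin_span_0)
  next
    case (lin_span_step x k b)
    then obtain i where i: "b = c ^ i" by auto
    have "k * (c ^ i * y) \<in> ?R"
      using lin_span_step that(2) by (intro lin_span_smult[OF F] c_pow) auto
    then show ?case using lin_span_add[OF lin_span_step.IH] by (simp add: i distrib_right mult.assoc)
  qed
  have pows: "x ^ i \<in> ?R" if "x \<in> ?R" for x i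
    by (induction i) (auto simp: one mult that)
  have inv: "inverse x \<in> ?R" if x: "x \<in> ?R" for x
  proof (cases "x = 0")
    case True
    then show ?thesis by (simp add: lin_span_0)
  next
    case False
    obtain k where k: "\<forall>i\<le>card ?B. k i \<in> F" "\<exists>i\<le>card ?B. k i \<noteq> 0" "(\<Sum>i\<le>card ?B. k i * x ^ i) = 0"
      using linear_dependence[OF F, of ?B "{..card ?B}" "\<lambda>i. x ^ i"] pows[OF x] by auto
    \<comment> \<open>The lowest nonzero coefficient. After division by \<open>x ^ m\<close> it is
      the constant term, so \<open>x\<close> times a polynomial in \<open>x\<close> equals
      \<open>- k m\<close>.\<close>
    define m where "m = (LEAST i. k i \<noteq> 0)"
    define N where "N = card ?B"
    have m: "k m \<noteq> 0" "m \<le> N" "\<And>i. i < m \<Longrightarrow> k i = 0"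
      unfolding m_def N_def using k(2) LeastI_ex[of "\<lambda>i. k i \<noteq> 0"]
      by (auto intro: Least_le[THEN order.trans] dest: not_less_Least)
    have "0 = (\<Sum>i\<in>{m..N}. k i * x ^ i)"
      unfolding k(3)[symmetric] N_def[symmetric] using m by (intro sum.mono_neutral_right) auto
    also have "\<dots> = k m * x ^ m + (\<Sum>i\<in>{Suc m..N}. k i * x ^ i)"
      using m(2) by (simp add: sum.atLeast_Suc_atMost)
    also have "(\<Sum>i\<in>{Suc m..N}. k i * x ^ i) = (\<Sum>i\<in>{Suc m..N}. x ^ Suc m * (k i * x ^ (i - Suc m)))"
    proof (rule sum.cong)
      fix i assume "i \<in> {Suc m..N}"
      then have "x ^ i = x ^ Suc m * x ^ (i - Suc m)"
        by (metis atLeastAtMost_iff le_add_diff_inverse power_add)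
      then show "k i * x ^ i = x ^ Suc m * (k i * x ^ (i - Suc m))" by (simp only: mult.left_commute)
    qed simp
    also have "\<dots> = x ^ Suc m * (\<Sum>i\<in>{Suc m..N}. k i * x ^ (i - Suc m))"
      by (simp add: sum_distrib_left)
    finally have "x ^ m * (k m + x * (\<Sum>i\<in>{Suc m..N}. k i * x ^ (i - Suc m))) = 0"
      by (simp add: algebra_simps)
    then have "x * (\<Sum>i\<in>{Suc m..N}. k i * x ^ (i - Suc m)) = - k m"
      using False by (simp add: eq_neg_iff_add_eq_0 add.commute)
    then have "inverse x = (- inverse (k m)) * (\<Sum>i\<in>{Suc m..N}. k i * x ^ (i - Suc m))"
      using m(1) False by (simp add: field_simps)
    moreover have "- inverse (k m) \<in> F" using k(1) m(2) F unfolding N_def by (simp add: subfield_closed)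
    moreover have "(\<Sum>i\<in>{Suc m..N}. k i * x ^ (i - Suc m)) \<in> ?R"
      using k(1) unfolding N_def by (intro lin_span_sum lin_span_smult[OF F] pows x) auto
    ultimately show ?thesis by (simp only: lin_span_smult[OF F])
  qed
  have "is_subfield ?R"
    unfolding is_subfield_def
    using lin_span_0 one lin_span_add mult inv lin_span_smult[OF F, of "- 1"] F
    by (auto simp: subfield_closed)
  moreover have "c \<in> ?R" using c_mult[OF one] by simp
  ultimately show ?thesis using F_sub by (intro gen_field_least) auto
qed

lemma fin_ext_insert:
  assumes F: "is_subfield F" and c: "algebraic_over F c"
  shows "fin_ext F (gen_field (insert c F))"
proof -
  obtain P where P: "P \<in> polys_over F" "P \<noteq> 0" "poly P c = 0"
    using c unfolding algebraic_over_def by blast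
  define n where "n = degree P"
  have n: "n > 0"
  proof (rule ccontr)
    assume "\<not> n > 0"
    then obtain a where "P = [:a:]" unfolding n_def by (auto elim: degree_eq_zeroE)
    then show False using P by simp
  qed
  have lc: "lead_coeff P \<noteq> 0" using P by simp
  have "(\<Sum>i<n. coeff P i * c ^ i) + lead_coeff P * c ^ n = 0"
    using P(3) unfolding poly_altdef n_def[symmetric] by (simp flip: lessThan_Suc_atMost)
  then have "c ^ n = (\<Sum>i<n. (- coeff P i / lead_coeff P) * c ^ i)"
    using lc by (simp add: field_simps sum_negf eq_neg_iff_add_eq_0 flip: sum_divide_distrib)
  moreover have "- coeff P i / lead_coeff P \<in> F" for i
    using P(1) F unfolding polys_over_def by (auto intro!: subfield_closed)
  ultimately have "c ^ n \<in> lin_span F ((\<lambda>i. c ^ i) ` {..<n})"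
    by (simp only:) (intro lin_span_sum lin_span_base imageI)
  then show ?thesis
    using gen_field_subset_lin_span[OF F _ n] unfolding fin_ext_def by blast
qed

text \<open>There are \<open>card B + 1\<close> powers of \<open>a\<close> in the span of
  \<open>card B\<close> elements; a linear relation among them is a polynomial equation for
  \<open>a\<close>.\<close>

lemma fin_ext_algebraic:
  assumes F: "is_subfield F" and W: "fin_ext F W" "is_subfield W" "a \<in> W"
  shows "algebraic_over F a"
proof -
  obtain B where B: "finite B" "W \<subseteq> lin_span F B" using W(1) unfolding fin_ext_def by blast
  have "a ^ i \<in> lin_span F B" for i using subfield_power[OF W(2,3)] B by blast
  then obtain k where k: "\<forall>i\<le>card B. k i \<in> F" "\<exists>i\<le>card B. k i \<noteq> 0" "(\<Sum>i\<le>card B. k i * a ^ i) = 0"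
    using linear_dependence[OF F, of B "{..card B}" "\<lambda>i. a ^ i"] B(1) by auto
  then show ?thesis using algebraic_over_sum[OF F, of "card B" k] by blast
qed

lemma algebraic_over_member: "is_subfield F \<Longrightarrow> a \<in> F \<Longrightarrow> algebraic_over F a"
  using fin_ext_algebraic fin_ext_refl by blast

section \<open>The exchange property and transcendence degree\<close>

lemma gen_field_insert_cases:
  assumes F: "is_subfield F" and x: "x \<in> gen_field (insert a F)"
  obtains P Q where "P \<in> polys_over F" "Q \<in> polys_over F" "poly Q a \<noteq> 0" "x = poly P a / poly Q a"
proof -
  let ?R = "{poly P a / poly Q a | P Q. P \<in> polys_over F \<and> Q \<in> polys_over F \<and> poly Q a \<noteq> 0}"
  define R where "R = ?R"
  have RI: "poly P a / poly Q a \<in> R" if "P \<in> polys_over F" "Q \<in> polys_over F" "poly Q a \<noteq> 0" for P Q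
    using that unfolding R_def by blast
  note cl = polys_over_closed[OF F]
  have const: "c \<in> R" if "c \<in> F" for c
    using RI[of "[:c:]" 1] that by (simp add: cl)
  have "is_subfield R"
    unfolding is_subfield_def
  proof (intro conjI ballI)
    show "0 \<in> R" "1 \<in> R" using const F by (auto simp: subfield_0 subfield_1)
  next
    fix x y assume "x \<in> R" "y \<in> R"
    then obtain P Q P' Q' where *: "x = poly P a / poly Q a" "y = poly P' a / poly Q' a"
      "P \<in> polys_over F" "Q \<in> polys_over F" "P' \<in> polys_over F" "Q' \<in> polys_over F"
      "poly Q a \<noteq> 0" "poly Q' a \<noteq> 0" unfolding R_def by blast
    show "x + y \<in> R"
      using RI[of "P * Q' + P' * Q" "Q * Q'"] * by (simp add: cl add_frac_eq)
    show "x * y \<in> R"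
      using RI[of "P * P'" "Q * Q'"] * by (simp add: cl)
  next
    fix x assume "x \<in> R"
    then obtain P Q where *: "x = poly P a / poly Q a"
      "P \<in> polys_over F" "Q \<in> polys_over F" "poly Q a \<noteq> 0" unfolding R_def by blast
    show "- x \<in> R" using RI[of "- P" Q] * by (simp add: cl)
    show "inverse x \<in> R"
      using RI[of Q P] * const[of 0] F
      by (cases "poly P a = 0") (simp_all add: cl subfield_0)
  qed
  moreover have "a \<in> R" using RI[of "[:0, 1:]" 1] F by (simp add: cl subfield_closed)
  ultimately have "gen_field (insert a F) \<subseteq> R" using const by (intro gen_field_least) auto
  then show ?thesis using x that unfolding R_def by blast
qed

text \<open>With denominators cleared, an equation for \<open>b\<close> over F(a) is a polynomial
  relation between \<open>a\<close> and \<open>b\<close> over \<open>F\<close>. Sorted by powers of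
  \<open>a\<close> it becomes an equation for \<open>a\<close> over F(b); it is nontrivial because
  \<open>b\<close> is transcendental over \<open>F\<close>.\<close>

lemma algebraic_exchange:
  assumes F: "is_subfield F" and b: "algebraic_over (gen_field (insert a F)) b" "\<not> algebraic_over F b"
  shows "algebraic_over (gen_field (insert b F)) a"
proof -
  let ?Fb = "gen_field (insert b F)"
  obtain P where P: "P \<in> polys_over (gen_field (insert a F))" "P \<noteq> 0" "poly P b = 0"
    using b(1) unfolding algebraic_over_def by blast
  define n where "n = degree P"
  have "\<forall>i. \<exists>N D. N \<in> polys_over F \<and> D \<in> polys_over F \<and> poly D a \<noteq> 0 \<and> coeff P i = poly N a / poly D a"
  proof
    fix i
    have "coeff P i \<in> gen_field (insert a F)" using P(1) unfolding polys_over_def by blast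
    then show "\<exists>N D. N \<in> polys_over F \<and> D \<in> polys_over F \<and> poly D a \<noteq> 0 \<and> coeff P i = poly N a / poly D a"
      by (rule gen_field_insert_cases[OF F]) blast
  qed
  then obtain N D where ND: "\<And>i. N i \<in> polys_over F" "\<And>i. D i \<in> polys_over F"
    "\<And>i. poly (D i) a \<noteq> 0" "\<And>i. coeff P i = poly (N i) a / poly (D i) a"
    by metis
  \<comment> \<open>The \<open>i\<close>-th coefficient of \<open>P\<close> multiplied by all
    denominators, as a polynomial to be evaluated at \<open>a\<close>.\<close>
  define R where "R i = N i * (\<Prod>j\<in>{..n}-{i}. D j)" for i
  have R_F: "R i \<in> polys_over F" for i
    unfolding R_def by (intro polys_over_closed(2)[OF F] polys_over_prod[OF F] ND)
  have R: "poly (R i) a = coeff P i * (\<Prod>j\<le>n. poly (D j) a)" if "i \<le> n" for i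
  proof -
    have "(\<Prod>j\<le>n. poly (D j) a) = poly (D i) a * (\<Prod>j\<in>{..n}-{i}. poly (D j) a)"
      using that by (intro prod.remove) auto
    then show ?thesis using ND by (simp add: R_def poly_prod)
  qed
  have sum0: "(\<Sum>i\<le>n. poly (R i) a * b ^ i) = 0"
  proof -
    have "(\<Sum>i\<le>n. poly (R i) a * b ^ i) = (\<Prod>j\<le>n. poly (D j) a) * (\<Sum>i\<le>n. coeff P i * b ^ i)"
      by (simp add: R sum_distrib_left algebra_simps)
    then show ?thesis using P(3) by (simp add: poly_altdef n_def)
  qed
  define d where "d = Max ((\<lambda>i. degree (R i)) ` {..n})"
  have d: "degree (R i) \<le> d" if "i \<le> n" for i
    unfolding d_def using that by (intro Max_ge) auto
  define c where "c j = (\<Sum>i\<le>n. coeff (R i) j * b ^ i)" for j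
  have Fb: "is_subfield ?Fb" by (rule is_subfield_gen_field)
  have c_in: "c j \<in> ?Fb" for j
    unfolding c_def using gen_field_superset[of "insert b F"] R_F
    by (intro subfield_closed Fb) (auto simp: polys_over_def)
  have "(\<Sum>j\<le>d. c j * a ^ j) = (\<Sum>j\<le>d. \<Sum>i\<le>n. coeff (R i) j * a ^ j * b ^ i)"
    unfolding c_def sum_distrib_right by (simp add: algebra_simps)
  also have "\<dots> = (\<Sum>i\<le>n. \<Sum>j\<le>d. coeff (R i) j * a ^ j * b ^ i)" by (rule sum.swap)
  also have "\<dots> = (\<Sum>i\<le>n. poly (R i) a * b ^ i)"
    by (rule sum.cong) (use d in \<open>simp_all add: poly_sum_atMost[of _ d] sum_distrib_right\<close>)
  finally have sum_c: "(\<Sum>j\<le>d. c j * a ^ j) = 0" using sum0 by simp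
  have "poly (R n) a \<noteq> 0" using R[of n] ND(3) P(2) by (simp add: n_def)
  then have "R n \<noteq> 0" by auto
  \<comment> \<open>In \<open>c j\<close> the power \<open>b ^ n\<close> has the leading coefficient
    of \<open>R n\<close>, which is nonzero; so \<open>c j = 0\<close> would be an equation for
    \<open>b\<close> over \<open>F\<close>.\<close>
  define j where "j = degree (R n)"
  have j: "coeff (R n) j \<noteq> 0" "j \<le> d" using \<open>R n \<noteq> 0\<close> d[of n] by (auto simp: j_def)
  have "c j \<noteq> 0"
  proof
    assume "c j = 0"
    then have "algebraic_over F b"
      using j(1) R_F unfolding c_def
      by (intro algebraic_over_sum[OF F, of n "\<lambda>i. coeff (R i) j" n]) (auto simp: polys_over_def)
    then show False using b(2) by contradiction
  qed
  then show ?thesis using algebraic_over_sum[OF Fb, of d c j] c_in j(2) sum_c by blast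
qed

text \<open>Independence in the matroid of algebraic dependence, the form that exchange works with.
  \<open>eval_poly_indep\<close> leads from it to the absence of polynomial relations.\<close>

definition indep_over :: "'a::field set \<Rightarrow> 'a set \<Rightarrow> bool" where
  "indep_over K S \<longleftrightarrow> (\<forall>s\<in>S. \<not> algebraic_over (gen_field (K \<union> (S - {s}))) s)"

lemma indep_over_notin:
  assumes "indep_over K S" "T \<subseteq> S" "s \<in> S" "s \<notin> T"
  shows "\<not> algebraic_over (gen_field (K \<union> T)) s"
  using assms algebraic_over_mono[of "gen_field (K \<union> T)" s "gen_field (K \<union> (S - {s}))"]
    gen_field_mono[of "K \<union> T" "K \<union> (S - {s})"]
  unfolding indep_over_def by blast

text \<open>The elements of \<open>Y\<close> are brought in one at a time, each displacing an
  element of \<open>S\<close>, while \<open>W\<close> stays finite over the generated field.\<close>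

lemma steinitz_exchange:
  assumes W: "is_subfield W" and X: "indep_over K X" "X \<subseteq> W"
    and S: "finite S" "fin_ext (gen_field (K \<union> S)) W"
    and Y: "finite Y" "Y \<subseteq> X"
  shows "\<exists>T\<subseteq>S. card T + card Y \<le> card S \<and> fin_ext (gen_field (K \<union> Y \<union> T)) W"
  using Y
proof (induction Y rule: finite_induct)
  case empty
  then show ?case using S by (intro exI[of _ S]) auto
next
  case (insert y Y)
  then obtain T where T: "T \<subseteq> S" "card T + card Y \<le> card S" "fin_ext (gen_field (K \<union> Y \<union> T)) W"
    by auto
  have finT: "finite T" using T S finite_subset by auto
  have alg: "algebraic_over (gen_field (K \<union> Y \<union> T)) y"
    using fin_ext_algebraic[OF is_subfield_gen_field T(3) W] insert X by auto
  let ?A = "\<lambda>U. U \<subseteq> T \<and> algebraic_over (gen_field (K \<union> Y \<union> U)) y"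
  have "?A T" using alg by simp
  \<comment> \<open>For a minimal \<open>U\<close>, leaving out any \<open>u\<close> makes
    \<open>y\<close> transcendental, so exchange applies to \<open>u\<close> and \<open>y\<close>.
    Independence of \<open>X\<close> ensures that \<open>U\<close> has an element to
    displace.\<close>
  then obtain U where U: "?A U" and U_min: "\<And>V. ?A V \<Longrightarrow> card U \<le> card V"
    using ex_has_least_nat[of ?A T card] by auto
  have "U \<noteq> {}"
    using U indep_over_notin[OF X(1), of Y y] insert by auto
  then obtain u where u: "u \<in> U" by blast
  let ?E = "gen_field (K \<union> Y \<union> (U - {u}))"
  have "\<not> ?A (U - {u})"
    using U_min[of "U - {u}"] u U finite_subset[OF _ finT, of U] by (auto simp: card_Diff1_less_iff dest: card_Diff1_less)
  then have "\<not> algebraic_over ?E y" using U by auto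
  moreover have "algebraic_over (gen_field (insert u ?E)) y"
  proof -
    have "insert u (K \<union> Y \<union> (U - {u})) = K \<union> Y \<union> U" using u by auto
    then show ?thesis using U by (simp add: gen_field_insert_gen_field)
  qed
  ultimately have "algebraic_over (gen_field (insert y ?E)) u"
    by (rule algebraic_exchange[OF is_subfield_gen_field, rotated])
  moreover let ?F = "gen_field (K \<union> insert y Y \<union> (T - {u}))"
  have "gen_field (insert y ?E) \<subseteq> ?F"
    unfolding gen_field_insert_gen_field using U by (intro gen_field_mono) auto
  ultimately have "algebraic_over ?F u" by (rule algebraic_over_mono)
  then have "fin_ext ?F (gen_field (insert u ?F))"
    by (intro fin_ext_insert is_subfield_gen_field)
  moreover have "gen_field (K \<union> Y \<union> T) \<subseteq> gen_field (insert u ?F)"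
    unfolding gen_field_insert_gen_field by (intro gen_field_mono) auto
  then have "fin_ext (gen_field (insert u ?F)) W" using T(3) by (rule fin_ext_mono_base[rotated])
  ultimately have "fin_ext ?F W" by (rule fin_ext_trans)
  moreover have "card (T - {u}) + card (insert y Y) \<le> card S"
    using u U finT T(2) insert card_gt_0_iff[of T] by (auto simp: card_Diff_singleton)
  ultimately show ?case using T(1) by (intro exI[of _ "T - {u}"]) auto
qed

lemma indep_card_le:
  assumes W: "is_subfield W" and X: "indep_over K X" "X \<subseteq> W" "finite X"
    and S: "finite S" "fin_ext (gen_field (K \<union> S)) W"
  shows "card X \<le> card S"
  using steinitz_exchange[OF W X(1,2) S X(3) subset_refl] by auto

text \<open>An element algebraic over the others could be dropped, and \<open>W\<close> would be
  finite over a field with fewer than \<open>card X\<close> generators. This derives the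
  independence of the invariants from their number.\<close>

lemma spanning_set_indep:
  assumes W: "is_subfield W" and X: "indep_over K X" "X \<subseteq> W" "finite X"
    and S: "finite S" "fin_ext (gen_field (K \<union> S)) W" "card S \<le> card X"
  shows "indep_over K S"
  unfolding indep_over_def
proof (intro ballI notI)
  fix s assume s: "s \<in> S" "algebraic_over (gen_field (K \<union> (S - {s}))) s"
  let ?E = "gen_field (K \<union> (S - {s}))"
  have "insert s (K \<union> (S - {s})) = K \<union> S" using s by auto
  then have "gen_field (insert s ?E) = gen_field (K \<union> S)"
    by (simp add: gen_field_insert_gen_field)
  then have "fin_ext ?E (gen_field (K \<union> S))"
    using fin_ext_insert[OF is_subfield_gen_field s(2)] by simp
  then have "fin_ext ?E W" using S(2) by (rule fin_ext_trans)
  then have "card X \<le> card (S - {s})" using S(1) by (intro indep_card_le[OF W X]) auto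
  then show False using S s by (metis card_Diff1_less not_le order.strict_trans2)
qed

section \<open>Field homomorphisms, roots of unity and Kummer extensions\<close>

definition field_hom :: "('a::field \<Rightarrow> 'b::field) \<Rightarrow> bool" where
  "field_hom f \<longleftrightarrow> (\<forall>x y. f (x + y) = f x + f y) \<and> (\<forall>x y. f (x * y) = f x * f y) \<and> f 1 = 1"

context
  fixes f :: "'a::field \<Rightarrow> 'b::field"
  assumes f: "field_hom f"
begin

lemma field_hom_add: "f (x + y) = f x + f y"
  and field_hom_mult: "f (x * y) = f x * f y"
  and field_hom_1: "f 1 = 1"
  using f unfolding field_hom_def by blast+

lemma field_hom_0: "f 0 = 0"
  using field_hom_add[of 0 0] by (metis add.right_neutral add_left_cancel)

lemma field_hom_uminus: "f (- x) = - f x"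
  using field_hom_add[of x "- x"] field_hom_0 by (simp add: eq_neg_iff_add_eq_0 add.commute)

lemma field_hom_diff: "f (x - y) = f x - f y"
  using field_hom_add[of x "- y"] by (simp add: field_hom_uminus)

lemma field_hom_inverse: "f (inverse x) = inverse (f x)"
proof (cases "x = 0")
  case True
  then show ?thesis by (simp add: field_hom_0)
next
  case False
  then have "f x * f (inverse x) = 1" by (simp add: field_hom_1 flip: field_hom_mult)
  then show ?thesis by (metis inverse_unique)
qed

lemma field_hom_divide: "f (x / y) = f x / f y"
  by (simp add: divide_inverse field_hom_mult field_hom_inverse)

lemma field_hom_power: "f (x ^ n) = f x ^ n"
  by (induction n) (auto simp: field_hom_1 field_hom_mult)

lemma field_hom_sum: "f (sum g I) = (\<Sum>i\<in>I. f (g i))"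
  by (induction I rule: infinite_finite_induct) (auto simp: field_hom_0 field_hom_add)

lemma field_hom_eq_0_iff: "f x = 0 \<longleftrightarrow> x = 0"
proof
  assume "f x = 0"
  then show "x = 0" using field_hom_mult[of x "inverse x"] field_hom_1 by (cases "x = 0") auto
qed (simp add: field_hom_0)

lemma is_subfield_image: "is_subfield F \<Longrightarrow> is_subfield (f ` F)"
  unfolding is_subfield_def
  using field_hom_0 field_hom_1 field_hom_add field_hom_mult field_hom_uminus field_hom_inverse
  by (auto simp: image_iff) metis+

lemmas field_hom_simps = field_hom_0 field_hom_1 field_hom_add field_hom_mult field_hom_uminus
  field_hom_diff field_hom_inverse field_hom_divide field_hom_power field_hom_sum

end

lemma gen_field_hom_fixed:
  assumes "field_hom f" "\<And>x. x \<in> S \<Longrightarrow> f x = x" "x \<in> gen_field S"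
  shows "f x = x"
proof -
  have "is_subfield {x. f x = x}"
    unfolding is_subfield_def by (auto simp: field_hom_simps[OF assms(1)])
  then have "gen_field S \<subseteq> {x. f x = x}" using assms(2) by (intro gen_field_least) auto
  then show ?thesis using assms(3) by auto
qed

text \<open>In characteristic \<open>p\<close> the Frobenius identity would give
  \<open>(\<zeta> - 1) ^ p = \<zeta> ^ p - 1 = 0\<close>, hence \<open>\<zeta> = 1\<close>.\<close>

lemma root_of_unity_of_nat_neq_0:
  fixes \<zeta> :: "'a::field"
  assumes p: "Factorial_Ring.prime p" and \<zeta>: "primitive_root_of_unity p \<zeta>"
  shows "(of_nat p :: 'a) \<noteq> 0"
proof
  assume "(of_nat p :: 'a) = 0"
  then have "CHAR('a) dvd p" by (simp add: of_nat_eq_0_iff_char_dvd)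
  then have char: "CHAR('a) = p" using p by (metis CHAR_not_1' One_nat_def prime_nat_iff)
  have "((\<zeta> - 1) + 1) ^ p = (\<zeta> - 1) ^ p + 1 ^ p"
    by (rule freshmans_dream) (use char p in auto)
  then have "\<zeta> ^ 1 = 1" using \<zeta> by (simp add: primitive_root_of_unity_def)
  then show False using \<zeta> prime_gt_1_nat[OF p] unfolding primitive_root_of_unity_def by blast
qed

lemma sum_powers_root_of_unity:
  fixes u :: "'a::field"
  assumes "u ^ p = 1" "u \<noteq> 1"
  shows "(\<Sum>j<p. u ^ j) = 0"
  using one_diff_power_eq[of u p] assms by auto

lemma primitive_root_inj:
  fixes \<zeta> :: "'a::field"
  assumes "primitive_root_of_unity p \<zeta>" "i < p" "j < p" "\<zeta> ^ i = \<zeta> ^ j"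
  shows "i = j"
proof -
  have nz: "\<zeta> \<noteq> 0" using assms(1) unfolding primitive_root_of_unity_def by (auto simp: power_0_left)
  have *: "i = j" if "i \<le> j" "j < p" "\<zeta> ^ i = \<zeta> ^ j" for i j
  proof -
    have "\<zeta> ^ j = \<zeta> ^ i * \<zeta> ^ (j - i)" using that(1) by (metis le_add_diff_inverse power_add)
    then have "\<zeta> ^ (j - i) = 1" using that nz by simp
    then show ?thesis using assms(1) that unfolding primitive_root_of_unity_def
      by (metis diff_is_0_eq le_antisym less_imp_diff_less not_gr_zero)
  qed
  show ?thesis using *[of i j] *[of j i] assms by (cases "i \<le> j") auto
qed

text \<open>Fourier inversion on the cyclic group of order \<open>p\<close>: by orthogonality of
  characters, the transforms combine to \<open>of_nat p * y m\<close> with coefficients in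
  \<open>F\<close>.\<close>

lemma dft_inversion:
  fixes w :: "'a::field"
  assumes F: "is_subfield F" and p: "(of_nat p :: 'a) \<noteq> 0"
    and w: "primitive_root_of_unity p w" "w \<in> F"
    and dft: "\<And>j. j < p \<Longrightarrow> (\<Sum>i<p. w ^ (i * j) * y i) \<in> F" and m: "m < p"
  shows "y m \<in> F"
proof -
  have nz: "w \<noteq> 0" and wp: "w ^ p = 1"
    using w(1) unfolding primitive_root_of_unity_def by (auto simp: power_0_left)
  have eq: "(\<Sum>j<p. inverse w ^ (m * j) * w ^ (i * j)) = (if i = m then of_nat p else 0)" if "i < p" for i
  proof -
    \<comment> \<open>A \<open>p\<close>-th root of unity that equals 1 only for
      \<open>i = m\<close>, as \<open>w\<close> is primitive; otherwise its powers sum to 0.\<close>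
    define u where "u = w ^ i * inverse w ^ m"
    have "u ^ p = (w ^ p) ^ i * inverse (w ^ p) ^ m"
      unfolding u_def by (simp add: power_mult_distrib power_inverse mult.commute flip: power_mult)
    then have "u ^ p = 1" using wp by simp
    moreover have "u = 1 \<longleftrightarrow> i = m"
    proof
      assume "u = 1"
      then have "w ^ i = w ^ m" using nz unfolding u_def by (simp add: field_simps)
      then show "i = m" using primitive_root_inj[OF w(1) that m] by simp
    qed (use nz in \<open>simp add: u_def field_simps\<close>)
    ultimately have "(\<Sum>j<p. u ^ j) = (if i = m then of_nat p else 0)"
      using sum_powers_root_of_unity[of u p] by auto
    moreover have "u ^ j = inverse w ^ (m * j) * w ^ (i * j)" for j
      unfolding u_def by (simp add: power_mult_distrib power_mult)
    ultimately show ?thesis by simp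
  qed
  have "(\<Sum>j<p. inverse w ^ (m * j) * (\<Sum>i<p. w ^ (i * j) * y i)) =
      (\<Sum>j<p. \<Sum>i<p. inverse w ^ (m * j) * w ^ (i * j) * y i)"
    by (simp add: sum_distrib_left mult.assoc)
  also have "\<dots> = (\<Sum>i<p. (\<Sum>j<p. inverse w ^ (m * j) * w ^ (i * j)) * y i)"
    unfolding sum_distrib_right by (rule sum.swap)
  also have "\<dots> = (\<Sum>i<p. if i = m then of_nat p * y i else 0)"
    by (rule sum.cong) (auto simp: eq)
  also have "\<dots> = of_nat p * y m" using m by (simp add: sum.delta)
  finally have "y m = (\<Sum>j<p. inverse w ^ (m * j) * (\<Sum>i<p. w ^ (i * j) * y i)) / of_nat p"
    using p by (simp add: field_simps)
  also have "\<dots> \<in> F"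
  proof (intro subfield_divide[OF F] subfield_sum[OF F] subfield_of_nat[OF F])
    fix j assume "j \<in> {..<p}"
    then show "inverse w ^ (m * j) * (\<Sum>i<p. w ^ (i * j) * y i) \<in> F"
      by (intro subfield_mult[OF F dft] subfield_mult[OF F] subfield_power[OF F] subfield_inverse[OF F]
          w(2) dft) auto
  qed
  finally show ?thesis .
qed

lemma lin_span_powers:
  assumes F: "is_subfield F" and "a \<in> lin_span F ((\<lambda>i. y ^ i) ` {..<n})"
  shows "\<exists>c. (\<forall>i<n. c i \<in> F) \<and> a = (\<Sum>i<n. c i * y ^ i)"
  using assms(2)
proof (induction rule: lin_span.induct)
  case lin_span_0
  show ?case by (rule exI[of _ "\<lambda>_. 0"]) (auto simp: subfield_0 F)
next
  case (lin_span_step x k b)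
  then obtain c j where c: "\<forall>i<n. c i \<in> F" "x = (\<Sum>i<n. c i * y ^ i)" and j: "j < n" "b = y ^ j" by blast
  have "(\<Sum>i<n. (c(j := c j + k)) i * y ^ i) = (\<Sum>i<n. c i * y ^ i + (if i = j then k * y ^ j else 0))"
    by (rule sum.cong) (auto simp: algebra_simps)
  also have "\<dots> = x + k * b" using j by (simp add: sum.distrib sum.delta c)
  finally show ?case
    using c(1) lin_span_step.hyps(2) F by (intro exI[of _ "c(j := c j + k)"]) (auto simp: subfield_closed)
qed

section \<open>Kummer extensions\<close>

lemma kummer_gen_field_span:
  assumes F: "is_subfield F" and "y ^ p \<in> F" "p > 0"
  shows "gen_field (insert y F) \<subseteq> lin_span F ((\<lambda>i. y ^ i) ` {..<p})"
proof (rule gen_field_subset_lin_span[OF F _ assms(3)])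
  show "y ^ p \<in> lin_span F ((\<lambda>i. y ^ i) ` {..<p})"
    using lin_span_base[of "y ^ p" F "y ^ 0"] assms by (metis imageI lessThan_iff mult.right_neutral power_0)
qed

text \<open>Averaging over the powers of \<open>s\<close> multiplies the term
  \<open>c i * y ^ i\<close> by the mean of the powers of \<open>\<zeta> ^ i\<close>, which vanishes
  unless \<open>i = 0\<close>. This applies to any expansion of \<open>a\<close> in powers of
  \<open>y\<close>, so the degree of the extension never enters.\<close>

lemma kummer_fixed:
  fixes y :: "'a::field"
  assumes F: "is_subfield F" and p: "(of_nat p :: 'a) \<noteq> 0"
    and \<zeta>: "primitive_root_of_unity p \<zeta>" "\<zeta> \<in> F"
    and s: "field_hom s" "\<And>x. x \<in> F \<Longrightarrow> s x = x" "s y = \<zeta> * y"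
    and y: "y ^ p \<in> F"
    and a: "a \<in> gen_field (insert y F)" "s a = a"
  shows "a \<in> F"
proof -
  have p0: "p > 0" using \<zeta>(1) by (simp add: primitive_root_of_unity_def)
  obtain c where c: "\<forall>i<p. c i \<in> F" "a = (\<Sum>i<p. c i * y ^ i)"
    using lin_span_powers[OF F] kummer_gen_field_span[OF F y p0] a(1) by blast
  note hom = field_hom_simps[OF s(1)]
  have conj: "a = (\<Sum>i<p. c i * y ^ i * (\<zeta> ^ i) ^ k)" for k
  proof (induction k)
    case 0
    show ?case using c(2) by simp
  next
    case (Suc k)
    have "a = s (\<Sum>i<p. c i * y ^ i * (\<zeta> ^ i) ^ k)" using Suc a(2) by simp
    also have "\<dots> = (\<Sum>i<p. c i * y ^ i * (\<zeta> ^ i) ^ Suc k)"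
      using c(1) s(2)[OF \<zeta>(2)] by (simp add: hom s algebra_simps power_mult_distrib)
    finally show ?case .
  qed
  have "of_nat p * a = (\<Sum>k<p. \<Sum>i<p. c i * y ^ i * (\<zeta> ^ i) ^ k)"
    by (simp flip: conj)
  also have "\<dots> = (\<Sum>i<p. c i * y ^ i * (\<Sum>k<p. (\<zeta> ^ i) ^ k))"
    unfolding sum_distrib_left by (rule sum.swap)
  also have "\<dots> = (\<Sum>i<p. if i = 0 then c 0 * of_nat p else 0)"
  proof (rule sum.cong[OF refl])
    fix i assume "i \<in> {..<p}"
    moreover have "(\<Sum>k<p. (\<zeta> ^ i) ^ k) = 0" if "i \<noteq> 0"
    proof (rule sum_powers_root_of_unity)
      show "(\<zeta> ^ i) ^ p = 1"
        using \<zeta>(1) by (metis power_commutes power_mult mult.commute power_one primitive_root_of_unity_def)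
      show "\<zeta> ^ i \<noteq> 1"
        using \<zeta>(1) \<open>i \<in> {..<p}\<close> that by (auto simp: primitive_root_of_unity_def)
    qed
    ultimately show "c i * y ^ i * (\<Sum>k<p. (\<zeta> ^ i) ^ k) = (if i = 0 then c 0 * of_nat p else 0)" by auto
  qed
  also have "\<dots> = of_nat p * c 0" using p0 by (simp add: sum.delta)
  finally have "a = c 0" using p by simp
  then show ?thesis using c(1) p0 by simp
qed

lemma kummer_fin_ext:
  assumes "is_subfield F" "y ^ p \<in> F" "p > 0"
  shows "fin_ext F (gen_field (insert y F))"
  using kummer_gen_field_span[OF assms] unfolding fin_ext_def by blast

lemma sum_shift_periodic:
  assumes "\<And>i::nat. h (i + p) = h i"
  shows "(\<Sum>i<p. h (i + k)) = (\<Sum>i<p. h i :: 'a::ab_group_add)"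
proof (induction k)
  case (Suc k)
  have "(\<Sum>i<p. h (i + k)) + h (p + k) = h k + (\<Sum>i<p. h (Suc i + k))"
    using sum.lessThan_Suc_shift[of "\<lambda>i. h (i + k)" p] by simp
  then show ?case using Suc assms[of k] by (simp add: add.commute)
qed simp

section \<open>The monomial action\<close>

lemma primitive_root_inverse:
  fixes \<zeta> :: "'a::field"
  shows "primitive_root_of_unity p \<zeta> \<Longrightarrow> primitive_root_of_unity p (inverse \<zeta>)"
  unfolding primitive_root_of_unity_def by (auto simp: power_inverse)

text \<open>Carries transcendence from a variable to a linear form in which that variable has
  coefficient 1 and the rest lies in \<open>F\<close>.\<close>

lemma algebraic_over_translate:
  assumes F: "is_subfield F" and "t \<in> F" "algebraic_over F (a + t)"
  shows "algebraic_over F a"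
proof (rule fin_ext_algebraic[OF F fin_ext_insert[OF F assms(3)] is_subfield_gen_field])
  have "a + t \<in> gen_field (insert (a + t) F)" "t \<in> gen_field (insert (a + t) F)"
    using gen_field_superset[of "insert (a + t) F"] assms(2) by auto
  then have "(a + t) - t \<in> gen_field (insert (a + t) F)"
    by (rule subfield_diff[OF is_subfield_gen_field])
  then show "a \<in> gen_field (insert (a + t) F)" by simp
qed

text \<open>In the application \<open>x i b a\<close> is the variable with index \<open>s\<^sup>i t\<^sup>b z\<^sup>a\<close>, the maps \<open>Z\<close>, \<open>T\<close>, \<open>S\<close> are
  the actions of \<open>z\<close>, \<open>t\<close>, \<open>s\<close>, and \<open>s\<^sup>p = z\<^sup>r\<close>.\<close>

locale heisenberg_action =
  fixes K :: "'a::field set" and p r :: nat and \<zeta> :: 'a and Z T S :: "'a \<Rightarrow> 'a"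
    and x :: "nat \<Rightarrow> nat \<Rightarrow> nat \<Rightarrow> 'a"
  assumes K: "is_subfield K" and p: "p > 1" "(of_nat p :: 'a) \<noteq> 0"
    and \<zeta>: "primitive_root_of_unity p \<zeta>" "\<zeta> \<in> K"
    and hom_Z: "field_hom Z" and hom_T: "field_hom T" and hom_S: "field_hom S"
    and Z_K: "\<And>c. c \<in> K \<Longrightarrow> Z c = c" and T_K: "\<And>c. c \<in> K \<Longrightarrow> T c = c"
    and S_K: "\<And>c. c \<in> K \<Longrightarrow> S c = c"
    and Z_x: "\<And>i b a. Z (x i b a) = x i b (a + 1)"
    and T_x: "\<And>i b a. T (x i b a) = x i (b + 1) (a + i)"
    and S_x: "\<And>i b a. S (x i b a) = x (i + 1) b a"
    and periodic: "\<And>i b a. x i b (a + p) = x i b a" "\<And>i b a. x i (b + p) a = x i b a"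
      "\<And>i b a. x (i + p) b a = x i b (a + r)"
    and transcendental: "\<not> algebraic_over (gen_field (K \<union>
      {x i b a | i b a. i < p \<and> b < p \<and> a < p \<and> (i, b, a) \<noteq> (0, 0, 0)})) (x 0 0 0)"
begin

text \<open>The inverse root is used in the transforms so that a shift by one acts on them with
  eigenvalue a power of \<open>\<zeta>\<close>.\<close>

definition w :: 'a where "w = inverse \<zeta>"

text \<open>The eigenvectors built from the variables of the coset of \<open>s ^ i\<close>:
  \<open>z\<close> acts by \<open>\<zeta> ^ a\<close> and \<open>t\<close> by
  \<open>\<zeta> ^ (i * a + b)\<close>. For fixed \<open>a\<close>, \<open>b\<close> and varying
  \<open>i\<close> they span the representation induced from one character of \<langle>z,
  t\<rangle>.\<close>

definition W :: "nat \<Rightarrow> nat \<Rightarrow> nat \<Rightarrow> 'a" where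
  "W a b i = (\<Sum>a'<p. w ^ (a' * a) * (\<Sum>b'<p. w ^ (b' * b) * x i b' a'))"

definition X :: "nat \<Rightarrow> 'a" where "X i = W 1 0 i"

definition y :: "nat \<Rightarrow> 'a" where "y i = X (i + 1) / X i"

definition e :: "nat \<Rightarrow> 'a" where "e j = (\<Sum>i<p. w ^ (i * j) * y i)"

definition l :: 'a where "l = e 1 / e 0"

text \<open>The denominator has the same eigenvalues as the numerator: \<open>X i ^ a\<close>
  contributes \<open>\<zeta> ^ a\<close> for \<open>z\<close> and \<open>\<zeta> ^ (i * a)\<close>
  for \<open>t\<close>, and \<open>e 0 ^ b\<close> the remaining \<open>\<zeta> ^ b\<close>. What is
  left is the shift of \<open>i\<close> by \<open>s\<close>.\<close>

definition Y :: "nat \<Rightarrow> nat \<Rightarrow> nat \<Rightarrow> 'a" where "Y a b i = W a b i / (X i ^ a * e 0 ^ b)"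

text \<open>Transforming over \<open>i\<close> diagonalises the shift, and \<open>l ^ j\<close>
  cancels the resulting eigenvalue \<open>\<zeta> ^ j\<close> of \<open>s\<close>.\<close>

definition u :: "nat \<Rightarrow> nat \<Rightarrow> nat \<Rightarrow> 'a" where "u a b j = (\<Sum>i<p. w ^ (i * j) * Y a b i) / l ^ j"

text \<open>The power \<open>X 0 ^ p\<close> is fixed by \<open>z\<close> and \<open>t\<close>, but
  \<open>s\<close> sends it to \<open>X 1 ^ p\<close>; \<open>f\<close> is the sum over this
  cycle.\<close>

definition f :: 'a where "f = (\<Sum>i<p. X i ^ p)"

text \<open>The pair \<open>(1, 0)\<close> is absent because \<open>Y 1 0 i = 1\<close>. Its
  \<open>p\<close> places are taken by \<open>f\<close>, \<open>l ^ p\<close> and the ratios for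
  \<open>2 \<le> j\<close>; at \<open>j = 0\<close> and \<open>j = 1\<close> the ratio would be
  1.\<close>

definition gens :: "'a set" where
  "gens = {f, l ^ p} \<union> (\<lambda>j. e j / e 0 / l ^ j) ` {2..<p} \<union>
     (\<lambda>((a, b), j). u a b j) ` (({..<p} \<times> {..<p} - {(1, 0)}) \<times> {..<p})"

definition L :: "'a set" where
  "L = gen_field (K \<union> {x i b a | i b a. i < p \<and> b < p \<and> a < p})"

lemma \<zeta>_nz: "\<zeta> \<noteq> 0" and \<zeta>_p: "\<zeta> ^ p = 1"
  using \<zeta>(1) unfolding primitive_root_of_unity_def by (auto simp: power_0_left)

lemma w: "primitive_root_of_unity p w" "w \<in> K" "w \<noteq> 0" "w ^ p = 1" "w * \<zeta> = 1"
  using primitive_root_inverse[OF \<zeta>(1)] subfield_inverse[OF K \<zeta>(2)] \<zeta>_nz \<zeta>_p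
  by (auto simp: w_def power_inverse)

lemma fix_roots: "Z w = w" "T w = w" "S w = w" "Z \<zeta> = \<zeta>" "T \<zeta> = \<zeta>" "S \<zeta> = \<zeta>"
  by (simp_all add: Z_K T_K S_K w(2) \<zeta>(2))

lemmas Z_simps = field_hom_simps[OF hom_Z] and T_simps = field_hom_simps[OF hom_T]
  and S_simps = field_hom_simps[OF hom_S]

lemma w_periodic: "w ^ ((i + p) * a) = w ^ (i * a)"
  using w(4) by (simp add: add_mult_distrib power_add power_mult)

lemma dft_shift:
  assumes "\<And>i. h (i + p) = h i"
  shows "(\<Sum>i<p. w ^ (i * a) * h (i + k)) = \<zeta> ^ (k * a) * (\<Sum>i<p. w ^ (i * a) * h i)"
proof -
  have eq: "\<zeta> ^ (k * a) * (w ^ ((i + k) * a) * g) = w ^ (i * a) * g" for i g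
  proof -
    have "\<zeta> ^ (k * a) * w ^ ((i + k) * a) = w ^ (i * a) * (w * \<zeta>) ^ (k * a)"
      by (simp add: add_mult_distrib power_add power_mult_distrib)
    then have "\<zeta> ^ (k * a) * w ^ ((i + k) * a) = w ^ (i * a)" using w(5) by simp
    then show ?thesis by (simp only: mult.assoc[symmetric])
  qed
  have "(\<Sum>i<p. w ^ (i * a) * h (i + k)) = \<zeta> ^ (k * a) * (\<Sum>i<p. w ^ ((i + k) * a) * h (i + k))"
    unfolding sum_distrib_left eq ..
  also have "(\<Sum>i<p. w ^ ((i + k) * a) * h (i + k)) = (\<Sum>i<p. w ^ (i * a) * h i)"
    by (rule sum_shift_periodic[of "\<lambda>i. w ^ (i * a) * h i"]) (simp only: w_periodic assms)
  finally show ?thesis .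
qed

lemma dft_shift_outer:
  "(\<Sum>a'<p. w ^ (a' * a) * (\<Sum>b'<p. w ^ (b' * b) * x i b' (a' + k))) = \<zeta> ^ (k * a) * W a b i"
  unfolding W_def using dft_shift[of "\<lambda>a'. \<Sum>b'<p. w ^ (b' * b) * x i b' a'" a k]
  by (simp only: periodic(1))

lemma Z_W: "Z (W a b i) = \<zeta> ^ a * W a b i"
proof -
  have "Z (W a b i) = (\<Sum>a'<p. w ^ (a' * a) * (\<Sum>b'<p. w ^ (b' * b) * x i b' (a' + 1)))"
    by (simp add: W_def Z_simps fix_roots Z_x)
  then show ?thesis unfolding dft_shift_outer by simp
qed

lemma T_W: "T (W a b i) = \<zeta> ^ (i * a) * \<zeta> ^ b * W a b i"
proof -
  have inner: "(\<Sum>b'<p. w ^ (b' * b) * x i (b' + 1) c) = \<zeta> ^ b * (\<Sum>b'<p. w ^ (b' * b) * x i b' c)" for c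
    using dft_shift[of "\<lambda>b'. x i b' c" b 1] periodic(2) by simp
  have "T (W a b i) = (\<Sum>a'<p. w ^ (a' * a) * (\<Sum>b'<p. w ^ (b' * b) * x i (b' + 1) (a' + i)))"
    by (simp add: W_def T_simps fix_roots T_x)
  also have "\<dots> = \<zeta> ^ b * (\<Sum>a'<p. w ^ (a' * a) * (\<Sum>b'<p. w ^ (b' * b) * x i b' (a' + i)))"
    unfolding inner sum_distrib_left[of "\<zeta> ^ b" "\<lambda>a'. w ^ (a' * a) * g a'" for g]
    by (simp only: mult.left_commute[of _ "\<zeta> ^ b"])
  finally show ?thesis unfolding dft_shift_outer by (simp only: mult_ac)
qed

lemma S_W: "S (W a b i) = W a b (i + 1)"
  by (simp add: W_def S_simps fix_roots S_x)

lemma W_periodic: "W a b (i + p) = \<zeta> ^ (r * a) * W a b i"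
  by (subst W_def) (simp only: periodic(3) dft_shift_outer)

lemma Z_X: "Z (X i) = \<zeta> * X i" and T_X: "T (X i) = \<zeta> ^ i * X i" and S_X: "S (X i) = X (i + 1)"
  and X_periodic: "X (i + p) = \<zeta> ^ r * X i"
  unfolding X_def using W_periodic[of 1 0] by (simp_all add: Z_W T_W S_W)

text \<open>\<open>X 0\<close> is transcendental over \<open>F\<close>, which contains the other \<open>X i\<close>. This is how the elements
  used as denominators are seen to be nonzero.\<close>

definition F where
  "F = gen_field (K \<union> {x i b a | i b a. i < p \<and> b < p \<and> a < p \<and> (i, b, a) \<noteq> (0, 0, 0)})"

lemma F: "is_subfield F" and K_F: "K \<subseteq> F"
  and x_F: "i < p \<Longrightarrow> b < p \<Longrightarrow> a < p \<Longrightarrow> (i, b, a) \<noteq> (0, 0, 0) \<Longrightarrow> x i b a \<in> F"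
proof -
  show "is_subfield F" unfolding F_def by (rule is_subfield_gen_field)
  show "K \<subseteq> F" unfolding F_def
    using gen_field_superset[of "K \<union> {x i b a | i b a. i < p \<and> b < p \<and> a < p \<and> (i, b, a) \<noteq> (0, 0, 0)}"] by blast
  show "x i b a \<in> F" if "i < p" "b < p" "a < p" "(i, b, a) \<noteq> (0, 0, 0)"
    using that unfolding F_def
    by (intro gen_field_superset[THEN subsetD] UnI2 CollectI exI[of _ i] exI[of _ b] exI[of _ a]) auto
qed

lemma w_F: "w ^ n \<in> F"
  using K_F w(2) by (auto intro: subfield_power[OF F])

lemma X_F: "0 < i \<Longrightarrow> i < p \<Longrightarrow> X i \<in> F"
  unfolding X_def W_def by (intro subfield_sum[OF F] subfield_mult[OF F] w_F x_F) auto

text \<open>The variable \<open>x 0 0 0\<close> occurs in \<open>X 0\<close> with coefficient 1, and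
  the remainder lies in \<open>F\<close>.\<close>

lemma X0_transcendental: "\<not> algebraic_over F (X 0)"
proof
  assume alg: "algebraic_over F (X 0)"
  define t where "t = (\<Sum>(a, b)\<in>{..<p} \<times> {..<p} - {(0, 0)}. w ^ a * x 0 b a)"
  have "X 0 = (\<Sum>a'<p. \<Sum>b'<p. w ^ a' * x 0 b' a')"
    by (simp add: X_def W_def sum_distrib_left)
  also have "\<dots> = (\<Sum>(a, b)\<in>{..<p} \<times> {..<p}. w ^ a * x 0 b a)"
    by (simp add: sum.cartesian_product)
  also have "\<dots> = x 0 0 0 + t"
    unfolding t_def using p(1) by (subst sum.remove[of _ "(0, 0)"]) auto
  finally have "X 0 = x 0 0 0 + t" .
  moreover have "t \<in> F"
    unfolding t_def by (rule subfield_sum[OF F]) (auto intro!: subfield_mult[OF F] w_F x_F)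
  ultimately have "algebraic_over F (x 0 0 0)" using alg algebraic_over_translate[OF F, of t "x 0 0 0"] by simp
  then show False using transcendental unfolding F_def by contradiction
qed

lemma X_nz: "X i \<noteq> 0"
proof (induction i)
  case 0
  show ?case using X0_transcendental algebraic_over_member[OF F subfield_0[OF F]] by metis
next
  case (Suc i)
  then show ?case using S_X[of i] field_hom_eq_0_iff[OF hom_S, of "X i"] by simp
qed

lemma y_nz: "y i \<noteq> 0" and Z_y: "Z (y i) = y i" and T_y: "T (y i) = \<zeta> * y i"
  and S_y: "S (y i) = y (i + 1)" and y_periodic: "y (i + p) = y i"
proof -
  show "y i \<noteq> 0" using X_nz by (simp add: y_def)
  show "Z (y i) = y i" "T (y i) = \<zeta> * y i" "S (y i) = y (i + 1)"
    using \<zeta>_nz by (simp_all add: y_def field_hom_divide[OF hom_Z] field_hom_divide[OF hom_T]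
        field_hom_divide[OF hom_S] Z_X T_X S_X)
  have "X (i + p + 1) = \<zeta> ^ r * X (i + 1)" using X_periodic[of "i + 1"] by (simp add: ac_simps)
  then show "y (i + p) = y i" using \<zeta>_nz by (simp add: y_def X_periodic)
qed

lemma Z_e: "Z (e j) = e j" and T_e: "T (e j) = \<zeta> * e j" and S_e: "S (e j) = \<zeta> ^ j * e j"
proof -
  show "Z (e j) = e j" by (simp add: e_def Z_simps fix_roots Z_y)
  show "T (e j) = \<zeta> * e j"
    by (simp add: e_def T_simps fix_roots T_y sum_distrib_left mult.left_commute)
  have "S (e j) = (\<Sum>i<p. w ^ (i * j) * y (i + 1))" by (simp add: e_def S_simps fix_roots S_y)
  also have "\<dots> = \<zeta> ^ (1 * j) * e j" unfolding e_def by (rule dft_shift) (rule y_periodic)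
  finally show "S (e j) = \<zeta> ^ j * e j" by simp
qed

text \<open>Among the quotients, \<open>X 0\<close> occurs only as the denominator of
  \<open>y 0\<close> and the numerator of \<open>y (p - 1)\<close>. Hence \<open>e j * X 0\<close>
  is a quadratic polynomial in \<open>X 0\<close> over \<open>F\<close> with nonzero leading
  coefficient.\<close>

lemma e_nz: "e j \<noteq> 0"
proof
  assume e0: "e j = 0"
  \<comment> \<open>The coefficients of this quadratic; index 2 falls into the last branch. For
    \<open>p = 2\<close> the middle sum is empty.\<close>
  define c :: "nat \<Rightarrow> 'a" where "c i = (if i = 0 then X 1 else if i = 1 then (\<Sum>i\<in>{1..<p - 1}. w ^ (i * j) * y i)
    else w ^ ((p - 1) * j) * \<zeta> ^ r / X (p - 1))" for i
  have *: "{..<p} = insert 0 (insert (p - 1) {1..<p - 1})" using p(1) by auto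
  have "e j = y 0 + (w ^ ((p - 1) * j) * y (p - 1) + (\<Sum>i\<in>{1..<p - 1}. w ^ (i * j) * y i))"
    unfolding e_def * using p(1) by simp
  moreover have "y 0 = X 1 / X 0" "y (p - 1) = \<zeta> ^ r * X 0 / X (p - 1)"
    using X_periodic[of 0] p(1) by (simp_all add: y_def)
  ultimately have "e j * X 0 = (\<Sum>i\<le>2. c i * X 0 ^ i)"
    using X_nz[of 0] by (simp add: c_def numeral_2_eq_2 field_simps)
  then have "(\<Sum>i\<le>2. c i * X 0 ^ i) = 0" using e0 by simp
  moreover have "c 2 \<noteq> 0" using w(3) \<zeta>_nz X_nz by (simp add: c_def)
  moreover have "y i \<in> F" if "1 \<le> i" "i < p - 1" for i
    unfolding y_def using that by (intro subfield_divide[OF F] X_F) auto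
  then have "c i \<in> F" for i
    unfolding c_def using p(1) K_F \<zeta>(2)
    by (auto intro!: subfield_divide[OF F] subfield_mult[OF F] subfield_sum[OF F] w_F X_F subfield_power[OF F])
  ultimately have "algebraic_over F (X 0)" using algebraic_over_sum[OF F, of 2 c 2] by blast
  then show False using X0_transcendental by contradiction
qed

lemma l_nz: "l \<noteq> 0" and Z_l: "Z l = l" and T_l: "T l = l" and S_l: "S l = \<zeta> * l"
  using e_nz[of 0] e_nz[of 1] \<zeta>_nz
  by (simp_all add: l_def Z_simps T_simps S_simps Z_e T_e S_e)

text \<open>Over \<open>F\<close>, this is a monic polynomial of degree \<open>p\<close> in
  \<open>X 0\<close>.\<close>

lemma f_nz: "f \<noteq> 0"
proof
  assume f0: "f = 0"
  define c :: "nat \<Rightarrow> 'a" where "c i = (if i = 0 then (\<Sum>i\<in>{1..<p}. X i ^ p) else if i = p then 1 else 0)" for i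
  have "f = X 0 ^ p + (\<Sum>i\<in>{1..<p}. X i ^ p)"
  proof -
    have "{..<p} = insert 0 {1..<p}" using p(1) by auto
    then show ?thesis unfolding f_def by simp
  qed
  moreover have "(\<Sum>i\<le>p. c i * X 0 ^ i) = c 0 * X 0 ^ 0 + (c p * X 0 ^ p + 0)"
  proof -
    have "(\<Sum>i\<le>p. c i * X 0 ^ i) = (\<Sum>i\<in>{0, p}. c i * X 0 ^ i)"
      by (rule sum.mono_neutral_right) (auto simp: c_def)
    then show ?thesis using p(1) by simp
  qed
  ultimately have "(\<Sum>i\<le>p. c i * X 0 ^ i) = 0" using f0 p(1) by (simp add: c_def add.commute)
  moreover have "c p \<noteq> 0" using p(1) by (simp add: c_def)
  moreover have "c i \<in> F" for i
    unfolding c_def using p(1) by (auto intro!: subfield_0[OF F] subfield_1[OF F] subfield_sum[OF F] subfield_power[OF F] X_F)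
  ultimately have "algebraic_over F (X 0)" using algebraic_over_sum[OF F, of p c p] by blast
  then show False using X0_transcendental by contradiction
qed

lemma Z_f: "Z f = f" and T_f: "T f = f" and S_f: "S f = f"
proof -
  show "Z f = f" by (simp add: f_def Z_simps Z_X power_mult_distrib \<zeta>_p)
  have "(\<zeta> ^ i) ^ p = 1" for i using \<zeta>_p by (metis mult.commute power_mult power_one)
  then show "T f = f" by (simp add: f_def T_simps T_X power_mult_distrib)
  have "S f = (\<Sum>i<p. X (i + 1) ^ p)" by (simp add: f_def S_simps S_X)
  also have "\<dots> = f"
    unfolding f_def
  proof (rule sum_shift_periodic[of "\<lambda>i. X i ^ p"])
    fix i
    have "(\<zeta> ^ r) ^ p = 1" using \<zeta>_p by (metis mult.commute power_mult power_one)
    then show "X (i + p) ^ p = X i ^ p" by (simp add: X_periodic power_mult_distrib)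
  qed
  finally show "S f = f" .
qed

lemma Z_Y: "Z (Y a b i) = Y a b i" and T_Y: "T (Y a b i) = Y a b i"
  and S_Y: "S (Y a b i) = Y a b (i + 1)" and Y_periodic: "Y a b (i + p) = Y a b i"
proof -
  show "Z (Y a b i) = Y a b i"
    using \<zeta>_nz by (simp add: Y_def Z_simps Z_W Z_X Z_e power_mult_distrib)
  show "T (Y a b i) = Y a b i"
    using \<zeta>_nz by (simp add: Y_def T_simps T_W T_X T_e power_mult_distrib power_mult)
  show "S (Y a b i) = Y a b (i + 1)"
    by (simp add: Y_def S_simps S_W S_X S_e)
  show "Y a b (i + p) = Y a b i"
    using \<zeta>_nz by (simp add: Y_def W_periodic X_periodic power_mult_distrib power_mult)
qed

lemma Z_u: "Z (u a b j) = u a b j" and T_u: "T (u a b j) = u a b j" and S_u: "S (u a b j) = u a b j"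
proof -
  show "Z (u a b j) = u a b j" "T (u a b j) = u a b j"
    by (simp_all add: u_def Z_simps T_simps fix_roots Z_Y T_Y Z_l T_l)
  have "(\<Sum>i<p. w ^ (i * j) * Y a b (i + 1)) = \<zeta> ^ (1 * j) * (\<Sum>i<p. w ^ (i * j) * Y a b i)"
    by (rule dft_shift) (rule Y_periodic)
  then show "S (u a b j) = u a b j"
    using \<zeta>_nz by (simp add: u_def S_simps fix_roots S_Y S_l power_mult_distrib)
qed

lemma gens_fixed: "g \<in> gens \<Longrightarrow> Z g = g \<and> T g = g \<and> S g = g"
proof -
  have "S (l ^ p) = l ^ p" using \<zeta>_p by (simp add: S_simps S_l power_mult_distrib)
  moreover have "S (e j / e 0 / l ^ j) = e j / e 0 / l ^ j" for j
    using \<zeta>_nz by (simp add: S_simps S_e S_l power_mult_distrib)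
  moreover have "T (e j / e 0 / l ^ j) = e j / e 0 / l ^ j" for j
    using \<zeta>_nz by (simp add: T_simps T_e T_l)
  ultimately show "g \<in> gens \<Longrightarrow> Z g = g \<and> T g = g \<and> S g = g"
    unfolding gens_def by (auto simp: Z_f T_f S_f Z_l T_l Z_simps T_simps Z_e Z_u T_u S_u)
qed

lemma gens_card: "finite gens" "card gens \<le> p ^ 3"
proof -
  let ?A = "(\<lambda>j. e j / e 0 / l ^ j) ` {2..<p}"
  let ?B = "(\<lambda>((a, b), j). u a b j) ` (({..<p} \<times> {..<p} - {(1, 0)}) \<times> {..<p})"
  show "finite gens" unfolding gens_def by auto
  have "card gens \<le> card {f, l ^ p} + card ?A + card ?B"
    unfolding gens_def by (meson add_le_mono1 card_Un_le order.trans)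
  also have "card {f, l ^ p} \<le> 2" by (simp add: card_insert_if)
  also have "card ?A \<le> p - 2" using card_image_le[of "{2..<p}"] by simp
  also have "card ?B \<le> (p * p - 1) * p"
  proof -
    have "card ({..<p} \<times> {..<p} - {(1::nat, 0::nat)}) = p * p - 1"
      using p(1) by (simp add: card_Diff_singleton card_cartesian_product)
    then show ?thesis
      using card_image_le[of "({..<p} \<times> {..<p} - {(1, 0)}) \<times> {..<p}" "\<lambda>((a, b), j). u a b j"]
      by (simp add: card_cartesian_product)
  qed
  also have "2 + (p - 2) + (p * p - 1) * p = p ^ 3"
  proof -
    have "2 + (p - 2) + (p * p - 1) * p = (1 + (p * p - 1)) * p"
      using p(1) unfolding add_mult_distrib by simp
    also have "1 + (p * p - 1) = p * p" using p(1) by simp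
    finally show ?thesis by (simp add: power3_eq_cube)
  qed
  finally show "card gens \<le> p ^ 3" by simp
qed

lemma L: "is_subfield L" and K_L: "K \<subseteq> L"
  unfolding L_def using gen_field_superset[of "K \<union> {x i b a | i b a. i < p \<and> b < p \<and> a < p}"]
  by (auto simp: is_subfield_gen_field)

lemma x_L': "i < p \<Longrightarrow> b < p \<Longrightarrow> a < p \<Longrightarrow> x i b a \<in> L"
  unfolding L_def
  by (intro gen_field_superset[THEN subsetD] UnI2 CollectI exI[of _ i] exI[of _ b] exI[of _ a]) auto

lemma W_L: "i < p \<Longrightarrow> W a b i \<in> L"
  unfolding W_def using K_L w(2)
  by (intro subfield_sum[OF L] subfield_mult[OF L] subfield_power[OF L] x_L') auto

lemma X_L: "i \<le> p \<Longrightarrow> X i \<in> L"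
  using W_L[of i 1 0] W_L[of 0 1 0] X_periodic[of 0] K_L \<zeta>(2) p(1)
  by (cases "i = p") (auto simp: X_def intro!: subfield_mult[OF L] subfield_power[OF L])

lemma e_L: "e j \<in> L"
  unfolding e_def y_def using K_L w(2)
  by (intro subfield_sum[OF L] subfield_mult[OF L] subfield_divide[OF L] subfield_power[OF L] X_L) auto

lemma l_L: "l \<in> L"
  unfolding l_def by (intro subfield_divide[OF L] e_L)

lemma gens_L: "gens \<subseteq> L"
proof -
  have "f \<in> L" unfolding f_def by (intro subfield_sum[OF L] subfield_power[OF L] X_L) auto
  moreover have "u a b j \<in> L" for a b j
    unfolding u_def Y_def using K_L w(2)
    by (intro subfield_sum[OF L] subfield_mult[OF L] subfield_divide[OF L] subfield_power[OF L] X_L W_L e_L l_L) auto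
  moreover have "e j / e 0 / l ^ j \<in> L" for j
    by (intro subfield_power[OF L] subfield_divide[OF L] e_L l_L)
  ultimately show ?thesis
    unfolding gens_def by (auto intro: subfield_power[OF L] l_L simp del: divide_divide_eq_left)
qed

section \<open>The Kummer tower over the field of invariants\<close>

definition F0 where "F0 = gen_field (K \<union> gens)"
definition F1 where "F1 = gen_field (insert l F0)"
definition F2 where "F2 = gen_field (insert (e 0) F1)"
definition F3 where "F3 = gen_field (insert (X 0) F2)"

lemma F0: "is_subfield F0" and F1: "is_subfield F1" and F2: "is_subfield F2" and F3: "is_subfield F3"
  unfolding F0_def F1_def F2_def F3_def by (rule is_subfield_gen_field)+

lemma F01: "F0 \<subseteq> F1" and F12: "F1 \<subseteq> F2" and F23: "F2 \<subseteq> F3" and K_F0: "K \<subseteq> F0" and gens_F0: "gens \<subseteq> F0"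
  and l_F1: "l \<in> F1" and e_F2: "e 0 \<in> F2" and X_F3: "X 0 \<in> F3"
  using gen_field_superset[of "K \<union> gens"] gen_field_superset[of "insert l F0"]
    gen_field_superset[of "insert (e 0) F1"] gen_field_superset[of "insert (X 0) F2"]
  unfolding F0_def[symmetric] F1_def[symmetric] F2_def[symmetric] F3_def[symmetric] by auto

lemma lp_F0: "l ^ p \<in> F0"
  using gens_F0 unfolding gens_def by auto

lemma w_F1: "w \<in> F1" using w(2) K_F0 F01 by auto

lemma e_ratio_F1:
  assumes "j < p"
  shows "e j / e 0 \<in> F1"
proof -
  consider "j = 0" | "j = 1" | "j \<in> {2..<p}" using assms by fastforce
  then show ?thesis
  proof cases
    case 1
    then show ?thesis using e_nz[of 0] subfield_1[OF F1] by simp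
  next
    case 2
    then show ?thesis using l_F1 by (simp add: l_def)
  next
    case 3
    then have "e j / e 0 / l ^ j \<in> F1" using gens_F0 F01 unfolding gens_def by blast
    then have "e j / e 0 / l ^ j * l ^ j \<in> F1" by (intro subfield_mult[OF F1] subfield_power[OF F1] l_F1)
    then show ?thesis using l_nz by simp
  qed
qed

text \<open>The ratios \<open>e j / e 0\<close> are the Fourier transform of the
  \<open>y i / e 0\<close>.\<close>

lemma y_ratio_F1:
  assumes "i < p"
  shows "y i / e 0 \<in> F1"
proof (rule dft_inversion[OF F1 p(2) w(1) w_F1 _ assms])
  fix j assume "j < p"
  then show "(\<Sum>i<p. w ^ (i * j) * (y i / e 0)) \<in> F1"
    using e_ratio_F1[of j] by (simp add: e_def sum_divide_distrib)
qed

lemma X_eq_prod: "X n = X 0 * (\<Prod>i<n. y i)"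
  by (induction n) (use X_nz in \<open>simp_all add: y_def\<close>)

text \<open>The product of the \<open>y i\<close> telescopes to
  \<open>X p / X 0 = \<zeta> ^ r\<close>. Thus the product of the known ratios
  \<open>y i / e 0\<close> is \<open>\<zeta> ^ r / e 0 ^ p\<close>.\<close>

lemma e0p_F1: "e 0 ^ p \<in> F1"
proof -
  have "(\<Prod>i<p. y i) = \<zeta> ^ r"
    using X_eq_prod[of p] X_periodic[of 0] X_nz[of 0] by simp
  then have "(\<Prod>i<p. y i / e 0) = \<zeta> ^ r / e 0 ^ p" by (simp add: prod_dividef)
  then have "e 0 ^ p = \<zeta> ^ r / (\<Prod>i<p. y i / e 0)"
    using \<zeta>_nz e_nz[of 0] y_nz by (auto simp: divide_simps mult.commute)
  also have "\<dots> \<in> F1"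
  proof (rule subfield_divide[OF F1])
    show "\<zeta> ^ r \<in> F1" using K_F0 F01 \<zeta>(2) by (intro subfield_power[OF F1]) auto
    show "(\<Prod>i<p. y i / e 0) \<in> F1" using y_ratio_F1 by (intro subfield_prod[OF F1]) auto
  qed
  finally show ?thesis .
qed

lemma yp_F1:
  assumes "i < p"
  shows "y i ^ p \<in> F1"
proof -
  have "y i ^ p = (y i / e 0) ^ p * e 0 ^ p" using e_nz[of 0] by (simp add: power_divide)
  then show ?thesis
    using y_ratio_F1[OF assms] e0p_F1 by (simp add: subfield_mult[OF F1] subfield_power[OF F1])
qed

text \<open>Each \<open>X i ^ p\<close> is \<open>X 0 ^ p\<close> times a product of powers
  \<open>y k ^ p\<close> from \<open>F1\<close>, so \<open>f\<close> is \<open>X 0 ^ p\<close> times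
  an element of \<open>F1\<close>; that element is nonzero because \<open>f\<close> is.\<close>

lemma X0p_F1: "X 0 ^ p \<in> F1"
proof -
  let ?q = "\<Sum>i<p. \<Prod>k<i. y k ^ p"
  have "f = (\<Sum>i<p. (X 0 * (\<Prod>k<i. y k)) ^ p)" unfolding f_def by (simp flip: X_eq_prod)
  also have "\<dots> = X 0 ^ p * ?q" by (simp add: power_mult_distrib prod_power_distrib sum_distrib_left)
  finally have f: "f = X 0 ^ p * ?q" .
  then have "?q \<noteq> 0" using f_nz by auto
  then have "X 0 ^ p = f / ?q" using f by simp
  also have "\<dots> \<in> F1"
    using gens_F0 F01 unfolding gens_def
    by (intro subfield_divide[OF F1] subfield_sum[OF F1] subfield_prod[OF F1] yp_F1) auto
  finally show ?thesis .
qed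

lemma y_F2:
  assumes "i < p"
  shows "y i \<in> F2"
proof -
  have "y i = y i / e 0 * e 0" using e_nz[of 0] by simp
  then show ?thesis using y_ratio_F1[OF assms] F12 e_F2 by (metis subfield_mult[OF F2] subsetD)
qed

lemma Xi_F3: "i < p \<Longrightarrow> X i \<in> F3"
  unfolding X_eq_prod[of i] using y_F2 F23
  by (intro subfield_mult[OF F3] subfield_prod[OF F3] X_F3) auto

text \<open>Inverting the transform that defines \<open>u a b j\<close> gives
  \<open>Y a b i\<close>, and restoring the monomial in \<open>X i\<close> and \<open>e 0\<close>
  gives \<open>W a b i\<close>.\<close>

lemma W_F3:
  assumes "a < p" "b < p" "i < p"
  shows "W a b i \<in> F3"
proof (cases "(a, b) = (1, 0)")
  case True
  then show ?thesis using Xi_F3[OF assms(3)] by (simp add: X_def)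
next
  case False
  have "Y a b i \<in> F1"
  proof (rule dft_inversion[OF F1 p(2) w(1) w_F1 _ assms(3)])
    fix j assume "j < p"
    then have "u a b j \<in> gens"
      unfolding gens_def using False assms by (intro UnI2 image_eqI[of _ _ "((a, b), j)"]) auto
    then have "u a b j * l ^ j \<in> F1"
      using gens_F0 F01 by (intro subfield_mult[OF F1] subfield_power[OF F1] l_F1) auto
    then show "(\<Sum>i<p. w ^ (i * j) * Y a b i) \<in> F1" using l_nz by (simp add: u_def)
  qed
  then have "Y a b i * (X i ^ a * e 0 ^ b) \<in> F3"
    using F12 F23 e_F2 Xi_F3[OF assms(3)] by (intro subfield_mult[OF F3] subfield_power[OF F3]) auto
  then show ?thesis using X_nz e_nz by (simp add: Y_def)
qed

text \<open>Two Fourier inversions, one in \<open>b\<close> and one in \<open>a\<close>, recover the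
  variables from the \<open>W a b i\<close>.\<close>

lemma L_F3: "L \<subseteq> F3"
proof -
  have w3: "w \<in> F3" using w_F1 F12 F23 by auto
  have "x i b a \<in> F3" if "i < p" "b < p" "a < p" for i b a
  proof (rule dft_inversion[OF F3 p(2) w(1) w3 _ that(2), of "\<lambda>b. x i b a"])
    fix b' assume b': "b' < p"
    show "(\<Sum>b<p. w ^ (b * b') * x i b a) \<in> F3"
    proof (rule dft_inversion[OF F3 p(2) w(1) w3 _ that(3), of "\<lambda>a. (\<Sum>b<p. w ^ (b * b') * x i b a)"])
      fix a' assume "a' < p"
      then show "(\<Sum>a<p. w ^ (a * a') * (\<Sum>b<p. w ^ (b * b') * x i b a)) \<in> F3"
        using W_F3[of a' b' i] b' that by (simp add: W_def)
    qed
  qed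
  moreover have "K \<subseteq> F3" using K_F0 F01 F12 F23 by auto
  ultimately show ?thesis unfolding L_def by (intro gen_field_least F3) auto
qed

lemma fin_ext_F0_L: "fin_ext F0 L"
proof -
  have "fin_ext F0 F1" unfolding F1_def using p(1) by (intro kummer_fin_ext[OF F0 lp_F0]) simp
  moreover have "fin_ext F1 F2" unfolding F2_def using p(1) by (intro kummer_fin_ext[OF F1 e0p_F1]) simp
  moreover have "fin_ext F2 F3"
    unfolding F3_def using p(1) X0p_F1 F12 by (intro kummer_fin_ext[OF F2, of _ p]) auto
  ultimately show ?thesis using L_F3 by (meson fin_ext_trans fin_ext_mono)
qed

text \<open>The tower is peeled from the top. \<open>Z\<close> fixes \<open>l\<close> and
  \<open>e 0\<close>, hence \<open>F2\<close>; \<open>T\<close> fixes \<open>l\<close>, hence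
  \<open>F1\<close>; \<open>S\<close> fixes \<open>F0\<close>. Each multiplies the generator of the
  next field by \<open>\<zeta>\<close>, so \<open>kummer_fixed\<close> removes one step at a
  time.\<close>

lemma fixed_F0:
  assumes "a \<in> L" "Z a = a" "T a = a" "S a = a"
  shows "a \<in> F0"
proof -
  have \<zeta>F: "\<zeta> \<in> F0" "\<zeta> \<in> F1" "\<zeta> \<in> F2" using \<zeta>(2) K_F0 F01 F12 by auto
  have fix0: "Z c = c \<and> T c = c \<and> S c = c" if c: "c \<in> F0" for c
  proof -
    have "Z g = g \<and> T g = g \<and> S g = g" if "g \<in> K \<union> gens" for g
      using that gens_fixed Z_K T_K S_K by blast
    then show ?thesis
      using c gen_field_hom_fixed[OF hom_Z, of "K \<union> gens" c] gen_field_hom_fixed[OF hom_T, of "K \<union> gens" c]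
        gen_field_hom_fixed[OF hom_S, of "K \<union> gens" c]
      unfolding F0_def by blast
  qed
  have fix1: "Z c = c \<and> T c = c" if c: "c \<in> F1" for c
  proof -
    have "Z g = g \<and> T g = g" if "g \<in> insert l F0" for g
      using that fix0 Z_l T_l by blast
    then show ?thesis
      using c gen_field_hom_fixed[OF hom_Z, of "insert l F0" c] gen_field_hom_fixed[OF hom_T, of "insert l F0" c]
      unfolding F1_def by blast
  qed
  have fix2: "Z c = c" if c: "c \<in> F2" for c
  proof -
    have "Z g = g" if "g \<in> insert (e 0) F1" for g
      using that fix1 Z_e by blast
    then show ?thesis
      using c gen_field_hom_fixed[OF hom_Z, of "insert (e 0) F1" c] unfolding F2_def by blast
  qed
  have "X 0 ^ p \<in> F2" "a \<in> gen_field (insert (X 0) F2)"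
    using X0p_F1 F12 assms(1) L_F3 unfolding F3_def by blast+
  then have "a \<in> F2"
    using kummer_fixed[OF F2 p(2) \<zeta>(1) \<zeta>F(3) hom_Z fix2 Z_X] assms(2) by blast
  then have "a \<in> F1"
    using kummer_fixed[OF F1 p(2) \<zeta>(1) \<zeta>F(2) hom_T _ T_e e0p_F1] fix1 assms(3) unfolding F2_def by blast
  then show "a \<in> F0"
    using kummer_fixed[OF F0 p(2) \<zeta>(1) \<zeta>F(1) hom_S _ S_l lp_F0] fix0 assms(4) unfolding F1_def by blast
qed

end

section \<open>The quaternion group\<close>

text \<open>Makes the square root steps of the quaternion case instances of the Kummer
  lemmas.\<close>

lemma primitive_root_minus_1: "(2::'a::field) \<noteq> 0 \<Longrightarrow> primitive_root_of_unity 2 (- 1 :: 'a)"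
  unfolding primitive_root_of_unity_def
proof (intro conjI allI impI)
  assume two: "(2::'a) \<noteq> 0"
  fix k :: nat assume "0 < k \<and> k < 2"
  then have "k = 1" by simp
  then show "(- 1 :: 'a) ^ k \<noteq> 1" using two by (metis add.right_inverse one_add_one power_one_right)
qed auto

text \<open>The variables \<open>x1\<close>, \<open>xi\<close>, \<open>xj\<close>, \<open>xk\<close>
  belong to 1, i, j, k, and \<open>n1\<close>, \<open>ni\<close>, \<open>nj\<close>,
  \<open>nk\<close> to their negatives; \<open>Z\<close>, \<open>I\<close>, \<open>J\<close> are
  left multiplication by -1, i, j.\<close>

locale quaternion_action =
  fixes K :: "'a::field set" and Z I J :: "'a \<Rightarrow> 'a" and x1 xi xj xk n1 ni nj nk :: 'a
  assumes K: "is_subfield K" and two: "(2 :: 'a) \<noteq> 0"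
    and hom_Z: "field_hom Z" and hom_I: "field_hom I" and hom_J: "field_hom J"
    and Z_K: "\<And>c. c \<in> K \<Longrightarrow> Z c = c" and I_K: "\<And>c. c \<in> K \<Longrightarrow> I c = c"
    and J_K: "\<And>c. c \<in> K \<Longrightarrow> J c = c"
    and Z_x: "Z x1 = n1" "Z xi = ni" "Z xj = nj" "Z xk = nk" "Z n1 = x1" "Z ni = xi" "Z nj = xj" "Z nk = xk"
    and I_x: "I x1 = xi" "I xi = n1" "I xj = xk" "I xk = nj" "I n1 = ni" "I ni = x1" "I nj = nk" "I nk = xj"
    and J_x: "J x1 = xj" "J xi = nk" "J xj = n1" "J xk = xi" "J n1 = nj" "J ni = xk" "J nj = x1" "J nk = ni"
    and transcendental: "\<not> algebraic_over (gen_field (K \<union> {xi, xj, xk, n1, ni, nj, nk})) x1"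
begin

text \<open>The differences span the part of the regular representation where \<open>Z\<close> is
  -1. On the generic quaternion a + b i + c j + d k the maps \<open>I\<close> and \<open>J\<close>
  are left multiplication by -i and -j.\<close>

definition a where "a = x1 - n1"
definition b where "b = xi - ni"
definition c where "c = xj - nj"
definition d where "d = xk - nk"

text \<open>With \<open>x = a + b i + c j + d k\<close> of norm \<open>N\<close>, the vectors \<open>q\<close>, \<open>r\<close> and \<open>s\<close> are the rows of
  \<open>N\<close> times the rotation matrix of \<open>x\<close>. Left multiplication by the quaternion group only changes
  the signs of the rows.\<close>

definition N where "N = a ^ 2 + b ^ 2 + c ^ 2 + d ^ 2"
definition q1 where "q1 = a ^ 2 + b ^ 2 - c ^ 2 - d ^ 2"
definition q2 where "q2 = 2 * (b * c - a * d)"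
definition q3 where "q3 = 2 * (b * d + a * c)"
definition r1 where "r1 = 2 * (b * c + a * d)"
definition r2 where "r2 = a ^ 2 - b ^ 2 + c ^ 2 - d ^ 2"
definition r3 where "r3 = 2 * (c * d - a * b)"
definition s1 where "s1 = 2 * (b * d - a * c)"
definition s2 where "s2 = 2 * (c * d + a * b)"
definition s3 where "s3 = a ^ 2 - b ^ 2 - c ^ 2 + d ^ 2"

lemmas row_defs = N_def q1_def q2_def q3_def r1_def r2_def r3_def s1_def s2_def s3_def

text \<open>The sums span the part where \<open>Z\<close> is 1, which is the regular representation
  of the quotient of type (2, 2).\<close>

definition t1 where "t1 = x1 + n1"
definition ti where "ti = xi + ni"
definition tj where "tj = xj + nj"
definition tk where "tk = xk + nk"

text \<open>First entries of two rows of the rotation matrix. Of \<open>I\<close> and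
  \<open>J\<close>, only \<open>J\<close> changes the sign of \<open>Q\<close> and only
  \<open>I\<close> that of \<open>R\<close>; so 1, \<open>Q\<close>, \<open>R\<close>,
  \<open>Q * R\<close> realise the four characters of the quotient of type (2, 2).\<close>

definition Q where "Q = q1 / N"
definition R where "R = r1 / N"

text \<open>Ratios within a row are invariant because a row changes sign as a whole. The four
  combinations of the sums are eigenvectors for the four sign characters, each multiplied by the
  matching product of \<open>Q\<close> and \<open>R\<close>.\<close>

definition gens :: "'a set" where
  "gens = {N, q2 / q1, q3 / q1, r2 / r1, t1 + ti + tj + tk, (t1 + ti - tj - tk) * Q,
     (t1 - ti + tj - tk) * R, (t1 - ti - tj + tk) * (Q * R)}"

definition L :: "'a set" where
  "L = gen_field (K \<union> {x1, xi, xj, xk, n1, ni, nj, nk})"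

lemmas Z_simps = field_hom_simps[OF hom_Z] and I_simps = field_hom_simps[OF hom_I]
  and J_simps = field_hom_simps[OF hom_J]

lemma hom_two: "Z 2 = 2" "I 2 = 2" "J 2 = 2"
  using Z_simps(3)[of 1 1] I_simps(3)[of 1 1] J_simps(3)[of 1 1] by (simp_all add: Z_simps(2) I_simps(2) J_simps(2))

lemma Z_coords: "Z a = - a" "Z b = - b" "Z c = - c" "Z d = - d"
  and I_coords: "I a = b" "I b = - a" "I c = d" "I d = - c"
  and J_coords: "J a = c" "J b = - d" "J c = - a" "J d = b"
  by (simp_all add: a_def b_def c_def d_def Z_simps I_simps J_simps Z_x I_x J_x)

lemma Z_rows: "Z N = N" "Z q1 = q1" "Z q2 = q2" "Z q3 = q3" "Z r1 = r1" "Z r2 = r2"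
  by (simp_all add: row_defs Z_simps hom_two Z_coords)

lemma I_rows: "I N = N" "I q1 = q1" "I q2 = q2" "I q3 = q3" "I r1 = - r1" "I r2 = - r2"
  by (simp_all add: row_defs I_simps hom_two I_coords algebra_simps)

lemma J_rows: "J N = N" "J q1 = - q1" "J q2 = - q2" "J q3 = - q3" "J r1 = r1" "J r2 = r2"
  by (simp_all add: row_defs J_simps hom_two J_coords algebra_simps)

lemma t_action: "Z t1 = t1" "Z ti = ti" "Z tj = tj" "Z tk = tk"
  "I t1 = ti" "I ti = t1" "I tj = tk" "I tk = tj" "J t1 = tj" "J ti = tk" "J tj = t1" "J tk = ti"
  by (simp_all add: t1_def ti_def tj_def tk_def Z_simps I_simps J_simps Z_x I_x J_x add.commute)

lemma QR_action: "Z Q = Q" "I Q = Q" "J Q = - Q" "Z R = R" "I R = - R" "J R = R"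
  by (simp_all add: Q_def R_def Z_simps I_simps J_simps Z_rows I_rows J_rows)

lemma gens_fixed: "g \<in> gens \<Longrightarrow> Z g = g \<and> I g = g \<and> J g = g"
proof -
  let ?fixed = "\<lambda>g. Z g = g \<and> I g = g \<and> J g = g"
  have "?fixed N" "?fixed (q2 / q1)" "?fixed (q3 / q1)" "?fixed (r2 / r1)" "?fixed (t1 + ti + tj + tk)"
    "?fixed ((t1 + ti - tj - tk) * Q)" "?fixed ((t1 - ti + tj - tk) * R)"
    "?fixed ((t1 - ti - tj + tk) * (Q * R))"
    by (simp_all add: Z_simps I_simps J_simps Z_rows I_rows J_rows t_action QR_action algebra_simps)
  then show "g \<in> gens \<Longrightarrow> ?fixed g" unfolding gens_def by blast
qed

definition F where "F = gen_field (K \<union> {xi, xj, xk, n1, ni, nj, nk})"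

lemma F: "is_subfield F" unfolding F_def by (rule is_subfield_gen_field)

lemma x_F: "{xi, xj, xk, n1, ni, nj, nk} \<subseteq> F"
  unfolding F_def using gen_field_superset[of "K \<union> {xi, xj, xk, n1, ni, nj, nk}"] by blast

lemma coords_F: "b \<in> F" "c \<in> F" "d \<in> F"
  unfolding b_def c_def d_def using x_F by (auto intro: subfield_diff[OF F])

lemma a_transcendental: "\<not> algebraic_over F a"
proof
  assume "algebraic_over F a"
  then have "algebraic_over F (x1 + (- n1))" by (simp add: a_def)
  moreover have "- n1 \<in> F" using x_F by (intro subfield_uminus[OF F]) auto
  ultimately have "algebraic_over F x1" using algebraic_over_translate[OF F] by blast
  then show False using transcendental unfolding F_def by contradiction
qed

text \<open>Applies to \<open>N\<close>, \<open>q1\<close>, \<open>q3\<close> and \<open>r1\<close>,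
  which have degree at most 2 in the transcendental \<open>a\<close>.\<close>

lemma quadratic_nz:
  assumes "c0 \<in> F" "c1 \<in> F" "c2 \<in> F" "c1 \<noteq> 0 \<or> c2 \<noteq> 0"
  shows "c0 + c1 * a + c2 * a ^ 2 \<noteq> 0"
proof
  assume eq: "c0 + c1 * a + c2 * a ^ 2 = 0"
  define e where "e i = (if i = 0 then c0 else if i = 1 then c1 else c2)" for i :: nat
  have "(\<Sum>i\<le>2. e i * a ^ i) = 0" using eq by (simp add: e_def numeral_2_eq_2)
  moreover have "e i \<in> F" for i using assms by (simp add: e_def)
  moreover obtain j where "j \<le> 2" "e j \<noteq> 0"
    using assms(4) that[of 1] that[of 2] unfolding e_def by auto
  ultimately have "algebraic_over F a" by (intro algebraic_over_sum[OF F, of 2 e j])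
  then show False using a_transcendental by contradiction
qed

lemma coords_nz: "a \<noteq> 0" "b \<noteq> 0" "c \<noteq> 0" "d \<noteq> 0"
proof -
  show a: "a \<noteq> 0" using a_transcendental algebraic_over_member[OF F subfield_0[OF F]] by metis
  show "b \<noteq> 0" using a field_hom_eq_0_iff[OF hom_I, of a] by (simp add: I_coords)
  show c: "c \<noteq> 0" using a field_hom_eq_0_iff[OF hom_J, of a] by (simp add: J_coords)
  show "d \<noteq> 0" using c field_hom_eq_0_iff[OF hom_I, of c] by (simp add: I_coords)
qed

lemma rows_nz: "N \<noteq> 0" "q1 \<noteq> 0" "q3 \<noteq> 0" "r1 \<noteq> 0"
proof -
  have sq: "b ^ 2 \<in> F" "c ^ 2 \<in> F" "d ^ 2 \<in> F" "b * c \<in> F" "b * d \<in> F" "2 \<in> F"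
    using coords_F subfield_numeral[OF F] by (auto intro: subfield_power[OF F] subfield_mult[OF F])
  have "b ^ 2 + c ^ 2 + d ^ 2 + 0 * a + 1 * a ^ 2 \<noteq> 0"
    by (intro quadratic_nz subfield_add[OF F] sq subfield_0[OF F] subfield_1[OF F]) auto
  then show "N \<noteq> 0" by (simp add: N_def algebra_simps)
  have "b ^ 2 - c ^ 2 - d ^ 2 + 0 * a + 1 * a ^ 2 \<noteq> 0"
    by (intro quadratic_nz subfield_diff[OF F] sq subfield_0[OF F] subfield_1[OF F]) auto
  then show "q1 \<noteq> 0" by (simp add: q1_def algebra_simps)
  have "2 * (b * d) + (2 * c) * a + 0 * a ^ 2 \<noteq> 0"
    using coords_nz two by (intro quadratic_nz subfield_mult[OF F _ sq(5)] subfield_mult[OF F _ coords_F(2)]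
        sq subfield_0[OF F]) auto
  then show "q3 \<noteq> 0" by (simp add: q3_def algebra_simps)
  have "2 * (b * c) + (2 * d) * a + 0 * a ^ 2 \<noteq> 0"
    using coords_nz two by (intro quadratic_nz subfield_mult[OF F _ sq(4)] subfield_mult[OF F _ coords_F(3)]
        sq subfield_0[OF F]) auto
  then show "r1 \<noteq> 0" by (simp add: r1_def algebra_simps)
qed

lemma gens_card: "finite gens" "card gens \<le> 8"
  unfolding gens_def by (auto intro!: card_insert_le_m1)

lemma L: "is_subfield L" unfolding L_def by (rule is_subfield_gen_field)

lemma x_L: "{x1, xi, xj, xk, n1, ni, nj, nk} \<subseteq> L"
  unfolding L_def using gen_field_superset[of "K \<union> {x1, xi, xj, xk, n1, ni, nj, nk}"] by blast

lemma coords_L: "a \<in> L" "b \<in> L" "c \<in> L" "d \<in> L"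
  and t_L: "t1 \<in> L" "ti \<in> L" "tj \<in> L" "tk \<in> L"
  unfolding a_def b_def c_def d_def t1_def ti_def tj_def tk_def
  using x_L by (auto intro: subfield_diff[OF L] subfield_add[OF L])

lemma rows_L: "N \<in> L" "q1 \<in> L" "q2 \<in> L" "q3 \<in> L" "r1 \<in> L" "r2 \<in> L"
  unfolding row_defs
  by (intro subfield_add[OF L] subfield_diff[OF L] subfield_mult[OF L] subfield_power[OF L]
      subfield_numeral[OF L] coords_L)+

lemma gens_L: "gens \<subseteq> L"
proof -
  have "Q \<in> L" "R \<in> L" unfolding Q_def R_def by (intro subfield_divide[OF L] rows_L)+
  then show ?thesis
    unfolding gens_def using rows_L t_L
    by (auto intro!: subfield_divide[OF L] subfield_mult[OF L] subfield_add[OF L] subfield_diff[OF L])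
qed

section \<open>The tower of square roots over the field of invariants\<close>

definition F0 where "F0 = gen_field (K \<union> gens)"
definition F1 where "F1 = gen_field (insert Q F0)"
definition F2 where "F2 = gen_field (insert R F1)"
definition F3 where "F3 = gen_field (insert a F2)"

lemma F0: "is_subfield F0" and F1: "is_subfield F1" and F2: "is_subfield F2" and F3: "is_subfield F3"
  unfolding F0_def F1_def F2_def F3_def by (rule is_subfield_gen_field)+

lemma F01: "F0 \<subseteq> F1" and F12: "F1 \<subseteq> F2" and F23: "F2 \<subseteq> F3" and K_F0: "K \<subseteq> F0" and gens_F0: "gens \<subseteq> F0"
  and Q_F1: "Q \<in> F1" and R_F2: "R \<in> F2" and a_F3: "a \<in> F3"
  using gen_field_superset[of "K \<union> gens"] gen_field_superset[of "insert Q F0"]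
    gen_field_superset[of "insert R F1"] gen_field_superset[of "insert a F2"]
  unfolding F0_def[symmetric] F1_def[symmetric] F2_def[symmetric] F3_def[symmetric] by auto

text \<open>Orthogonality of the first two rows expresses \<open>r3 / r1\<close> by the other
  ratios, with \<open>q3 / q1\<close> as denominator.\<close>

lemma ratios_F0: "N \<in> F0" "q2 / q1 \<in> F0" "q3 / q1 \<in> F0" "r2 / r1 \<in> F0" "r3 / r1 \<in> F0"
proof -
  show g: "N \<in> F0" "q2 / q1 \<in> F0" "q3 / q1 \<in> F0" "r2 / r1 \<in> F0"
    using gens_F0 unfolding gens_def by auto
  have "q1 * r1 + q2 * r2 + q3 * r3 = 0" unfolding row_defs by algebra
  then have "r3 / r1 = - (1 + (r2 / r1) * (q2 / q1)) / (q3 / q1)"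
    using rows_nz by (simp add: field_simps) algebra
  also have "\<dots> \<in> F0"
    by (intro subfield_divide[OF F0] subfield_uminus[OF F0] subfield_add[OF F0] subfield_mult[OF F0]
        subfield_1[OF F0] g)
  finally show "r3 / r1 \<in> F0" .
qed

text \<open>The row has squared length \<open>N ^ 2\<close>; its ratios therefore determine its
  first entry up to sign.\<close>

lemma Q_sq_F0: "Q ^ 2 \<in> F0"
proof -
  have norm: "q1 ^ 2 + q2 ^ 2 + q3 ^ 2 = N ^ 2" unfolding row_defs by algebra
  have "Q ^ 2 * (1 + (q2 / q1) ^ 2 + (q3 / q1) ^ 2) = (q1 ^ 2 + q2 ^ 2 + q3 ^ 2) / N ^ 2"
    unfolding Q_def using rows_nz by (simp add: field_simps power2_eq_square)
  then have "Q ^ 2 * (1 + (q2 / q1) ^ 2 + (q3 / q1) ^ 2) = 1" using norm rows_nz by simp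
  then have "Q ^ 2 = inverse (1 + (q2 / q1) ^ 2 + (q3 / q1) ^ 2)"
    by (metis inverse_unique mult.commute)
  also have "\<dots> \<in> F0"
    by (intro subfield_inverse[OF F0] subfield_add[OF F0] subfield_power[OF F0] subfield_1[OF F0] ratios_F0)
  finally show ?thesis .
qed

lemma R_sq_F0: "R ^ 2 \<in> F0"
proof -
  have norm: "r1 ^ 2 + r2 ^ 2 + r3 ^ 2 = N ^ 2" unfolding row_defs by algebra
  have "R ^ 2 * (1 + (r2 / r1) ^ 2 + (r3 / r1) ^ 2) = (r1 ^ 2 + r2 ^ 2 + r3 ^ 2) / N ^ 2"
    unfolding R_def using rows_nz by (simp add: field_simps power2_eq_square)
  then have "R ^ 2 * (1 + (r2 / r1) ^ 2 + (r3 / r1) ^ 2) = 1" using norm rows_nz by simp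
  then have "R ^ 2 = inverse (1 + (r2 / r1) ^ 2 + (r3 / r1) ^ 2)"
    by (metis inverse_unique mult.commute)
  also have "\<dots> \<in> F0"
    by (intro subfield_inverse[OF F0] subfield_add[OF F0] subfield_power[OF F0] subfield_1[OF F0] ratios_F0)
  finally show ?thesis .
qed

text \<open>\<open>Q\<close> and \<open>R\<close> fix the scale of the first two rows, and the third
  is their cross product divided by \<open>N\<close>.\<close>

lemma rows_F2: "N \<in> F2" "q1 \<in> F2" "q2 \<in> F2" "q3 \<in> F2" "r1 \<in> F2" "r2 \<in> F2" "r3 \<in> F2"
    "s1 \<in> F2" "s2 \<in> F2" "s3 \<in> F2"
proof -
  have ratios: "q2 / q1 \<in> F2" "q3 / q1 \<in> F2" "r2 / r1 \<in> F2" "r3 / r1 \<in> F2"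
    using ratios_F0 F01 F12 by auto
  show N: "N \<in> F2" using ratios_F0 F01 F12 by auto
  have "Q * N \<in> F2" "R * N \<in> F2" using Q_F1 F12 R_F2 N by (auto intro: subfield_mult[OF F2])
  then show q1: "q1 \<in> F2" and r1: "r1 \<in> F2" using rows_nz by (auto simp: Q_def R_def)
  show rest: "q2 \<in> F2" "q3 \<in> F2" "r2 \<in> F2" "r3 \<in> F2"
    using subfield_mult[OF F2 ratios(1) q1] subfield_mult[OF F2 ratios(2) q1]
      subfield_mult[OF F2 ratios(3) r1] subfield_mult[OF F2 ratios(4) r1] rows_nz by auto
  have "s1 * N = q2 * r3 - q3 * r2" "s2 * N = q3 * r1 - q1 * r3" "s3 * N = q1 * r2 - q2 * r1"
    unfolding row_defs by algebra+
  then have "s1 = (q2 * r3 - q3 * r2) / N" "s2 = (q3 * r1 - q1 * r3) / N" "s3 = (q1 * r2 - q2 * r1) / N"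
    using rows_nz by (simp_all add: field_simps)
  then show "s1 \<in> F2" "s2 \<in> F2" "s3 \<in> F2"
    by (auto intro!: subfield_divide[OF F2] subfield_diff[OF F2] subfield_mult[OF F2] N q1 r1 rest)
qed

lemma four: "(4 :: 'a) \<noteq> 0"
proof -
  have "(4 :: 'a) = 2 * 2" by simp
  then show ?thesis using two by (metis mult_eq_0_iff)
qed

lemma quarter:
  fixes x y :: 'a
  assumes "is_subfield E" "4 * x = y" "y \<in> E"
  shows "x \<in> E"
proof -
  have "x = y / 4" using assms(2) four by (simp add: field_simps)
  then show ?thesis using assms(1,3) by (simp only: subfield_divide subfield_numeral)
qed

text \<open>A quaternion is recovered up to sign from its rotation: \<open>a ^ 2\<close> from the
  trace, and the products with \<open>a\<close> from the antisymmetric part.\<close>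

lemma products_F2: "a ^ 2 \<in> F2" "a * b \<in> F2" "a * c \<in> F2" "a * d \<in> F2"
proof -
  have "4 * a ^ 2 = N + q1 + r2 + s3" "4 * (a * b) = s2 - r3" "4 * (a * c) = q3 - s1" "4 * (a * d) = r1 - q2"
    unfolding row_defs by algebra+
  then show "a ^ 2 \<in> F2" "a * b \<in> F2" "a * c \<in> F2" "a * d \<in> F2"
    by (auto elim!: quarter[OF F2] intro!: subfield_add[OF F2] subfield_diff[OF F2] rows_F2)
qed

lemma coords_F3: "a \<in> F3" "b \<in> F3" "c \<in> F3" "d \<in> F3"
proof -
  show "a \<in> F3" by (rule a_F3)
  have "b = a * b / a" "c = a * c / a" "d = a * d / a" using coords_nz by auto
  then show "b \<in> F3" "c \<in> F3" "d \<in> F3"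
    using products_F2 F23 a_F3 by (metis subfield_divide[OF F3] subsetD)+
qed

text \<open>Inverts the character table of the group of type (2, 2), once the factors
  \<open>Q\<close> and \<open>R\<close> are divided out.\<close>

lemma t_F3: "t1 \<in> F3" "ti \<in> F3" "tj \<in> F3" "tk \<in> F3"
proof -
  define v0 where "v0 = t1 + ti + tj + tk"
  define v1 where "v1 = t1 + ti - tj - tk"
  define v2 where "v2 = t1 - ti + tj - tk"
  define v3 where "v3 = t1 - ti - tj + tk"
  have QR: "Q \<in> F3" "R \<in> F3" "Q \<noteq> 0" "R \<noteq> 0"
    using Q_F1 R_F2 F12 F23 rows_nz by (auto simp: Q_def R_def)
  have g: "v0 \<in> F3" "v1 * Q \<in> F3" "v2 * R \<in> F3" "v3 * (Q * R) \<in> F3"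
    using gens_F0 F01 F12 F23 unfolding gens_def v0_def v1_def v2_def v3_def by auto
  have v: "v0 \<in> F3" "v1 \<in> F3" "v2 \<in> F3" "v3 \<in> F3"
    using g(1) subfield_divide[OF F3 g(2) QR(1)] subfield_divide[OF F3 g(3) QR(2)]
      subfield_divide[OF F3 g(4) subfield_mult[OF F3 QR(1,2)]] QR(3,4) by auto
  have "4 * t1 = v0 + v1 + v2 + v3" "4 * ti = v0 + v1 - v2 - v3" "4 * tj = v0 - v1 + v2 - v3"
      "4 * tk = v0 - v1 - v2 + v3"
    unfolding v0_def v1_def v2_def v3_def by simp_all
  then show "t1 \<in> F3" "ti \<in> F3" "tj \<in> F3" "tk \<in> F3"
    by (auto elim!: quarter[OF F3] intro!: subfield_add[OF F3] subfield_diff[OF F3] v)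
qed

lemma L_F3: "L \<subseteq> F3"
proof -
  have half: "x \<in> F3 \<and> n \<in> F3" if "x - n \<in> F3" "x + n \<in> F3" for x n
  proof -
    have "x = ((x + n) + (x - n)) / 2" "n = ((x + n) - (x - n)) / 2" using two by (simp_all add: field_simps)
    then show ?thesis
      using that subfield_numeral[OF F3] by (metis subfield_divide[OF F3] subfield_add[OF F3] subfield_diff[OF F3])
  qed
  have "{x1, xi, xj, xk, n1, ni, nj, nk} \<subseteq> F3"
    using half[of x1 n1] half[of xi ni] half[of xj nj] half[of xk nk] coords_F3 t_F3
    unfolding a_def b_def c_def d_def t1_def ti_def tj_def tk_def by blast
  then show ?thesis unfolding L_def using K_F0 F01 F12 F23 by (intro gen_field_least F3) auto
qed

lemma fin_ext_F0_L: "fin_ext F0 L"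
proof -
  have "fin_ext F0 F1" unfolding F1_def by (rule kummer_fin_ext[OF F0 Q_sq_F0]) simp
  moreover have "R ^ 2 \<in> F1" using R_sq_F0 F01 by blast
  then have "fin_ext F1 F2" unfolding F2_def by (rule kummer_fin_ext[OF F1]) simp
  moreover have "fin_ext F2 F3" unfolding F3_def by (rule kummer_fin_ext[OF F2 products_F2(1)]) simp
  ultimately show ?thesis using L_F3 by (meson fin_ext_trans fin_ext_mono)
qed

text \<open>\<open>Z\<close> negates \<open>a\<close> and fixes \<open>F2\<close>, \<open>I\<close>
  negates \<open>R\<close> and fixes \<open>F1\<close>, and \<open>J\<close> negates
  \<open>Q\<close> and fixes \<open>F0\<close>. So the steps come off from the top, with -1 as root
  of unity.\<close>

lemma fixed_F0:
  assumes "f \<in> L" "Z f = f" "I f = f" "J f = f"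
  shows "f \<in> F0"
proof -
  have fix0: "Z g = g \<and> I g = g \<and> J g = g" if g: "g \<in> F0" for g
  proof -
    have "Z g = g \<and> I g = g \<and> J g = g" if "g \<in> K \<union> gens" for g
      using that gens_fixed Z_K I_K J_K by blast
    then show ?thesis
      using g gen_field_hom_fixed[OF hom_Z, of "K \<union> gens" g] gen_field_hom_fixed[OF hom_I, of "K \<union> gens" g]
        gen_field_hom_fixed[OF hom_J, of "K \<union> gens" g]
      unfolding F0_def by blast
  qed
  have fix1: "Z g = g \<and> I g = g" if g: "g \<in> F1" for g
  proof -
    have "Z g = g \<and> I g = g" if "g \<in> insert Q F0" for g
      using that fix0 QR_action by blast
    then show ?thesis
      using g gen_field_hom_fixed[OF hom_Z, of "insert Q F0" g] gen_field_hom_fixed[OF hom_I, of "insert Q F0" g]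
      unfolding F1_def by blast
  qed
  have fix2: "Z g = g" if g: "g \<in> F2" for g
  proof -
    have "Z g = g" if "g \<in> insert R F1" for g
      using that fix1 QR_action by blast
    then show ?thesis
      using g gen_field_hom_fixed[OF hom_Z, of "insert R F1" g] unfolding F2_def by blast
  qed
  have two': "(of_nat 2 :: 'a) \<noteq> 0" using two by simp
  note root = primitive_root_minus_1[OF two]
  have m1: "- 1 \<in> F0" "- 1 \<in> F1" "- 1 \<in> F2"
    using F0 F1 F2 by (auto intro: subfield_uminus subfield_1)
  have eig: "Z a = - 1 * a" "I R = - 1 * R" "J Q = - 1 * Q" by (simp_all add: Z_coords QR_action)
  have "R ^ 2 \<in> F1" using R_sq_F0 F01 by blast
  have "f \<in> gen_field (insert a F2)" using assms(1) L_F3 unfolding F3_def by blast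
  then have "f \<in> F2"
    using kummer_fixed[OF F2 two' root m1(3) hom_Z fix2 eig(1) products_F2(1)] assms(2) by blast
  then have "f \<in> F1"
    using kummer_fixed[OF F1 two' root m1(2) hom_I _ eig(2) \<open>R ^ 2 \<in> F1\<close>] fix1 assms(3) unfolding F2_def by blast
  then show "f \<in> F0"
    using kummer_fixed[OF F0 two' root m1(1) hom_J _ eig(3) Q_sq_F0] fix0 assms(4) unfolding F1_def by blast
qed

end

section \<open>Non-abelian groups of order \<open>p\<^sup>3\<close>\<close>

definition center :: "('g, 'b) monoid_scheme \<Rightarrow> 'g set" where
  "center G = {z \<in> carrier G. \<forall>g\<in>carrier G. z \<otimes>\<^bsub>G\<^esub> g = g \<otimes>\<^bsub>G\<^esub> z}"

definition centralizer :: "('g, 'b) monoid_scheme \<Rightarrow> 'g \<Rightarrow> 'g set" where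
  "centralizer G g = {h \<in> carrier G. h \<otimes>\<^bsub>G\<^esub> g = g \<otimes>\<^bsub>G\<^esub> h}"

context group
begin

lemma subgroup_centralizer:
  assumes g: "g \<in> carrier G"
  shows "subgroup (centralizer G g) G"
proof (rule subgroupI)
  show "centralizer G g \<noteq> {}" using g by (auto simp: centralizer_def)
next
  fix h assume h: "h \<in> centralizer G g"
  then have hc: "h \<in> carrier G" "h \<otimes> g = g \<otimes> h" by (auto simp: centralizer_def)
  have "inv h \<otimes> g = inv h \<otimes> (g \<otimes> h) \<otimes> inv h" using hc(1) g by (simp add: m_assoc)
  also have "\<dots> = inv h \<otimes> (h \<otimes> g) \<otimes> inv h" by (simp only: hc(2))
  also have "\<dots> = g \<otimes> inv h" using hc(1) g by (simp flip: m_assoc)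
  finally show "inv h \<in> centralizer G g" using hc(1) by (simp add: centralizer_def)
next
  fix h k assume "h \<in> centralizer G g" "k \<in> centralizer G g"
  then show "h \<otimes> k \<in> centralizer G g" using g by (simp add: centralizer_def) (metis m_assoc)
qed (auto simp: centralizer_def)

lemma center_eq_Inter: "center G = (\<Inter>g\<in>carrier G. centralizer G g)"
  by (auto simp: center_def centralizer_def)

lemma subgroup_center: "subgroup (center G) G"
  unfolding center_eq_Inter using subgroup_centralizer by (intro subgroups_Inter) auto

lemma center_normal: "center G \<lhd> G"
  unfolding normal_inv_iff
proof (intro conjI ballI subgroup_center)
  fix g z assume "g \<in> carrier G" "z \<in> center G"
  then have "g \<otimes> z \<otimes> inv g = z" by (simp add: center_def) (metis inv_solve_right m_closed)
  then show "g \<otimes> z \<otimes> inv g \<in> center G" using \<open>z \<in> center G\<close> by simp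
qed

lemma card_subgroup_dvd: "subgroup H G \<Longrightarrow> card H dvd order G"
  using lagrange[of H] by (metis dvd_triv_right)

lemma center_less_centralizer:
  assumes "finite (carrier G)" "g \<in> carrier G" "g \<notin> center G"
  shows "card (center G) < card (centralizer G g)" "card (centralizer G g) < order G"
proof -
  have "center G \<subset> centralizer G g"
    using assms unfolding center_def centralizer_def by auto
  moreover have "centralizer G g \<subset> carrier G"
    using assms unfolding center_def centralizer_def by force
  ultimately show "card (center G) < card (centralizer G g)" "card (centralizer G g) < order G"
    using assms(1) unfolding order_def by (auto intro: psubset_card_mono finite_subset)
qed

text \<open>The class equation: if the center were trivial, every class except that of
  \<open>\<one>\<close> would have size divisible by \<open>p\<close>, and the group order would be
  1 modulo \<open>p\<close>.\<close>

lemma p_group_center: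
  assumes p: "Factorial_Ring.prime p" and ord: "order G = p ^ n" "n > 0"
  shows "card (center G) > 1"
proof (rule ccontr)
  assume "\<not> card (center G) > 1"
  have fin: "finite (carrier G)"
    using ord p by (metis order_def card.infinite not_prime_0 power_not_zero)
  have one: "\<one> \<in> center G" by (auto simp: center_def)
  have "finite (center G)" using fin by (rule finite_subset[rotated]) (auto simp: center_def)
  then have center: "center G = {\<one>}"
    using \<open>\<not> card (center G) > 1\<close> one by (auto simp: card_le_Suc0_iff_eq not_less)
  define \<phi> where "\<phi> = (\<lambda>g. (\<lambda>h \<in> carrier G. g \<otimes> h \<otimes> (inv g)))"
  interpret conj: group_action G "carrier G" \<phi> unfolding \<phi>_def by (rule action_by_conjugation)
  have orb_dvd: "p dvd card (orbit G \<phi> x)" if x: "x \<in> carrier G" "x \<noteq> \<one>" for x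
  proof -
    have "card (orbit G \<phi> x) dvd p ^ n"
      using conj.orbit_stabilizer_theorem[OF x(1)] ord(1) by (metis dvd_triv_left)
    then obtain k where k: "card (orbit G \<phi> x) = p ^ k"
      using divides_primepow_nat[OF p] by blast
    have "x \<notin> center G" using x center by simp
    then obtain g where g: "g \<in> carrier G" "x \<otimes> g \<noteq> g \<otimes> x" using x by (auto simp: center_def)
    have "g \<otimes> x \<otimes> inv g \<noteq> x" using g x by (metis inv_solve_right m_closed)
    moreover have "g \<otimes> x \<otimes> inv g \<in> orbit G \<phi> x" "x \<in> orbit G \<phi> x"
      using g x conj.orbit_refl[OF x(1)] by (auto simp: orbit_def \<phi>_def intro!: exI[of _ g])
    ultimately have "card (orbit G \<phi> x) \<noteq> 1" by (metis card_1_singletonE singletonD)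
    then have "k \<noteq> 0" using k by (metis power_0)
    then show ?thesis using k by simp
  qed
  have orb1: "orbit G \<phi> \<one> = {\<one>}" by (auto simp: orbit_def \<phi>_def intro: exI[of _ \<one>])
  have orbs: "finite (orbits G (carrier G) \<phi>)" using fin by (simp add: orbits_def setcompr_eq_image)
  have one_orb: "{\<one>} \<in> orbits G (carrier G) \<phi>" using orb1 by (auto simp: orbits_def)
  have "order G = (\<Sum>orb\<in>orbits G (carrier G) \<phi>. card orb)"
    using conj.disjoint_sum[OF fin, of "\<lambda>_. 1 :: nat"] by (simp add: order_def)
  also have "\<dots> = 1 + (\<Sum>orb\<in>orbits G (carrier G) \<phi> - {{\<one>}}. card orb)"
    using sum.remove[OF orbs one_orb, of card] by simp
  finally have "order G = 1 + (\<Sum>orb\<in>orbits G (carrier G) \<phi> - {{\<one>}}. card orb)" .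
  moreover have "p dvd (\<Sum>orb\<in>orbits G (carrier G) \<phi> - {{\<one>}}. card orb)"
  proof (rule dvd_sum)
    fix orb assume "orb \<in> orbits G (carrier G) \<phi> - {{\<one>}}"
    then obtain x where x: "x \<in> carrier G" "orb = orbit G \<phi> x" "orb \<noteq> {\<one>}" by (auto simp: orbits_def)
    then have "x \<noteq> \<one>" using orb1 by auto
    then show "p dvd card orb" using orb_dvd x by simp
  qed
  moreover have "p dvd order G" using ord by simp
  ultimately have "p dvd 1" by (metis dvd_add_left_iff)
  then show False using p by simp
qed

text \<open>A noncentral \<open>g\<close> puts its centralizer strictly between the center and the
  group, and between \<open>p\<close> and \<open>p ^ 2\<close> there is no further power of
  \<open>p\<close>.\<close>

lemma order_p2_comm:
  assumes p: "Factorial_Ring.prime p" and ord: "order G = p ^ 2" and g: "g \<in> carrier G"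
  shows "g \<in> center G"
proof (rule ccontr)
  assume nc: "g \<notin> center G"
  have fin: "finite (carrier G)"
    using ord p by (metis order_def card.infinite not_prime_0 power_not_zero)
  note * = center_less_centralizer[OF fin g nc]
  obtain k where k: "card (centralizer G g) = p ^ k" "k \<le> 2"
    using card_subgroup_dvd[OF subgroup_centralizer[OF g]] divides_primepow_nat[OF p] ord by metis
  obtain j where j: "card (center G) = p ^ j" "j \<le> 2"
    using card_subgroup_dvd[OF subgroup_center] divides_primepow_nat[OF p] ord by metis
  have "j \<noteq> 0" using p_group_center[OF p ord] j by (metis less_irrefl power_0 zero_less_numeral)
  moreover have "j < k" "k < 2"
    using * j k ord prime_gt_1_nat[OF p] by (auto simp: power_strict_increasing_iff)
  ultimately show False by simp
qed

text \<open>The same squeeze: p^j < p^k < p^3 for center and centralizer, with j positive, forces j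
  = 1.\<close>

lemma order_p3_center:
  assumes p: "Factorial_Ring.prime p" and ord: "order G = p ^ 3" and nc: "g \<in> carrier G" "g \<notin> center G"
  shows "card (center G) = p"
proof -
  have fin: "finite (carrier G)"
    using ord p by (metis order_def card.infinite not_prime_0 power_not_zero)
  note * = center_less_centralizer[OF fin nc]
  obtain k where k: "card (centralizer G g) = p ^ k" "k \<le> 3"
    using card_subgroup_dvd[OF subgroup_centralizer[OF nc(1)]] divides_primepow_nat[OF p] ord by metis
  obtain j where j: "card (center G) = p ^ j" "j \<le> 3"
    using card_subgroup_dvd[OF subgroup_center] divides_primepow_nat[OF p] ord by metis
  have "j \<noteq> 0" using p_group_center[OF p ord] j by (metis less_irrefl power_0 zero_less_numeral)
  moreover have "j < k" "k < 3"
    using * j k ord prime_gt_1_nat[OF p] by (auto simp: power_strict_increasing_iff)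
  ultimately have "j = 1" by simp
  then show ?thesis using j by simp
qed

lemma pow_diff_eq_1:
  assumes "z \<in> carrier G" "a \<le> (b :: nat)" "z [^] a = z [^] b"
  shows "z [^] (b - a) = \<one>"
proof -
  have "z [^] a \<otimes> z [^] (b - a) = z [^] b" using assms(1,2) by (simp add: nat_pow_mult)
  then show ?thesis using assms(1,3) by (simp add: l_cancel_one)
qed

text \<open>The order \<open>k\<close> of \<open>z\<close> is at most \<open>p\<close> by the
  pigeonhole principle in \<open>C\<close>, and a power of \<open>p\<close> by Lagrange for the
  cyclic subgroup \<open>D\<close>.\<close>

lemma pow_prime_eq_1:
  assumes p: "Factorial_Ring.prime p" and ord: "order G = p ^ n"
    and C: "subgroup C G" "card C = p" and z: "z \<in> C"
  shows "z [^] p = \<one>"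
proof -
  have zc: "z \<in> carrier G" using z C(1) by (rule subgroup.mem_carrier[rotated])
  have pow_C: "z [^] i \<in> C" for i :: nat
    by (induction i) (use z C(1) in \<open>auto intro: subgroup.one_closed subgroup.m_closed\<close>)
  have "\<not> inj_on (\<lambda>i::nat. z [^] i) {..p}"
  proof
    assume "inj_on (\<lambda>i::nat. z [^] i) {..p}"
    then have "card {..p} \<le> card C"
      using pow_C C(2) prime_gt_0_nat[OF p] by (intro card_inj_on_le) (auto intro: card_ge_0_finite)
    then show False using C(2) by simp
  qed
  then obtain i j where ij: "i < j" "j \<le> p" "z [^] i = z [^] j"
    unfolding inj_on_def by (metis atMost_iff linorder_neqE_nat)
  then have ex: "0 < j - i \<and> z [^] (j - i) = \<one>" using pow_diff_eq_1[OF zc, of i j] by simp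
  define k :: nat where "k = (LEAST k. 0 < k \<and> z [^] k = \<one>)"
  have k: "0 < k" "z [^] k = \<one>" "k \<le> p"
    using LeastI[of "\<lambda>k. 0 < k \<and> z [^] k = \<one>", OF ex] Least_le[of "\<lambda>k. 0 < k \<and> z [^] k = \<one>", OF ex] ij(2)
    unfolding k_def by auto
  have k_min: "z [^] l \<noteq> \<one>" if "0 < l" "l < k" for l :: nat
    using not_less_Least[of l "\<lambda>k. 0 < k \<and> z [^] k = \<one>"] that unfolding k_def by blast
  have k_mult: "z [^] (k * q) = \<one>" for q :: nat
    using k(2) zc by (simp flip: nat_pow_pow)
  have mod_k: "z [^] l = z [^] (l mod k)" for l :: nat
  proof -
    have "z [^] l = z [^] (k * (l div k)) \<otimes> z [^] (l mod k)" using zc by (simp add: nat_pow_mult)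
    then show ?thesis using k_mult zc by simp
  qed
  define D where "D = (\<lambda>i::nat. z [^] i) ` {..<k}"
  have pow_D: "z [^] l \<in> D" for l :: nat
    using k(1) mod_k[of l] unfolding D_def by (intro image_eqI[of _ _ "l mod k"]) auto
  have "subgroup D G"
  proof (rule subgroupI)
    show "D \<subseteq> carrier G" using zc by (auto simp: D_def)
    show "D \<noteq> {}" using k(1) by (auto simp: D_def)
  next
    fix x assume "x \<in> D"
    then obtain l where l: "x = z [^] l" "l < k" by (auto simp: D_def)
    have "z [^] l \<otimes> z [^] (k - l) = \<one>" using l zc k(2) by (simp add: nat_pow_mult)
    then have "inv x = z [^] (k - l)" using l(1) zc by (metis inv_equality inv_inv inv_closed nat_pow_closed)
    then show "inv x \<in> D" using pow_D by simp
  next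
    fix x y assume "x \<in> D" "y \<in> D"
    then show "x \<otimes> y \<in> D" using pow_D zc by (auto simp: D_def nat_pow_mult)
  qed
  moreover have "card D = k"
  proof -
    have "a = b" if "a \<le> b" "b < k" "z [^] a = z [^] b" for a b :: nat
    proof (rule ccontr)
      assume "a \<noteq> b"
      then show False using \<open>a \<noteq> b\<close> k_min[of "b - a"] pow_diff_eq_1[OF zc that(1,3)] that by (simp add: less_imp_diff_less)
    qed
    then have "inj_on (\<lambda>i::nat. z [^] i) {..<k}"
      by (intro inj_onI) (metis lessThan_iff nle_le)
    then show ?thesis unfolding D_def by (simp add: card_image)
  qed
  ultimately have "k dvd p ^ n" using card_subgroup_dvd ord by metis
  then obtain m where "k = p ^ m" using divides_primepow_nat[OF p] by blast
  then have "k = 1 \<or> k = p"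
    using k(3) prime_gt_1_nat[OF p] power_increasing_iff[of p m 1] by (cases m) auto
  then show ?thesis using k(2) zc by auto
qed

text \<open>The quotient by the center has order \<open>p ^ 2\<close> and is therefore abelian,
  which makes the commutator of \<open>s\<close> and \<open>t\<close> central; and the center has
  order \<open>p\<close>.\<close>

lemma order_p3_commutator:
  assumes p: "Factorial_Ring.prime p" and ord: "order G = p ^ 3"
    and st: "s \<in> carrier G" "t \<in> carrier G" "t \<otimes> s \<noteq> s \<otimes> t"
  obtains z where "z \<in> center G" "t \<otimes> s = s \<otimes> t \<otimes> z" "z \<noteq> \<one>" "z [^] p = \<one>"
proof -
  have "s \<notin> center G" using st unfolding center_def by force
  then have card: "card (center G) = p" using order_p3_center[OF p ord st(1)] by simp
  have fin: "finite (carrier G)"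
    using ord p by (metis order_def card.infinite not_prime_0 power_not_zero)
  define z where "z = inv (s \<otimes> t) \<otimes> (t \<otimes> s)"
  have z_in: "z \<in> carrier G" and ts: "t \<otimes> s = s \<otimes> t \<otimes> z"
    using st by (auto simp: z_def simp flip: m_assoc)
  interpret Q: group "G Mod center G" using center_normal by (rule normal.factorgroup_is_group)
  have "order (G Mod center G) * p = p ^ 3"
    using lagrange[OF subgroup_center] ord card by (simp add: order_def FactGroup_def)
  then have "order (G Mod center G) = p ^ 2"
    using p by (simp add: power3_eq_cube power2_eq_square)
  moreover have "center G #> s \<in> carrier (G Mod center G)" "center G #> t \<in> carrier (G Mod center G)"
    using st by (auto simp: carrier_FactGroup)
  ultimately have "(center G #> s) <#> (center G #> t) = (center G #> t) <#> (center G #> s)"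
    using Q.order_p2_comm[OF p] by (auto simp: center_def)
  then have "center G #> (s \<otimes> t) = center G #> (t \<otimes> s)"
    using st by (simp add: normal.rcos_sum[OF center_normal])
  moreover have "t \<otimes> s \<in> center G #> (t \<otimes> s)"
    using st subgroup_center by (intro rcos_self) auto
  ultimately obtain y where y: "y \<in> center G" "t \<otimes> s = y \<otimes> (s \<otimes> t)" by (auto simp: r_coset_def)
  then have "t \<otimes> s = s \<otimes> t \<otimes> y" using st by (auto simp: center_def)
  then have "z = y" using ts z_in y(1) st by (simp add: center_def)
  then have zc: "z \<in> center G" using y by simp
  have "z \<noteq> \<one>" using ts st by auto
  moreover have "z [^] p = \<one>" by (rule pow_prime_eq_1[OF p ord subgroup_center card zc])
  ultimately show ?thesis using that zc ts by blast
qed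

section \<open>Normal forms for two generators with central commutator\<close>

context
  fixes s t z :: 'a and p :: nat
  assumes s: "s \<in> carrier G" and t: "t \<in> carrier G" and z: "z \<in> center G"
    and ts: "t \<otimes> s = s \<otimes> t \<otimes> z" and z_ne: "z \<noteq> \<one>" and z_p: "z [^] p = \<one>"
    and p: "Factorial_Ring.prime p"
begin

lemma z_carrier: "z \<in> carrier G"
  using z by (simp add: center_def)

lemma z_pow_center: "z [^] (n::nat) \<in> center G"
  by (induction n) (use z subgroup_center in \<open>auto intro: subgroup.one_closed subgroup.m_closed\<close>)

lemma z_pow_comm: "g \<in> carrier G \<Longrightarrow> z [^] (n::nat) \<otimes> g = g \<otimes> z [^] n"
  using z_pow_center[of n] by (simp add: center_def)

lemma t_s_pow: "t \<otimes> s [^] (i::nat) = s [^] i \<otimes> t \<otimes> z [^] i"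
proof (induction i)
  case 0
  then show ?case using t by simp
next
  case (Suc i)
  have "t \<otimes> s [^] Suc i = s [^] i \<otimes> t \<otimes> z [^] i \<otimes> s"
    using Suc s t by (simp flip: m_assoc)
  also have "\<dots> = s [^] i \<otimes> (t \<otimes> s) \<otimes> z [^] i"
    using s t z_carrier z_pow_comm[OF s, of i] by (simp add: m_assoc)
  also have "\<dots> = s [^] Suc i \<otimes> t \<otimes> z [^] Suc i"
    unfolding ts using s t z_carrier z_pow_comm[OF z_carrier, of i] by (simp add: m_assoc)
  finally show ?case .
qed

lemma t_pow_s: "t [^] (b::nat) \<otimes> s = s \<otimes> t [^] b \<otimes> z [^] b"
proof (induction b)
  case 0
  then show ?case using s by simp
next
  case (Suc b)
  have "t [^] Suc b \<otimes> s = t [^] b \<otimes> (s \<otimes> t \<otimes> z)"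
    using s t ts by (simp add: m_assoc)
  also have "\<dots> = (t [^] b \<otimes> s) \<otimes> t \<otimes> z" using s t z_carrier by (simp add: m_assoc)
  also have "\<dots> = s \<otimes> t [^] b \<otimes> (z [^] b \<otimes> t) \<otimes> z" unfolding Suc using s t z_carrier by (simp add: m_assoc)
  also have "\<dots> = s \<otimes> t [^] Suc b \<otimes> z [^] Suc b"
    unfolding z_pow_comm[OF t] using s t z_carrier by (simp add: m_assoc)
  finally show ?case .
qed

lemma z_pow_eq_1_iff: "z [^] (k::nat) = \<one> \<longleftrightarrow> p dvd k"
proof
  assume k: "z [^] k = \<one>"
  show "p dvd k"
  proof (rule ccontr)
    assume "\<not> p dvd k"
    then have "coprime k p" using p by (metis coprime_commute prime_imp_coprime)
    moreover have "k \<noteq> 0" using \<open>\<not> p dvd k\<close> by (metis dvd_0_right)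
    ultimately obtain x y where xy: "k * x = p * y + 1"
      using bezout_nat[of k p] by auto
    have "\<one> = (z [^] k) [^] x" using k by simp
    also have "\<dots> = z [^] (p * y + 1)" using z_carrier xy by (simp only: nat_pow_pow)
    also have "\<dots> = (z [^] p) [^] y \<otimes> z" using z_carrier by (simp add: nat_pow_pow)
    also have "\<dots> = z" using z_p z_carrier by simp
    finally show False using z_ne by simp
  qed
next
  assume "p dvd k"
  then obtain l where "k = p * l" by auto
  then have "z [^] k = (z [^] p) [^] l" using z_carrier by (simp only: nat_pow_pow)
  then show "z [^] k = \<one>" using z_p by simp
qed

lemma z_pow_inj: "z [^] (i::nat) = z [^] (j::nat) \<Longrightarrow> i < p \<Longrightarrow> j < p \<Longrightarrow> i = j"
proof (induction i j rule: linorder_wlog)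
  case (le i j)
  have "z [^] (j - i) = \<one>" by (rule pow_diff_eq_1[OF z_carrier le(1,2)])
  then show ?case using le z_pow_eq_1_iff[of "j - i"] by (auto dest: dvd_imp_le)
qed simp

text \<open>The exponents are arbitrary naturals, so the multiplication formulas stay free of
  reduction modulo \<open>p\<close>; periodicity is a separate fact.\<close>

definition elt :: "nat \<Rightarrow> nat \<Rightarrow> nat \<Rightarrow> 'a" where
  "elt i b a = s [^] i \<otimes> t [^] b \<otimes> z [^] a"

lemma elt_closed: "elt i b a \<in> carrier G"
  using s t z_carrier by (simp add: elt_def)

lemma z_elt: "z \<otimes> elt i b a = elt i b (a + 1)"
  using s t z_carrier z_pow_comm[of "s [^] i \<otimes> t [^] b" 1] z_pow_comm[OF z_carrier, of a]
  by (simp add: elt_def m_assoc[symmetric])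

lemma s_elt: "s \<otimes> elt i b a = elt (i + 1) b a"
  using s t z_carrier nat_pow_Suc2[OF s, of i] by (simp add: elt_def m_assoc[symmetric])

lemma t_elt: "t \<otimes> elt i b a = elt i (b + 1) (a + i)"
proof -
  have "t \<otimes> elt i b a = (t \<otimes> s [^] i) \<otimes> t [^] b \<otimes> z [^] a"
    using s t z_carrier by (simp add: elt_def m_assoc)
  also have "\<dots> = s [^] i \<otimes> t \<otimes> (z [^] i \<otimes> t [^] b) \<otimes> z [^] a"
    unfolding t_s_pow using s t z_carrier by (simp add: m_assoc)
  also have "\<dots> = s [^] i \<otimes> (t \<otimes> t [^] b) \<otimes> (z [^] i \<otimes> z [^] a)"
    using s t z_carrier z_pow_comm[of "t [^] b" i] by (simp add: m_assoc)
  also have "\<dots> = elt i (b + 1) (a + i)"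
    using t z_carrier nat_pow_Suc2[OF t, of b] by (simp add: elt_def nat_pow_mult add.commute)
  finally show ?thesis .
qed

lemma elt_t: "elt i b a \<otimes> t = elt i (b + 1) a"
  using s t z_carrier z_pow_comm[OF t, of a] by (simp add: elt_def m_assoc)

lemma elt_s: "elt i b a \<otimes> s = elt (i + 1) b (a + b)"
proof -
  have "elt i b a \<otimes> s = s [^] i \<otimes> (t [^] b \<otimes> s) \<otimes> z [^] a"
    using s t z_carrier z_pow_comm[OF s, of a] by (simp add: elt_def m_assoc)
  also have "\<dots> = s [^] Suc i \<otimes> t [^] b \<otimes> (z [^] b \<otimes> z [^] a)"
    unfolding t_pow_s using s t z_carrier by (simp add: m_assoc)
  also have "\<dots> = elt (i + 1) b (a + b)"
    using z_carrier by (simp add: elt_def nat_pow_mult add.commute del: nat_pow_Suc)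
  finally show ?thesis .
qed

lemma elt_add: "elt i b (a + k) = elt i b a \<otimes> z [^] k"
  using s t z_carrier by (simp add: elt_def m_assoc flip: nat_pow_mult)

lemma elt_cancel: "elt i b a = elt i b c \<longleftrightarrow> z [^] a = z [^] c"
  unfolding elt_def using s t z_carrier by simp

lemma elt_comm_t: "t \<otimes> elt i b a = elt i b a \<otimes> t \<longleftrightarrow> p dvd i"
  unfolding t_elt elt_t elt_cancel using z_carrier z_pow_eq_1_iff[of i]
  by (simp flip: nat_pow_mult)

lemma elt_comm_s: "s \<otimes> elt i b a = elt i b a \<otimes> s \<longleftrightarrow> p dvd b"
  unfolding s_elt elt_s elt_cancel using z_carrier z_pow_eq_1_iff[of b]
  by (auto simp flip: nat_pow_mult)

text \<open>The commutator with \<open>t\<close> reveals \<open>z [^] i\<close> and the one with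
  \<open>s\<close> reveals \<open>z [^] b\<close>; after that \<open>a\<close> is read off
  directly.\<close>

lemma elt_inj: "inj_on (\<lambda>(i, b, a). elt i b a) ({..<p} \<times> {..<p} \<times> {..<p})"
proof -
  have "i = i' \<and> b = b' \<and> a = a'"
    if lt: "i < p" "b < p" "a < p" "i' < p" "b' < p" "a' < p" and eq: "elt i b a = elt i' b' a'"
    for i b a i' b' a'
  proof -
    let ?g = "elt i b a"
    have tg: "t \<otimes> elt i b a = elt i b a \<otimes> t \<otimes> z [^] i" for i b a
      unfolding t_elt elt_t elt_add ..
    have gs: "elt i b a \<otimes> s = s \<otimes> elt i b a \<otimes> z [^] b" for i b a
      unfolding elt_s s_elt elt_add ..
    have "?g \<otimes> t \<otimes> z [^] i = ?g \<otimes> t \<otimes> z [^] i'" using tg[of i b a] tg[of i' b' a'] eq by simp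
    then have i: "i = i'" using lt z_pow_inj t z_carrier elt_closed by simp
    have "s \<otimes> ?g \<otimes> z [^] b = s \<otimes> ?g \<otimes> z [^] b'" using gs[of i b a] gs[of i' b' a'] eq by simp
    then have b: "b = b'" using lt z_pow_inj s z_carrier elt_closed by simp
    show ?thesis using i b eq elt_cancel z_pow_inj lt by simp
  qed
  then show ?thesis by (auto simp: inj_on_def)
qed

lemma elt_bij:
  assumes ord: "order G = p ^ 3"
  shows "bij_betw (\<lambda>(i, b, a). elt i b a) ({..<p} \<times> {..<p} \<times> {..<p}) (carrier G)"
  unfolding bij_betw_def
proof (intro conjI elt_inj)
  let ?f = "\<lambda>(i, b, a). elt i b a"
  have fin: "finite (carrier G)"
    using ord p by (metis order_def card.infinite not_prime_0 power_not_zero)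
  have "card (?f ` ({..<p} \<times> {..<p} \<times> {..<p})) = p ^ 3"
    using card_image[OF elt_inj] by (simp add: card_cartesian_product power3_eq_cube)
  then show "?f ` ({..<p} \<times> {..<p} \<times> {..<p}) = carrier G"
    using ord fin elt_closed by (intro card_subset_eq) (auto simp: order_def)
qed

text \<open>In the normal form of \<open>g\<close>, commuting with \<open>t\<close> and
  \<open>s\<close> makes \<open>i\<close> and \<open>b\<close> divisible by \<open>p\<close>, hence
  0. It serves for the \<open>p\<close>-th powers of \<open>s\<close> and \<open>t\<close>.\<close>

lemma central_pow:
  assumes ord: "order G = p ^ 3" and g: "g \<in> carrier G" "t \<otimes> g = g \<otimes> t" "s \<otimes> g = g \<otimes> s"
  shows "\<exists>r<p. g = z [^] r"
proof -
  have "g \<in> (\<lambda>(i, b, a). elt i b a) ` ({..<p} \<times> {..<p} \<times> {..<p})"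
    using bij_betw_imp_surj_on[OF elt_bij[OF ord]] g(1) by simp
  then obtain i b a where "i < p" "b < p" "a < p" "g = elt i b a" by auto
  moreover have "i = 0" "b = 0"
    using calculation g elt_comm_t[of i b a] elt_comm_s[of i b a] by (auto dest: dvd_imp_le)
  ultimately show ?thesis using z_carrier by (auto simp: elt_def)
qed

lemma s_pow_p: "order G = p ^ 3 \<Longrightarrow> \<exists>r<p. s [^] p = z [^] r"
proof (rule central_pow)
  show "t \<otimes> s [^] p = s [^] p \<otimes> t" using t_s_pow[of p] s t z_p by simp
  show "s \<otimes> s [^] p = s [^] p \<otimes> s" using nat_pow_Suc2[OF s, of p] by simp
qed (use s in auto)

lemma t_pow_p: "order G = p ^ 3 \<Longrightarrow> \<exists>r<p. t [^] p = z [^] r"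
proof (rule central_pow)
  show "s \<otimes> t [^] p = t [^] p \<otimes> s" using t_pow_s[of p] s t z_p by simp
  show "t \<otimes> t [^] p = t [^] p \<otimes> t" using nat_pow_Suc2[OF t, of p] by simp
qed (use t in auto)

text \<open>Moving a new \<open>s [^] j\<close> to the left past \<open>i\<close> factors
  \<open>t\<close> costs \<open>z [^] (j * i)\<close>, and the costs add up to a triangular
  number.\<close>

lemma pow_product: "(s [^] j \<otimes> t) [^] (n::nat) = s [^] (j * n) \<otimes> t [^] n \<otimes> z [^] (j * (\<Sum>i<n. i))"
proof (induction n)
  case 0
  then show ?case by simp
next
  case (Suc n)
  have 1: "elt i b a \<otimes> s [^] j = elt (i + j) b (a + b * j)" for i b a j
  proof (induction j)
    case (Suc j)
    have "elt i b a \<otimes> s [^] Suc j = (elt i b a \<otimes> s [^] j) \<otimes> s" using s elt_closed by (simp add: m_assoc)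
    then show ?case using Suc by (simp add: elt_s algebra_simps)
  qed (use elt_closed in simp)
  have "(s [^] j \<otimes> t) [^] Suc n = elt (j * n) n (j * (\<Sum>i<n. i)) \<otimes> s [^] j \<otimes> t"
    using Suc s t elt_closed by (simp add: elt_def m_assoc)
  also have "\<dots> = elt (j * Suc n) (Suc n) (j * (\<Sum>i<Suc n. i))"
    by (simp add: 1 elt_t algebra_simps)
  finally show ?case by (simp add: elt_def)
qed

end

text \<open>Write the \<open>p\<close>-th powers of \<open>s\<close> and \<open>t\<close> as
  \<open>z [^] r\<close> and \<open>z [^] m\<close>. For odd \<open>p\<close> the triangular number
  in \<open>pow_product\<close> is divisible by \<open>p\<close>, so the \<open>p\<close>-th power
  of \<open>s [^] j \<otimes> t\<close> is \<open>z [^] (r * j + m)\<close>, and for nonzero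
  \<open>r\<close> some \<open>j\<close> makes it trivial. For \<open>p = 2\<close> the triangular
  number is 1, and \<open>r = m = 1\<close> remains as the quaternion group.\<close>

lemma order_p3_cases:
  assumes p: "Factorial_Ring.prime p" and ord: "order G = p ^ 3" and nc: "\<not> comm_group G"
  obtains (modular) s t z where "s \<in> carrier G" "t \<in> carrier G" "z \<in> center G" "t \<otimes> s = s \<otimes> t \<otimes> z"
      "z \<noteq> \<one>" "z [^] p = \<one>" "t [^] p = \<one>"
  | (quaternion) s t z where "s \<in> carrier G" "t \<in> carrier G" "z \<in> center G" "t \<otimes> s = s \<otimes> t \<otimes> z"
      "z \<noteq> \<one>" "z [^] p = \<one>" "p = 2" "s \<otimes> s = z" "t \<otimes> t = z"
proof -
  have "\<exists>s\<in>carrier G. \<exists>t\<in>carrier G. t \<otimes> s \<noteq> s \<otimes> t"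
  proof (rule ccontr)
    assume "\<not> ?thesis"
    then have "\<And>s t. s \<in> carrier G \<Longrightarrow> t \<in> carrier G \<Longrightarrow> t \<otimes> s = s \<otimes> t" by blast
    then have "comm_group G" by (intro group_comm_groupI)
    then show False using nc by contradiction
  qed
  then obtain s t where s: "s \<in> carrier G" and t: "t \<in> carrier G" and ne: "t \<otimes> s \<noteq> s \<otimes> t"
    by blast
  obtain z where z: "z \<in> center G" "t \<otimes> s = s \<otimes> t \<otimes> z" "z \<noteq> \<one>" "z [^] p = \<one>"
    using order_p3_commutator[OF p ord s t ne] by blast
  have zc: "z \<in> carrier G" using z(1) by (simp add: center_def)
  note ctx = s t z p
  obtain r where r: "r < p" "s [^] p = z [^] r" using s_pow_p[OF ctx ord] by blast
  obtain m where m: "m < p" "t [^] p = z [^] m" using t_pow_p[OF ctx ord] by blast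
  have "m = 0 \<or> r = 0 \<or> (p = 2 \<and> r = 1 \<and> m = 1) \<or> (r \<noteq> 0 \<and> p \<noteq> 2)"
    using r(1) m(1) by (cases "p = 2") auto
  then consider "m = 0" | "r = 0" | "p = 2" "r = 1" "m = 1" | "r \<noteq> 0" "p \<noteq> 2" by blast
  then show thesis
  proof cases
    case 1
    then show thesis using modular[OF s t z] m by simp
  next
    case 2
    \<comment> \<open>Here the \<open>p\<close>-th power of \<open>s\<close> is trivial, so
      \<open>s\<close> and \<open>t\<close> exchange roles.\<close>
    obtain z' where z': "z' \<in> center G" "s \<otimes> t = t \<otimes> s \<otimes> z'" "z' \<noteq> \<one>" "z' [^] p = \<one>"
      using order_p3_commutator[OF p ord t s ne[symmetric]] by blast
    show thesis using modular[OF t s z'] r 2 by simp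
  next
    case 3
    then show thesis using quaternion[OF s t z] r m s t zc by (simp add: numeral_2_eq_2)
  next
    case 4
    then have "\<not> p dvd r" using r(1) by (auto dest: dvd_imp_le)
    then have "coprime p r" using p by (intro prime_imp_coprime)
    then have "coprime r p" by (simp add: coprime_commute)
    then obtain x y where xy: "r * x = p * y + 1" using bezout_nat[of r p] 4 by auto
    \<comment> \<open>\<open>x\<close> inverts \<open>r\<close> modulo \<open>p\<close>, and
      \<open>(p - 1) * m\<close> represents \<open>- m\<close>; so \<open>j\<close> solves the
      congruence \<open>r * j + m = 0\<close> modulo \<open>p\<close>.\<close>
    define j where "j = x * ((p - 1) * m)"
    define t' where "t' = s [^] j \<otimes> t"
    have t': "t' \<in> carrier G" using s t by (simp add: t'_def)
    have "t' \<otimes> s = s [^] j \<otimes> s \<otimes> t \<otimes> z" using s t zc z(2) by (simp add: t'_def m_assoc)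
    also have "\<dots> = s \<otimes> t' \<otimes> z"
      using s t zc nat_pow_Suc2[OF s, of j] by (simp add: t'_def m_assoc[symmetric])
    finally have "t' \<otimes> s \<noteq> s \<otimes> t'" using s t' zc z(3) by simp
    then obtain z' where z': "z' \<in> center G" "t' \<otimes> s = s \<otimes> t' \<otimes> z'" "z' \<noteq> \<one>" "z' [^] p = \<one>"
      using order_p3_commutator[OF p ord s t'] by blast
    have gauss: "2 * (\<Sum>i<n. i) = n * (n - 1)" for n :: nat
    proof (induction n)
      case (Suc n)
      then show ?case by (cases n) simp_all
    qed simp
    have "p dvd 2 * (\<Sum>i<p. i)" unfolding gauss by simp
    moreover have "\<not> p dvd 2" using p 4(2) primes_dvd_imp_eq[of p 2] by auto
    ultimately have "p dvd (\<Sum>i<p. i)" using p by (simp add: prime_dvd_mult_iff)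
    moreover have "r * j + m = p * (y * ((p - 1) * m) + m)"
    proof -
      have "r * j + m = (r * x) * ((p - 1) * m) + m" by (simp add: j_def mult.assoc)
      also have "\<dots> = (p * y + 1) * ((p - 1) * m) + m" by (simp only: xy)
      also have "\<dots> = p * (y * ((p - 1) * m)) + ((p - 1) * m + m)"
        by (simp only: add_mult_distrib mult.assoc mult_1_left add.assoc)
      also have "(p - 1) * m + m = p * m" using prime_gt_0_nat[OF p] by (cases p) simp_all
      finally show ?thesis by (simp add: algebra_simps)
    qed
    ultimately have "z [^] (r * j + m) = \<one>" "z [^] (j * (\<Sum>i<p. i)) = \<one>"
      using z_pow_eq_1_iff[OF ctx] by auto
    moreover have "s [^] (j * p) = z [^] (r * j)"
      using r(2) s zc by (metis mult.commute nat_pow_pow)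
    ultimately have "t' [^] p = \<one>"
      unfolding t'_def pow_product[OF ctx] using m(2) zc by (simp add: nat_pow_mult)
    then show thesis using modular[OF s t' z'] by simp
  qed
qed

end

section \<open>Rational function fields and algebraic independence\<close>

abbreviation var_power :: "'v \<Rightarrow> nat \<Rightarrow> ('v, 'k::field) mpoly" where
  "var_power v n \<equiv> Poly_Mapping.single (Poly_Mapping.single (Indet v) n) 1"

abbreviation poly_fun :: "('v, 'k::field) mpoly \<Rightarrow> ('v, 'k) ratfun" where
  "poly_fun p \<equiv> Fract p 1"

lemma polys_in_0: "0 \<in> polys_in V"
  by (simp add: polys_in_def)

lemma polys_in_uminus: "p \<in> polys_in V \<Longrightarrow> - p \<in> polys_in V"
  unfolding polys_in_def by (auto simp: in_keys_iff)

lemma polys_in_prod: "(\<And>i. i \<in> I \<Longrightarrow> P i \<in> polys_in V) \<Longrightarrow> prod P I \<in> polys_in V"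
  by (induction I rule: infinite_finite_induct) (auto simp: polys_in_1 polys_in_mult)

lemma polys_in_induct [consumes 1, case_names zero monomial]:
  assumes "p \<in> polys_in V" "Q 0"
    and "\<And>p m c. p \<in> polys_in V \<Longrightarrow> Poly_Mapping.keys m \<subseteq> Indet ` V \<Longrightarrow> Q p \<Longrightarrow>
      Q (p + Poly_Mapping.single m c)"
  shows "Q p"
  using assms(1)
proof (induction p rule: Poly_Mapping.update_induct)
  case const
  show ?case by (rule assms(2))
next
  case (update p m c)
  have "p \<in> polys_in V" "Poly_Mapping.keys m \<subseteq> Indet ` V"
    using update.prems update.hyps by (auto simp: polys_in_def keys_update split: if_splits)
  then show ?case using update by (simp add: update_eq_add assms(3))
qed

lemma polys_in_UNIV: "(p :: ('v, 'k::field) mpoly) \<in> polys_in UNIV"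
proof -
  have "range Indet = (UNIV :: 'v indet set)" by (metis indet.exhaust surj_def)
  then show ?thesis by (simp add: polys_in_def)
qed

lemma is_subfield_ratfuns_in: "is_subfield (ratfuns_in V :: ('v, 'k::field) ratfun set)"
proof -
  have zero: "0 \<in> (ratfuns_in V :: ('v, 'k) ratfun set)" and one: "1 \<in> (ratfuns_in V :: ('v, 'k) ratfun set)"
    unfolding Zero_fract_def One_fract_def by (intro Fract_in polys_in_0 polys_in_1 one_neq_zero)+
  have "- f \<in> ratfuns_in V \<and> inverse f \<in> ratfuns_in V" if "f \<in> ratfuns_in V" for f :: "('v, 'k) ratfun"
  proof -
    obtain p q where f: "f = Fract p q" "p \<in> polys_in V" "q \<in> polys_in V" "q \<noteq> 0"
      using \<open>f \<in> ratfuns_in V\<close> by (rule ratfuns_in_cases)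
    have "inverse f \<in> ratfuns_in V"
    proof (cases "p = 0")
      case True
      then have "f = 0" using f by (simp add: Zero_fract_def eq_fract)
      then show ?thesis using zero by simp
    qed (use f in \<open>simp add: Fract_in\<close>)
    then show ?thesis using f by (simp add: Fract_in polys_in_uminus)
  qed
  then show ?thesis
    unfolding is_subfield_def using zero one by (simp add: ratfuns_in_add ratfuns_in_mult)
qed

lemma poly_fun_hom: "poly_fun (p + q) = poly_fun p + poly_fun q" "poly_fun (p * q) = poly_fun p * poly_fun q"
  "poly_fun 0 = 0" "poly_fun 1 = 1" "poly_fun p = 0 \<longleftrightarrow> p = 0"
  by (simp_all add: Zero_fract_def One_fract_def eq_fract)

lemma poly_fun_sum: "poly_fun (sum P I) = (\<Sum>i\<in>I. poly_fun (P i))"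
  by (induction I rule: infinite_finite_induct) (auto simp: poly_fun_hom(1,3) simp del: add_fract mult_fract)

lemma Fract_eq_divide: "q \<noteq> 0 \<Longrightarrow> Fract p q = poly_fun p / poly_fun q"
  by simp

lemma var_power_add: "var_power v (m + n) = var_power v m * var_power v n"
  by (simp add: mult_single single_add)

lemma poly_fun_var_power: "poly_fun (var_power v n :: ('v, 'k::field) mpoly) = var_fun v ^ n"
proof (induction n)
  case (Suc n)
  have "var_power v (Suc n) = (var_power v 1 * var_power v n :: ('v, 'k) mpoly)" using var_power_add[of v 1 n] by simp
  then show ?case using Suc by (simp only: poly_fun_hom(2) power_Suc) (simp only: var_fun_def)
qed (simp add: One_fract_def)

section \<open>Evaluation of polynomials and transcendence of the variables\<close>

definition eval_monom :: "('v \<Rightarrow> 'a::field) \<Rightarrow> ('v indet \<Rightarrow>\<^sub>0 nat) \<Rightarrow> 'a" where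
  "eval_monom g m = (\<Prod>i\<in>Poly_Mapping.keys m. (case i of Indet v \<Rightarrow> g v) ^ Poly_Mapping.lookup m i)"

definition eval_poly :: "('k::field \<Rightarrow> 'a::field) \<Rightarrow> ('v \<Rightarrow> 'a) \<Rightarrow> ('v, 'k) mpoly \<Rightarrow> 'a" where
  "eval_poly c g p = (\<Sum>m\<in>Poly_Mapping.keys p. c (Poly_Mapping.lookup p m) * eval_monom g m)"

lemma eval_monom_superset:
  assumes "finite A" "Poly_Mapping.keys m \<subseteq> A"
  shows "eval_monom g m = (\<Prod>i\<in>A. (case i of Indet v \<Rightarrow> g v) ^ Poly_Mapping.lookup m i)"
  unfolding eval_monom_def using assms by (intro prod.mono_neutral_left) (auto simp: in_keys_iff)

lemma eval_monom_add: "eval_monom g (m + n) = eval_monom g m * eval_monom g n"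
proof -
  let ?A = "Poly_Mapping.keys m \<union> Poly_Mapping.keys n"
  have "eval_monom g k = (\<Prod>i\<in>?A. (case i of Indet v \<Rightarrow> g v) ^ Poly_Mapping.lookup k i)"
    if "k \<in> {m, n, m + n}" for k
    using that Poly_Mapping.keys_add[of m n] by (intro eval_monom_superset) auto
  then show ?thesis by (simp add: lookup_add power_add prod.distrib)
qed

lemma eval_monom_0 [simp]: "eval_monom g 0 = 1"
  by (simp add: eval_monom_def)

lemma eval_monom_single: "eval_monom g (Poly_Mapping.single (Indet v) n) = g v ^ n"
  by (simp add: eval_monom_def)

context
  fixes c :: "'k::field \<Rightarrow> 'a::field" and g :: "'v \<Rightarrow> 'a"
  assumes c: "field_hom c"
begin

lemma eval_poly_superset:
  assumes "finite A" "Poly_Mapping.keys p \<subseteq> A"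
  shows "eval_poly c g p = (\<Sum>m\<in>A. c (Poly_Mapping.lookup p m) * eval_monom g m)"
  unfolding eval_poly_def using assms
  by (intro sum.mono_neutral_left) (auto simp: in_keys_iff field_hom_0[OF c])

lemma eval_poly_add: "eval_poly c g (p + q) = eval_poly c g p + eval_poly c g q"
proof -
  let ?A = "Poly_Mapping.keys p \<union> Poly_Mapping.keys q"
  have "eval_poly c g r = (\<Sum>m\<in>?A. c (Poly_Mapping.lookup r m) * eval_monom g m)"
    if "r \<in> {p, q, p + q}" for r
    using that Poly_Mapping.keys_add[of p q] by (intro eval_poly_superset) auto
  then show ?thesis by (simp add: lookup_add field_hom_add[OF c] distrib_right sum.distrib)
qed

lemma eval_poly_single: "eval_poly c g (Poly_Mapping.single m a) = c a * eval_monom g m"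
  by (simp add: eval_poly_def field_hom_0[OF c])

lemma eval_poly_0: "eval_poly c g 0 = 0"
  by (simp add: eval_poly_def)

lemma eval_poly_1: "eval_poly c g 1 = 1"
  using eval_poly_single[of 0 1] by (simp add: field_hom_1[OF c])

lemma eval_poly_sum: "eval_poly c g (sum P I) = (\<Sum>i\<in>I. eval_poly c g (P i))"
  by (induction I rule: infinite_finite_induct) (auto simp: eval_poly_0 eval_poly_add)

lemma eval_poly_mult: "eval_poly c g (p * q) = eval_poly c g p * eval_poly c g q"
  using polys_in_UNIV[of p]
proof (induction p rule: polys_in_induct)
  case zero
  show ?case by (simp add: eval_poly_0)
next
  case (monomial p m a)
  have "eval_poly c g (Poly_Mapping.single m a * q) = c a * eval_monom g m * eval_poly c g q"
    using polys_in_UNIV[of q]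
  proof (induction q rule: polys_in_induct)
    case zero
    show ?case by (simp add: eval_poly_0)
  next
    case (monomial q n b)
    then show ?case
      by (simp add: distrib_left mult_single eval_poly_add eval_poly_single eval_monom_add
          field_hom_mult[OF c] algebra_simps)
  qed
  then show ?case
    using monomial.IH by (simp add: distrib_right eval_poly_add eval_poly_single)
qed

lemma eval_poly_var_power: "eval_poly c g (var_power v n) = g v ^ n"
  by (simp add: eval_poly_single eval_monom_single field_hom_1[OF c])

lemma eval_poly_in:
  assumes "p \<in> polys_in V"
  shows "eval_poly c g p \<in> gen_field (range c \<union> g ` V)"
  using assms
proof (induction p rule: polys_in_induct)
  case zero
  show ?case by (simp add: eval_poly_0 subfield_0[OF is_subfield_gen_field])
next
  case (monomial p m a)
  have "eval_monom g m \<in> gen_field (range c \<union> g ` V)"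
    unfolding eval_monom_def
  proof (intro subfield_prod[OF is_subfield_gen_field] subfield_power[OF is_subfield_gen_field])
    fix i assume "i \<in> Poly_Mapping.keys m"
    then obtain v where "i = Indet v" "v \<in> V" using monomial.hyps by auto
    then show "(case i of Indet v \<Rightarrow> g v) \<in> gen_field (range c \<union> g ` V)"
      using gen_field_superset[of "range c \<union> g ` V"] by auto
  qed
  moreover have "c a \<in> gen_field (range c \<union> g ` V)"
    using gen_field_superset[of "range c \<union> g ` V"] by auto
  ultimately show ?case
    using monomial.IH
    by (simp add: eval_poly_add eval_poly_single subfield_add[OF is_subfield_gen_field]
        subfield_mult[OF is_subfield_gen_field])
qed

end

lemma field_hom_const_fun: "field_hom const_fun"
  unfolding field_hom_def const_fun_def by (simp add: single_add mult_single One_fract_def)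

lemma poly_fun_monom:
  "poly_fun (Poly_Mapping.single m 1 :: ('v, 'k::field) mpoly) = eval_monom var_fun m"
proof (induction m rule: Poly_Mapping.update_induct)
  case const
  show ?case by (simp add: One_fract_def)
next
  case (update m i n)
  obtain v where v: "i = Indet v" by (cases i)
  then have "Poly_Mapping.single (Poly_Mapping.update i n m) 1 = Poly_Mapping.single m 1 * (var_power v n :: ('v, 'k) mpoly)"
    using update.hyps by (simp add: update_eq_add mult_single)
  then have "poly_fun (Poly_Mapping.single (Poly_Mapping.update i n m) 1 :: ('v, 'k) mpoly) =
      eval_monom var_fun m * var_fun v ^ n"
    by (simp only: poly_fun_hom(2) update.IH poly_fun_var_power)
  then show ?case
    using update.hyps v by (simp add: update_eq_add eval_monom_add eval_monom_single)
qed

lemma poly_fun_eq_eval: "poly_fun (p :: ('v, 'k::field) mpoly) = eval_poly const_fun var_fun p"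
  using polys_in_UNIV[of p]
proof (induction p rule: polys_in_induct)
  case zero
  show ?case by (simp add: eval_poly_0[OF field_hom_const_fun] poly_fun_hom(3))
next
  case (monomial p m a)
  have "Poly_Mapping.single m a = Poly_Mapping.single 0 a * Poly_Mapping.single m 1"
    by (simp add: mult_single)
  then have "poly_fun (Poly_Mapping.single m a) = const_fun a * eval_monom var_fun m"
    by (simp only: poly_fun_hom(2) poly_fun_monom const_fun_def)
  then show ?case
    using monomial.IH
    by (simp only: poly_fun_hom(1) eval_poly_add[OF field_hom_const_fun] eval_poly_single[OF field_hom_const_fun])
qed

text \<open>Evaluating a polynomial at the variables returns the polynomial, so fractions and
  generated fields describe the same set.\<close>

lemma ratfuns_in_eq_gen_field:
  "(ratfuns_in V :: ('v, 'k::field) ratfun set) = gen_field (range const_fun \<union> var_fun ` V)"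
  (is "?R = ?F")
proof
  show "?R \<subseteq> ?F"
  proof
    fix f :: "('v, 'k) ratfun" assume "f \<in> ratfuns_in V"
    then obtain p q where f: "f = Fract p q" "p \<in> polys_in V" "q \<in> polys_in V" "q \<noteq> 0"
      by (rule ratfuns_in_cases)
    show "f \<in> ?F"
      unfolding f(1) Fract_eq_divide[OF f(4)] poly_fun_eq_eval
      by (intro subfield_divide[OF is_subfield_gen_field] eval_poly_in field_hom_const_fun f)
  qed
  show "?F \<subseteq> ?R"
    by (intro gen_field_least is_subfield_ratfuns_in) (auto intro: const_fun_in var_fun_in)
qed

lemma lookup_mult_monomial:
  "Poly_Mapping.lookup (p * Poly_Mapping.single s 1) (m + s) = Poly_Mapping.lookup (p :: ('v, 'k::field) mpoly) m"
  using polys_in_UNIV[of p]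
proof (induction p rule: polys_in_induct)
  case (monomial p n a)
  then show ?case by (simp add: distrib_right lookup_add mult_single lookup_single)
qed simp

text \<open>The exponent of \<open>v\<close> in a monomial tells from which summand it comes, so
  nothing cancels between different \<open>j\<close>.\<close>

lemma polys_in_power_series_unique:
  assumes v: "v \<notin> V" and P: "\<And>j. P j \<in> polys_in V"
    and sum0: "(\<Sum>j\<le>n. P j * var_power v j) = 0" and i: "i \<le> n"
  shows "P i = 0"
proof (rule poly_mapping_eqI)
  fix m
  show "Poly_Mapping.lookup (P i) m = Poly_Mapping.lookup 0 m"
  proof (cases "m \<in> Poly_Mapping.keys (P i)")
    case False
    then show ?thesis by (simp add: in_keys_iff)
  next
    case True
    have no_v: "Poly_Mapping.lookup k (Indet v) = 0" if "k \<in> Poly_Mapping.keys (P j)" for j k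
    proof -
      have "Indet v \<notin> Indet ` V" using v by auto
      moreover have "Poly_Mapping.keys k \<subseteq> Indet ` V" using P[of j] that unfolding polys_in_def by blast
      ultimately show ?thesis by (auto simp: in_keys_iff)
    qed
    let ?k = "m + Poly_Mapping.single (Indet v) i"
    have "Poly_Mapping.lookup (P j * var_power v j) ?k = (if j = i then Poly_Mapping.lookup (P i) m else 0)" for j
    proof (cases "j = i")
      case True
      then show ?thesis by (simp add: lookup_mult_monomial)
    next
      case False
      have "?k \<notin> Poly_Mapping.keys (P j * var_power v j)"
      proof
        assume "?k \<in> Poly_Mapping.keys (P j * var_power v j)"
        then obtain a where a: "a \<in> Poly_Mapping.keys (P j)" "?k = a + Poly_Mapping.single (Indet v) j"
          using keys_mult[of "P j" "var_power v j"] by auto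
        have "Poly_Mapping.lookup ?k (Indet v) = i"
          using no_v[OF True] by (simp add: lookup_add)
        moreover have "Poly_Mapping.lookup ?k (Indet v) = j"
          unfolding a(2) using no_v[OF a(1)] by (simp add: lookup_add)
        ultimately show False using False by simp
      qed
      then show ?thesis using False by (simp add: in_keys_iff)
    qed
    then have "Poly_Mapping.lookup (\<Sum>j\<le>n. P j * var_power v j) ?k = Poly_Mapping.lookup (P i) m"
      using i by (simp add: lookup_sum sum.delta)
    then show ?thesis unfolding sum0 by simp
  qed
qed

lemma polys_in_power_series:
  assumes "p \<in> polys_in (insert v V)"
  shows "\<exists>n P. (\<forall>j. P j \<in> polys_in V) \<and> (\<forall>j>n. P j = 0) \<and> p = (\<Sum>j\<le>n. P j * var_power v j)"
  using assms
proof (induction p rule: polys_in_induct)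
  case zero
  show ?case by (rule exI[of _ 0], rule exI[of _ "\<lambda>_. 0"]) (simp add: polys_in_0)
next
  case (monomial p m a)
  then obtain n P where P: "\<And>j. P j \<in> polys_in V" "\<And>j. j > n \<Longrightarrow> P j = 0" "p = (\<Sum>j\<le>n. P j * var_power v j)"
    by blast
  define i where "i = Poly_Mapping.lookup m (Indet v)"
  define k where "k = m - Poly_Mapping.single (Indet v) i"
  have m: "m = k + Poly_Mapping.single (Indet v) i"
    by (rule poly_mapping_eqI) (auto simp: k_def i_def lookup_add lookup_minus lookup_single when_def)
  have "Poly_Mapping.keys k \<subseteq> Indet ` V"
  proof
    fix w assume w: "w \<in> Poly_Mapping.keys k"
    then have "w \<in> Poly_Mapping.keys m" "w \<noteq> Indet v"
      by (auto simp: k_def i_def in_keys_iff lookup_minus lookup_single)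
    then show "w \<in> Indet ` V" using monomial.hyps by auto
  qed
  then have single: "Poly_Mapping.single k a \<in> polys_in V" by (rule polys_in_monom)
  define Q where "Q = P(i := P i + Poly_Mapping.single k a)"
  define N where "N = max n i"
  have "(\<Sum>j\<le>n. P j * var_power v j) = (\<Sum>j\<le>N. P j * var_power v j)"
    using P(2) by (intro sum.mono_neutral_left) (auto simp: N_def)
  moreover have "(\<Sum>j\<le>N. Q j * var_power v j) =
      (\<Sum>j\<le>N. P j * var_power v j + (if j = i then Poly_Mapping.single k a * var_power v i else 0))"
    by (rule sum.cong) (auto simp: Q_def distrib_right)
  ultimately have "(\<Sum>j\<le>N. Q j * var_power v j) = p + Poly_Mapping.single m a"
    using m by (simp add: sum.distrib sum.delta N_def P(3) mult_single)
  moreover have "Q j \<in> polys_in V" for j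
    using P(1) single by (simp add: Q_def polys_in_add)
  moreover have "Q j = 0" if "j > N" for j
    using P(2)[of j] that by (auto simp: Q_def N_def)
  ultimately show ?case by (intro exI[of _ N] exI[of _ Q]) simp
qed

text \<open>With denominators cleared, an equation for \<open>v\<close> over K(V) is a polynomial
  identity in the new variable \<open>v\<close>, whose coefficients all vanish.\<close>

lemma var_fun_transcendental:
  assumes v: "v \<notin> V"
  shows "\<not> algebraic_over (ratfuns_in V) (var_fun v :: ('v, 'k::field) ratfun)"
proof
  assume "algebraic_over (ratfuns_in V) (var_fun v :: ('v, 'k) ratfun)"
  then obtain P where P: "P \<in> polys_over (ratfuns_in V)" "P \<noteq> 0" "poly P (var_fun v :: ('v, 'k) ratfun) = 0"
    unfolding algebraic_over_def by blast
  define n where "n = degree P"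
  have "\<exists>a b. a \<in> polys_in V \<and> b \<in> polys_in V \<and> b \<noteq> 0 \<and> coeff P i = Fract a b" for i
    using P(1) unfolding polys_over_def by (blast elim: ratfuns_in_cases)
  then obtain a b where ab: "\<And>i. a i \<in> polys_in V" "\<And>i. b i \<in> polys_in V" "\<And>i. b i \<noteq> 0"
    "\<And>i. coeff P i = Fract (a i) (b i)" by metis
  define A where "A i = a i * (\<Prod>j\<in>{..n} - {i}. b j)" for i
  let ?d = "poly_fun (\<Prod>j\<le>n. b j)"
  have d: "?d \<noteq> 0" using ab(3) by (simp add: poly_fun_hom(5))
  have A: "poly_fun (A i) = coeff P i * ?d" if "i \<le> n" for i
  proof -
    have "(\<Prod>j\<le>n. b j) = b i * (\<Prod>j\<in>{..n} - {i}. b j)" using that by (intro prod.remove) auto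
    then show ?thesis using ab(3)[of i] by (simp add: ab(4) A_def eq_fract)
  qed
  have "poly_fun (\<Sum>i\<le>n. A i * var_power v i) = (\<Sum>i\<le>n. poly_fun (A i) * var_fun v ^ i)"
    by (simp only: poly_fun_sum poly_fun_hom(2) poly_fun_var_power)
  also have "\<dots> = (\<Sum>i\<le>n. coeff P i * var_fun v ^ i) * ?d"
    unfolding sum_distrib_right by (rule sum.cong) (auto simp: A simp del: mult_fract)
  also have "\<dots> = 0" using P(3) by (simp add: poly_altdef n_def)
  finally have "(\<Sum>i\<le>n. A i * var_power v i) = 0" by (simp only: poly_fun_hom(5))
  moreover have "A i \<in> polys_in V" for i
    unfolding A_def by (intro polys_in_mult polys_in_prod ab)
  ultimately have "A n = 0" by (intro polys_in_power_series_unique[OF v, of A n n]) auto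
  then have "coeff P n = 0" using A[of n] d by (simp add: poly_fun_hom(3))
  then show False using P(2) by (simp add: n_def)
qed

lemma inj_var_fun: "inj (var_fun :: 'v \<Rightarrow> ('v, 'k::field) ratfun)"
proof (rule injI)
  fix v w :: 'v
  assume eq: "(var_fun v :: ('v, 'k) ratfun) = var_fun w"
  have "(var_fun w :: ('v, 'k) ratfun) \<in> ratfuns_in {w}" by (rule var_fun_in) simp
  then have "algebraic_over (ratfuns_in {w}) (var_fun v :: ('v, 'k) ratfun)"
    unfolding eq by (rule algebraic_over_member[OF is_subfield_ratfuns_in])
  then show "v = w"
    using var_fun_transcendental[of v "{w}", where ?'k = 'k] by (cases "v = w") simp_all
qed

lemma indep_var_fun: "indep_over (range const_fun) (var_fun ` V :: ('v, 'k::field) ratfun set)"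
  unfolding indep_over_def
proof
  fix s :: "('v, 'k) ratfun" assume "s \<in> var_fun ` V"
  then obtain v where v: "v \<in> V" "s = var_fun v" by blast
  have "(var_fun ` V :: ('v, 'k) ratfun set) - {s} = var_fun ` (V - {v})"
    using v by (auto simp: inj_eq[OF inj_var_fun])
  then show "\<not> algebraic_over (gen_field (range const_fun \<union> (var_fun ` V - {s}))) s"
    unfolding v(2) using var_fun_transcendental[of v "V - {v}"] by (simp add: ratfuns_in_eq_gen_field)
qed

text \<open>Expanded in the last variable, a relation has coefficients that are values at the
  earlier \<open>g k\<close>. These values vanish because \<open>g n\<close> is transcendental over
  them, and induction turns this into vanishing of the coefficients themselves.\<close>

lemma eval_poly_indep:
  fixes n :: nat
  assumes c: "field_hom c" and g: "\<And>k. k < n \<Longrightarrow> \<not> algebraic_over (gen_field (range c \<union> g ` {..<k})) (g k)"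
    and p: "p \<in> polys_in {..<n}" "eval_poly c g p = 0"
  shows "p = 0"
  using g p
proof (induction n arbitrary: p)
  case 0
  then have "p \<in> polys_in {}" by simp
  then have "\<exists>a. p = Poly_Mapping.single 0 a"
    by (intro exI[of _ "Poly_Mapping.lookup p 0"] poly_mapping_eqI)
      (auto simp: polys_in_def lookup_single when_def in_keys_iff)
  then obtain a where p: "p = Poly_Mapping.single 0 a" by blast
  then have "c a = 0" using 0(3) by (simp add: eval_poly_single[OF c])
  then show ?case by (simp add: p field_hom_eq_0_iff[OF c])
next
  case (Suc n)
  let ?F = "gen_field (range c \<union> g ` {..<n})"
  have "p \<in> polys_in (insert n {..<n})" using Suc.prems(2) by (simp add: lessThan_Suc)
  then obtain N P where P: "\<And>j. P j \<in> polys_in {..<n}" "p = (\<Sum>j\<le>N. P j * var_power n j)"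
    using polys_in_power_series[of p n "{..<n}"] by auto
  have sum0: "(\<Sum>j\<le>N. eval_poly c g (P j) * g n ^ j) = 0"
    using Suc.prems(3) unfolding P(2)
    by (simp only: eval_poly_sum[OF c] eval_poly_mult[OF c] eval_poly_var_power[OF c])
  have "P j = 0" if "j \<le> N" for j
  proof (rule Suc.IH)
    show "eval_poly c g (P j) = 0"
    proof (rule ccontr)
      assume "eval_poly c g (P j) \<noteq> 0"
      then have "algebraic_over ?F (g n)"
        by (intro algebraic_over_sum[OF is_subfield_gen_field eval_poly_in[OF c P(1)] that _ sum0])
      then show False using Suc.prems(1)[of n] by simp
    qed
  qed (use P(1) Suc.prems(1) in auto)
  then show ?case using P(2) by simp
qed

text \<open>Evaluation at an enumeration \<open>g\<close> of \<open>S\<close> vanishes on no nonzero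
  polynomial, so it extends to fractions as \<open>\<psi>\<close>. The image is a field between the
  generators and the field they generate; the isomorphism sought is the inverse of
  \<open>\<psi>\<close>.\<close>

lemma indep_rational_over_K:
  fixes S :: "('v, 'k::field) ratfun set"
  assumes S: "finite S" "indep_over (range const_fun) S"
  shows "rational_over_K (gen_field (range const_fun \<union> S))"
proof -
  define n where "n = card S"
  obtain g where g: "bij_betw g {..<n} S"
    using ex_bij_betw_nat_finite[OF S(1)] by (auto simp: n_def atLeast0LessThan)
  have c: "field_hom (const_fun :: 'k \<Rightarrow> ('v, 'k) ratfun)" by (rule field_hom_const_fun)
  let ?ev = "eval_poly (const_fun :: 'k \<Rightarrow> ('v, 'k) ratfun) g :: (nat, 'k) mpoly \<Rightarrow> _"
  let ?R = "ratfuns_in {..<n} :: (nat, 'k) ratfun set"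
  let ?P = "polys_in {..<n} :: (nat, 'k) mpoly set"
  have "\<not> algebraic_over (gen_field (range const_fun \<union> g ` {..<k})) (g k)" if "k < n" for k
  proof (rule indep_over_notin[OF S(2)])
    show "g ` {..<k} \<subseteq> S" "g k \<in> S" using g that unfolding bij_betw_def by auto
    show "g k \<notin> g ` {..<k}" using g that unfolding bij_betw_def inj_on_def by fastforce
  qed
  then have ev_nz: "?ev q \<noteq> 0" if "q \<in> ?P" "q \<noteq> 0" for q
    using eval_poly_indep[OF c, of n g q] that by blast
  define \<psi> where "\<psi> f = (THE y. \<exists>p q. p \<in> ?P \<and> q \<in> ?P \<and> q \<noteq> 0 \<and> f = Fract p q \<and> y = ?ev p / ?ev q)" for f
  have \<psi>: "\<psi> (Fract p q) = ?ev p / ?ev q" if "p \<in> ?P" "q \<in> ?P" "q \<noteq> 0" for p q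
    unfolding \<psi>_def
  proof (rule the_equality)
    fix y assume "\<exists>p' q'. p' \<in> ?P \<and> q' \<in> ?P \<and> q' \<noteq> 0 \<and> Fract p q = Fract p' q' \<and> y = ?ev p' / ?ev q'"
    then obtain p' q' where *: "p' \<in> ?P" "q' \<in> ?P" "q' \<noteq> 0" "Fract p q = Fract p' q'" "y = ?ev p' / ?ev q'"
      by blast
    then have "p * q' = p' * q" using that by (simp add: eq_fract)
    then have "?ev p * ?ev q' = ?ev p' * ?ev q" by (simp flip: eval_poly_mult[OF c])
    then show "y = ?ev p / ?ev q" using * that ev_nz by (simp add: frac_eq_eq)
  qed (use that in blast)
  have \<psi>_add: "\<psi> (f + h) = \<psi> f + \<psi> h" and \<psi>_mult: "\<psi> (f * h) = \<psi> f * \<psi> h" if fh: "f \<in> ?R" "h \<in> ?R" for f h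
  proof -
    obtain p q where f: "f = Fract p q" "p \<in> ?P" "q \<in> ?P" "q \<noteq> 0" using fh(1) by (rule ratfuns_in_cases)
    obtain p' q' where h: "h = Fract p' q'" "p' \<in> ?P" "q' \<in> ?P" "q' \<noteq> 0" using fh(2) by (rule ratfuns_in_cases)
    show "\<psi> (f + h) = \<psi> f + \<psi> h"
      using f h ev_nz by (simp add: \<psi> polys_in_add polys_in_mult eval_poly_add[OF c] eval_poly_mult[OF c] add_frac_eq)
    show "\<psi> (f * h) = \<psi> f * \<psi> h"
      using f h by (simp add: \<psi> polys_in_mult eval_poly_mult[OF c])
  qed
  have \<psi>_const: "\<psi> (const_fun a) = const_fun a" for a
    unfolding const_fun_def[of a, where 'v = nat]
    by (simp add: \<psi> polys_in_const polys_in_1 eval_poly_single[OF c] eval_poly_1[OF c])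
  have \<psi>_var: "\<psi> (var_fun k) = g k" if "k < n" for k
    unfolding var_fun_def using that
    by (simp add: \<psi> polys_in_var polys_in_1 eval_poly_var_power[OF c] eval_poly_1[OF c] del: One_nat_def)
  have inj: "inj_on \<psi> ?R"
  proof (rule inj_onI)
    fix f h assume fh: "f \<in> ?R" "h \<in> ?R" "\<psi> f = \<psi> h"
    obtain p q where f: "f = Fract p q" "p \<in> ?P" "q \<in> ?P" "q \<noteq> 0" using fh(1) by (rule ratfuns_in_cases)
    obtain p' q' where h: "h = Fract p' q'" "p' \<in> ?P" "q' \<in> ?P" "q' \<noteq> 0" using fh(2) by (rule ratfuns_in_cases)
    have "?ev p * ?ev q' = ?ev p' * ?ev q" using fh(3) f h ev_nz by (simp add: \<psi> frac_eq_eq)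
    then have "?ev (p * q' + - (p' * q)) + ?ev (p' * q) = ?ev (p' * q)"
      by (simp flip: eval_poly_add[OF c] eval_poly_mult[OF c])
    then have "?ev (p * q' + - (p' * q)) = 0" by simp
    moreover have "p * q' + - (p' * q) \<in> ?P" using f h by (intro polys_in_add polys_in_mult polys_in_uminus)
    ultimately have "p * q' + - (p' * q) = 0" using ev_nz by blast
    then show "f = h" using f h by (simp add: eq_fract)
  qed
  have image: "\<psi> ` ?R = gen_field (range const_fun \<union> S)"
  proof
    have S_eq: "S = g ` {..<n}" using g by (auto simp: bij_betw_def)
    show "\<psi> ` ?R \<subseteq> gen_field (range const_fun \<union> S)"
    proof
      fix y assume "y \<in> \<psi> ` ?R"
      then obtain f where y: "y = \<psi> f" "f \<in> ?R" by blast
      obtain p q where f: "f = Fract p q" "p \<in> ?P" "q \<in> ?P" "q \<noteq> 0" using y(2) by (rule ratfuns_in_cases)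
      show "y \<in> gen_field (range const_fun \<union> S)"
        unfolding y f(1) \<psi>[OF f(2-4)] S_eq
        by (intro subfield_divide[OF is_subfield_gen_field] eval_poly_in[OF c] f)
    qed
    have R: "is_subfield ?R" by (rule is_subfield_ratfuns_in)
    have one: "\<psi> 1 = 1" and zero: "\<psi> 0 = 0"
      using \<psi>_const[of 1] \<psi>_const[of 0] by (simp_all add: field_hom_1[OF field_hom_const_fun] field_hom_0[OF field_hom_const_fun])
    have minus: "\<psi> (- f) = - \<psi> f" if "f \<in> ?R" for f
      using \<psi>_add[OF that subfield_uminus[OF R that]] zero by (simp add: eq_neg_iff_add_eq_0 add.commute)
    have inv: "\<psi> (inverse f) = inverse (\<psi> f)" if "f \<in> ?R" for f
    proof (cases "f = 0")
      case False
      then have "\<psi> f * \<psi> (inverse f) = 1"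
        using \<psi>_mult[OF that subfield_inverse[OF R that]] one by simp
      then show ?thesis by (metis inverse_unique)
    qed (simp add: zero)
    have "is_subfield (\<psi> ` ?R)"
      unfolding is_subfield_def
    proof (intro conjI ballI)
      show "0 \<in> \<psi> ` ?R" "1 \<in> \<psi> ` ?R"
        using imageI[OF subfield_0[OF R], of \<psi>] imageI[OF subfield_1[OF R], of \<psi>] zero one by simp_all
    next
      fix x y assume "x \<in> \<psi> ` ?R" "y \<in> \<psi> ` ?R"
      then obtain f h where fh: "x = \<psi> f" "y = \<psi> h" "f \<in> ?R" "h \<in> ?R" by blast
      show "x + y \<in> \<psi> ` ?R" "x * y \<in> \<psi> ` ?R"
        using imageI[OF subfield_add[OF R fh(3,4)], of \<psi>] imageI[OF subfield_mult[OF R fh(3,4)], of \<psi>]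
        by (simp_all add: fh \<psi>_add \<psi>_mult)
    next
      fix x assume "x \<in> \<psi> ` ?R"
      then obtain f where f: "x = \<psi> f" "f \<in> ?R" by blast
      show "- x \<in> \<psi> ` ?R" "inverse x \<in> \<psi> ` ?R"
        using imageI[OF subfield_uminus[OF R f(2)], of \<psi>] imageI[OF subfield_inverse[OF R f(2)], of \<psi>]
        by (simp_all add: f minus inv)
    qed
    moreover have "range const_fun \<union> S \<subseteq> \<psi> ` ?R"
    proof
      fix y assume "y \<in> range const_fun \<union> S"
      then consider a where "y = const_fun a" | k where "k < n" "y = g k" unfolding S_eq by auto
      then show "y \<in> \<psi> ` ?R"
      proof cases
        case 1
        then show ?thesis using \<psi>_const const_fun_in by (metis imageI)
      next
        case 2
        then show ?thesis using \<psi>_var var_fun_in by (metis imageI lessThan_iff)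
      qed
    qed
    ultimately show "gen_field (range const_fun \<union> S) \<subseteq> \<psi> ` ?R" by (rule gen_field_least)
  qed
  define \<phi> where "\<phi> = inv_into ?R \<psi>"
  have \<phi>_\<psi>: "\<phi> (\<psi> f) = f" if "f \<in> ?R" for f unfolding \<phi>_def using inj that by (rule inv_into_f_f)
  have "K_isomorphism \<phi> (gen_field (range const_fun \<union> S)) ?R"
    unfolding K_isomorphism_def image[symmetric]
  proof (intro conjI ballI allI)
    show "bij_betw \<phi> (\<psi> ` ?R) ?R"
      unfolding \<phi>_def using inj by (intro bij_betw_inv_into) (simp add: bij_betw_def)
  next
    fix x y assume "x \<in> \<psi> ` ?R" "y \<in> \<psi> ` ?R"
    then obtain f h where fh: "x = \<psi> f" "y = \<psi> h" "f \<in> ?R" "h \<in> ?R" by blast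
    show "\<phi> (x + y) = \<phi> x + \<phi> y" "\<phi> (x * y) = \<phi> x * \<phi> y"
      using fh \<phi>_\<psi> by (simp_all add: ratfuns_in_add ratfuns_in_mult flip: \<psi>_add \<psi>_mult)
  next
    fix a
    show "\<phi> (const_fun a) = const_fun a" using \<phi>_\<psi>[OF const_fun_in] \<psi>_const by metis
  qed
  then show ?thesis unfolding rational_over_K_def by blast
qed

section \<open>The fixed field\<close>

text \<open>\<open>translation\<close> is determined only on functions of the carrier variables.
  Renaming variables, with indices outside the carrier kept, extends it to the whole type, where the
  results on \<open>field_hom\<close> apply.\<close>

lemma translation_extension:
  fixes G (structure)
  assumes G: "group G"
  obtains act :: "'g \<Rightarrow> ('g, 'k::field) ratfun \<Rightarrow> ('g, 'k) ratfun" where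
    "\<And>h. h \<in> carrier G \<Longrightarrow> field_hom (act h)"
    "\<And>h c. h \<in> carrier G \<Longrightarrow> act h (const_fun c) = const_fun c"
    "\<And>h g. h \<in> carrier G \<Longrightarrow> g \<in> carrier G \<Longrightarrow> act h (var_fun g) = var_fun (h \<otimes> g)"
    "\<And>h f. h \<in> carrier G \<Longrightarrow> f \<in> ratfuns_in (carrier G) \<Longrightarrow> translation G h f = act h f"
proof -
  interpret group G by fact
  define t where "t h g = (if g \<in> carrier G then h \<otimes> g else g)" for h g
  define \<pi> where "\<pi> h = (\<lambda>i. case i of Indet g \<Rightarrow> Indet (t h g))" for h
  have inv: "\<pi> h (\<pi> (inv h) i) = i" "\<pi> (inv h) (\<pi> h i) = i" if "h \<in> carrier G" for h i
    using that by (cases i; auto simp: \<pi>_def t_def simp flip: m_assoc)+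
  have bij: "bij (\<pi> h)" if "h \<in> carrier G" for h
    using inv[OF that] by (auto intro!: o_bij[of "\<pi> (inv h)"] simp: fun_eq_iff)
  have sub: "\<pi> h ` Indet ` carrier G \<subseteq> Indet ` carrier G" if "h \<in> carrier G" for h
    using that by (auto simp: \<pi>_def t_def)
  have img: "\<pi> h ` Indet ` carrier G = Indet ` carrier G" if "h \<in> carrier G" for h
  proof
    show "Indet ` carrier G \<subseteq> \<pi> h ` Indet ` carrier G"
    proof
      fix i assume "i \<in> Indet ` carrier G"
      then have "\<pi> (inv h) i \<in> Indet ` carrier G" using sub[of "inv h"] that by blast
      then show "i \<in> \<pi> h ` Indet ` carrier G" using inv(1)[OF that, of i] by (metis imageI)
    qed
  qed (rule sub[OF that])
  define act :: "'g \<Rightarrow> ('g, 'k) ratfun \<Rightarrow> ('g, 'k) ratfun" where "act h = rename_ratfun (\<pi> h)" for h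
  have UNIV: "(ratfuns_in UNIV :: ('g, 'k) ratfun set) = UNIV"
  proof -
    have "f \<in> ratfuns_in UNIV" for f :: "('g, 'k) ratfun"
      by (cases f) (auto intro!: Fract_in polys_in_UNIV)
    then show ?thesis by blast
  qed
  have var: "act h (var_fun g) = var_fun (h \<otimes> g)" if "h \<in> carrier G" "g \<in> carrier G" for h g
    unfolding act_def by (rule rename_ratfun_var[OF bij[OF that(1)]]) (simp add: \<pi>_def t_def that)
  have const: "act h (const_fun c) = const_fun c" if "h \<in> carrier G" for h c
    using K_isomorphism_rename_ratfun[OF bij[OF that] img[OF that]]
    unfolding act_def K_isomorphism_def by blast
  show thesis
  proof (rule that[of act])
    fix h assume h: "h \<in> carrier G"
    have "\<pi> h ` Indet ` UNIV = Indet ` UNIV"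
      using bij_is_surj[OF bij[OF h]] by (metis indet.exhaust surj_def)
    then have "K_isomorphism (act h) UNIV UNIV"
      using K_isomorphism_rename_ratfun[OF bij[OF h], of UNIV, where ?'b = 'k] unfolding UNIV act_def by blast
    moreover have "act h 1 = 1"
      using const[OF h, of 1] by (simp add: field_hom_1[OF field_hom_const_fun])
    ultimately show "field_hom (act h)" unfolding field_hom_def K_isomorphism_def by blast
    fix f :: "('g, 'k) ratfun" assume f: "f \<in> ratfuns_in (carrier G)"
    have "is_translation G h (act h)"
      unfolding is_translation_def act_def
      using K_isomorphism_rename_ratfun[OF bij[OF h] img[OF h]] var[OF h] by (auto simp: act_def)
    then show "translation G h f = act h f"
      using translations_agree[OF is_translation_translation[OF G h] _ f] by blast
  qed (use var const in auto)
qed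

text \<open>The criterion shared by both families. The condition on \<open>U\<close> says that
  \<open>H\<close> generates \<open>G\<close> as a monoid, which in a finite group means as a group.
  Independence of \<open>S\<close> comes from comparison with the \<open>order G\<close>
  variables.\<close>

lemma rational_fixed_field:
  fixes G (structure) and act :: "'g \<Rightarrow> ('g, 'k::field) ratfun \<Rightarrow> ('g, 'k) ratfun"
  defines "L \<equiv> ratfuns_in (carrier G)"
  assumes G: "group G" "finite (carrier G)"
    and act: "\<And>h. h \<in> carrier G \<Longrightarrow> field_hom (act h)"
      "\<And>h c. h \<in> carrier G \<Longrightarrow> act h (const_fun c) = const_fun c"
      "\<And>h g. h \<in> carrier G \<Longrightarrow> g \<in> carrier G \<Longrightarrow> act h (var_fun g) = var_fun (h \<otimes> g)"
      "\<And>h f. h \<in> carrier G \<Longrightarrow> f \<in> L \<Longrightarrow> translation G h f = act h f"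
    and H: "H \<subseteq> carrier G"
      "\<And>U. \<lbrakk>\<one> \<in> U; H \<subseteq> U; \<And>x y. x \<in> U \<Longrightarrow> y \<in> U \<Longrightarrow> x \<otimes> y \<in> U\<rbrakk> \<Longrightarrow> carrier G \<subseteq> U"
    and S: "finite S" "card S \<le> order G" "S \<subseteq> L"
      "\<And>h f. h \<in> H \<Longrightarrow> f \<in> S \<Longrightarrow> act h f = f"
    and ext: "fin_ext (gen_field (range const_fun \<union> S)) L"
    and fixed: "\<And>f. f \<in> L \<Longrightarrow> (\<And>h. h \<in> H \<Longrightarrow> act h f = f) \<Longrightarrow> f \<in> gen_field (range const_fun \<union> S)"
  shows "rational_over_K (fixed_field G :: ('g, 'k) ratfun set)"
proof -
  interpret group G by fact
  let ?F = "gen_field (range const_fun \<union> S)"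
  have L_gen: "L = gen_field (range const_fun \<union> var_fun ` carrier G)"
    unfolding L_def by (rule ratfuns_in_eq_gen_field)
  have L: "is_subfield L" unfolding L_def by (rule is_subfield_ratfuns_in)
  have F_L: "?F \<subseteq> L"
    using S(3) by (intro gen_field_least L) (auto simp: L_def intro: const_fun_in)
  have mult: "act (x \<otimes> y) f = act x (act y f)" if xy: "x \<in> carrier G" "y \<in> carrier G" and f: "f \<in> L" for x y f
  proof -
    have "is_subfield {f. act (x \<otimes> y) f = act x (act y f)}"
      unfolding is_subfield_def
      using xy by (simp add: field_hom_simps[OF act(1)])
    moreover have "range const_fun \<union> var_fun ` carrier G \<subseteq> {f. act (x \<otimes> y) f = act x (act y f)}"
      using xy by (auto simp: act m_assoc)
    ultimately have "L \<subseteq> {f. act (x \<otimes> y) f = act x (act y f)}"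
      unfolding L_gen by (rule gen_field_least)
    then show ?thesis using f by blast
  qed
  have one: "act \<one> f = f" if "f \<in> L" for f
    using that unfolding L_gen
    by (rule gen_field_hom_fixed[OF act(1)[OF one_closed], rotated]) (auto simp: act)
  \<comment> \<open>The elements acting trivially on K(S) are closed under products and contain
    \<open>H\<close>, so they are all of \<open>G\<close>.\<close>
  define U where "U = {h \<in> carrier G. \<forall>f\<in>?F. act h f = f}"
  have "carrier G \<subseteq> U"
  proof (rule H(2))
    show "\<one> \<in> U" using one F_L by (auto simp: U_def)
    show "H \<subseteq> U"
    proof
      fix h assume h: "h \<in> H"
      then have hc: "h \<in> carrier G" using H(1) by blast
      have "act h f = f" if "f \<in> ?F" for f
        using that by (rule gen_field_hom_fixed[OF act(1)[OF hc], rotated]) (use h hc S(4) act(2) in auto)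
      then show "h \<in> U" using hc by (simp add: U_def)
    qed
    show "x \<otimes> y \<in> U" if "x \<in> U" "y \<in> U" for x y
      using that F_L mult by (auto simp: U_def subset_iff)
  qed
  then have F_fixed: "act h f = f" if "h \<in> carrier G" "f \<in> ?F" for h f
    using that by (auto simp: U_def)
  have "fixed_field G = ?F"
  proof
    show "fixed_field G \<subseteq> ?F"
    proof
      fix f :: "('g, 'k) ratfun" assume "f \<in> fixed_field G"
      then have "f \<in> L" "\<And>h. h \<in> carrier G \<Longrightarrow> act h f = f"
        using act(4) unfolding fixed_field_def L_def by auto
      then show "f \<in> ?F" using fixed H(1) by blast
    qed
    show "?F \<subseteq> fixed_field G"
      using F_L F_fixed act(4) unfolding fixed_field_def L_def by (auto simp: subset_iff)
  qed
  moreover have "indep_over (range const_fun) S"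
  proof (rule spanning_set_indep[OF L indep_var_fun _ _ S(1) ext])
    show "var_fun ` carrier G \<subseteq> L" unfolding L_def by (auto intro: var_fun_in)
    show "finite (var_fun ` carrier G :: ('g, 'k) ratfun set)" using G(2) by simp
    have "card (var_fun ` carrier G :: ('g, 'k) ratfun set) = order G"
      unfolding Coset.order_def by (intro card_image inj_on_subset[OF inj_var_fun]) simp
    then show "card S \<le> card (var_fun ` carrier G :: ('g, 'k) ratfun set)" using S(2) by simp
  qed
  ultimately show ?thesis using indep_rational_over_K[OF S(1)] by simp
qed

lemma primitive_root_const_fun:
  assumes "primitive_root_of_unity p (\<zeta> :: 'k::field)"
  shows "primitive_root_of_unity p (const_fun \<zeta> :: ('v, 'k) ratfun)"
proof -
  have pow: "(const_fun \<zeta> :: ('v, 'k) ratfun) ^ k = const_fun (\<zeta> ^ k)" for k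
    by (simp add: field_hom_power[OF field_hom_const_fun])
  have "const_fun c = (1 :: ('v, 'k) ratfun) \<longleftrightarrow> c = 1" for c :: 'k
  proof -
    have "const_fun c = (1 :: ('v, 'k) ratfun) \<longleftrightarrow> const_fun (c - 1) = (0 :: ('v, 'k) ratfun)"
      by (simp add: field_hom_diff[OF field_hom_const_fun] field_hom_1[OF field_hom_const_fun])
    then show ?thesis by (simp add: field_hom_eq_0_iff[OF field_hom_const_fun])
  qed
  then show ?thesis using assms by (simp add: primitive_root_of_unity_def pow)
qed

lemma is_subfield_const: "is_subfield (range const_fun)"
  by (rule is_subfield_image[OF field_hom_const_fun]) (simp add: is_subfield_def)

text \<open>The normal form indexes the variables, and its injectivity separates the variable at
  \<open>\<one>\<close> from the others, which gives the transcendence demanded by the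
  locale.\<close>

lemma rational_modular_case:
  fixes G (structure) and \<zeta> :: "'k::field" and s t z :: 'g
  assumes G: "group G" and p: "Factorial_Ring.prime p" and ord: "order G = p ^ 3"
    and s: "s \<in> carrier G" and t: "t \<in> carrier G" and z: "z \<in> center G" and ts: "t \<otimes> s = s \<otimes> t \<otimes> z"
    and z_ne: "z \<noteq> \<one>" and z_p: "z [^] p = \<one>" and t_p: "t [^] p = \<one>"
    and \<zeta>: "primitive_root_of_unity p \<zeta>"
  shows "rational_over_K (fixed_field G :: ('g, 'k) ratfun set)"
proof -
  interpret group G by fact
  note ctx = s t z ts z_ne z_p p
  have zc: "z \<in> carrier G" using z by (simp add: center_def)
  have fin: "finite (carrier G)"
    using ord p by (metis Coset.order_def card.infinite not_prime_0 power_not_zero)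
  obtain act :: "'g \<Rightarrow> ('g, 'k) ratfun \<Rightarrow> ('g, 'k) ratfun" where act:
    "\<And>h. h \<in> carrier G \<Longrightarrow> field_hom (act h)"
    "\<And>h c. h \<in> carrier G \<Longrightarrow> act h (const_fun c) = const_fun c"
    "\<And>h g. h \<in> carrier G \<Longrightarrow> g \<in> carrier G \<Longrightarrow> act h (var_fun g) = var_fun (h \<otimes> g)"
    "\<And>h f. h \<in> carrier G \<Longrightarrow> f \<in> ratfuns_in (carrier G) \<Longrightarrow> translation G h f = act h f"
    using translation_extension[OF G] by blast
  obtain r :: nat where r: "s [^] p = z [^] r" using s_pow_p[OF ctx ord] by blast
  let ?x = "\<lambda>i b a. var_fun (elt s t z i b a) :: ('g, 'k) ratfun"
  have elt_closed': "elt s t z i b a \<in> carrier G" for i b a by (rule elt_closed[OF ctx])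
  have carrier_eq: "carrier G = {elt s t z i b a | i b a. i < p \<and> b < p \<and> a < p}"
    unfolding bij_betw_imp_surj_on[OF elt_bij[OF ctx ord], symmetric] by force
  have elt_1: "elt s t z 0 0 0 = \<one>" by (simp add: elt_def[OF ctx])
  interpret A: heisenberg_action "range const_fun" p r "const_fun \<zeta>" "act z" "act t" "act s" ?x
  proof
    show "is_subfield (range const_fun :: ('g, 'k) ratfun set)" by (rule is_subfield_const)
    show "1 < p" using p by (rule prime_gt_1_nat)
    show "(of_nat p :: ('g, 'k) ratfun) \<noteq> 0"
      by (rule root_of_unity_of_nat_neq_0[OF p primitive_root_const_fun[OF \<zeta>]])
    show "primitive_root_of_unity p (const_fun \<zeta> :: ('g, 'k) ratfun)" by (rule primitive_root_const_fun[OF \<zeta>])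
    show "field_hom (act z)" "field_hom (act t)" "field_hom (act s)" using act(1) zc s t by auto
    show "act z (?x i b a) = ?x i b (a + 1)" "act t (?x i b a) = ?x i (b + 1) (a + i)"
      "act s (?x i b a) = ?x (i + 1) b a" for i b a
      using act(3) zc s t elt_closed' by (simp_all only: z_elt[OF ctx] t_elt[OF ctx] s_elt[OF ctx])
    show "?x i b (a + p) = ?x i b a" for i b a
      by (simp add: elt_add[OF ctx] z_p elt_closed')
    show "?x i (b + p) a = ?x i b a" for i b a
      using t t_p by (simp add: elt_def[OF ctx] flip: nat_pow_mult)
    show "?x (i + p) b a = ?x i b (a + r)" for i b a
    proof -
      have "s [^] (i + p) \<otimes> t [^] b \<otimes> z [^] a = s [^] i \<otimes> (z [^] r \<otimes> t [^] b) \<otimes> z [^] a"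
        using s t zc r by (simp add: m_assoc flip: nat_pow_mult)
      also have "\<dots> = s [^] i \<otimes> t [^] b \<otimes> (z [^] a \<otimes> z [^] r)"
        using s t zc z_pow_comm[OF ctx, of "t [^] b" r] by (simp add: m_assoc nat_pow_mult add.commute)
      finally show ?thesis using s t zc by (simp add: elt_def[OF ctx] nat_pow_mult)
    qed
    show "\<not> algebraic_over (gen_field (range const_fun \<union>
      {?x i b a | i b a. i < p \<and> b < p \<and> a < p \<and> (i, b, a) \<noteq> (0, 0, 0)})) (?x 0 0 0)"
    proof
      let ?V = "carrier G - {\<one>}"
      assume "algebraic_over (gen_field (range const_fun \<union>
        {?x i b a | i b a. i < p \<and> b < p \<and> a < p \<and> (i, b, a) \<noteq> (0, 0, 0)})) (?x 0 0 0)"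
      moreover have "{?x i b a | i b a. i < p \<and> b < p \<and> a < p \<and> (i, b, a) \<noteq> (0, 0, 0)} \<subseteq> var_fun ` ?V"
      proof
        fix f assume "f \<in> {?x i b a | i b a. i < p \<and> b < p \<and> a < p \<and> (i, b, a) \<noteq> (0, 0, 0)}"
        then obtain i b a where f: "f = ?x i b a" and lt: "i < p" "b < p" "a < p"
          and ne: "(i, b, a) \<noteq> (0, 0, 0)" by blast
        have "elt s t z i b a \<noteq> elt s t z 0 0 0"
          using inj_onD[OF elt_inj[OF ctx], of "(i, b, a)" "(0, 0, 0)"] lt ne by auto
        then show "f \<in> var_fun ` ?V" using f elt_closed' elt_1 by auto
      qed
      ultimately have "algebraic_over (ratfuns_in ?V) (?x 0 0 0)"
        unfolding ratfuns_in_eq_gen_field by (elim algebraic_over_mono) (intro gen_field_mono, blast)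
      then show False unfolding elt_1 using var_fun_transcendental[of "\<one>" ?V, where ?'k = 'k] by simp
    qed
  qed (use act(2) zc s t in auto)
  have L: "A.L = ratfuns_in (carrier G)"
  proof -
    have "var_fun ` carrier G = {?x i b a | i b a. i < p \<and> b < p \<and> a < p}"
      unfolding carrier_eq by blast
    then show ?thesis unfolding A.L_def ratfuns_in_eq_gen_field by (simp only:)
  qed
  show ?thesis
  proof (rule rational_fixed_field[OF G fin act, of "{z, t, s}" A.gens])
    show "{z, t, s} \<subseteq> carrier G" using zc s t by simp
    show "carrier G \<subseteq> U" if U: "\<one> \<in> U" "{z, t, s} \<subseteq> U" "\<And>x y. x \<in> U \<Longrightarrow> y \<in> U \<Longrightarrow> x \<otimes> y \<in> U" for U
    proof -
      have "g [^] (n::nat) \<in> U" if "g \<in> {z, t, s}" for g n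
        by (induction n) (use U that in auto)
      then have "elt s t z i b a \<in> U" for i b a unfolding elt_def[OF ctx] using U(3) by simp
      then show ?thesis unfolding carrier_eq by blast
    qed
    show "card A.gens \<le> order G" using A.gens_card(2) ord by simp
    show "act h f = f" if "h \<in> {z, t, s}" "f \<in> A.gens" for h f
      using A.gens_fixed[OF that(2)] that(1) by blast
    show "fin_ext (gen_field (range const_fun \<union> A.gens)) (ratfuns_in (carrier G))"
      using A.fin_ext_F0_L unfolding A.F0_def L .
    show "f \<in> gen_field (range const_fun \<union> A.gens)"
      if "f \<in> ratfuns_in (carrier G)" "\<And>h. h \<in> {z, t, s} \<Longrightarrow> act h f = f" for f
      using A.fixed_F0[of f] that unfolding A.F0_def L by blast
  qed (use A.gens_card A.gens_L L in auto)
qed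

text \<open>Here i, j, k are \<open>s\<close>, \<open>t\<close>, \<open>s \<otimes> t\<close>, and
  passing to the negative is multiplication by \<open>z\<close>.\<close>

lemma rational_quaternion_case:
  fixes G (structure) and s t z :: 'g
  assumes G: "group G" and ord: "order G = 2 ^ 3"
    and s: "s \<in> carrier G" and t: "t \<in> carrier G" and z: "z \<in> center G" and ts: "t \<otimes> s = s \<otimes> t \<otimes> z"
    and z_ne: "z \<noteq> \<one>" and z_2: "z [^] (2::nat) = \<one>" and s_2: "s \<otimes> s = z" and t_2: "t \<otimes> t = z"
    and two: "(2 :: ('g, 'k::field) ratfun) \<noteq> 0"
  shows "rational_over_K (fixed_field G :: ('g, 'k) ratfun set)"
proof -
  interpret group G by fact
  note ctx = s t z ts z_ne z_2 two_is_prime_nat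
  have zc: "z \<in> carrier G" using z by (simp add: center_def)
  have fin: "finite (carrier G)"
    using ord by (metis Coset.order_def card.infinite power_not_zero zero_neq_numeral)
  obtain act :: "'g \<Rightarrow> ('g, 'k) ratfun \<Rightarrow> ('g, 'k) ratfun" where act:
    "\<And>h. h \<in> carrier G \<Longrightarrow> field_hom (act h)"
    "\<And>h c. h \<in> carrier G \<Longrightarrow> act h (const_fun c) = const_fun c"
    "\<And>h g. h \<in> carrier G \<Longrightarrow> g \<in> carrier G \<Longrightarrow> act h (var_fun g) = var_fun (h \<otimes> g)"
    "\<And>h f. h \<in> carrier G \<Longrightarrow> f \<in> ratfuns_in (carrier G) \<Longrightarrow> translation G h f = act h f"
    using translation_extension[OF G] by blast
  let ?e = "elt s t z"
  let ?x = "\<lambda>i b a. var_fun (?e i b a) :: ('g, 'k) ratfun"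
  have elt_closed': "?e i b a \<in> carrier G" for i b a by (rule elt_closed[OF ctx])
  have lt2: "{..<2::nat} = {0, 1}" by auto
  have carrier_eq: "carrier G = {?e 0 0 0, ?e 1 0 0, ?e 0 1 0, ?e 1 1 0, ?e 0 0 1, ?e 1 0 1, ?e 0 1 1, ?e 1 1 1}"
    using bij_betw_imp_surj_on[OF elt_bij[OF ctx ord]] unfolding lt2 by auto
  have elt_1: "?e 0 0 0 = \<one>" by (simp add: elt_def[OF ctx])
  have z2: "z \<otimes> z = \<one>" using z_2 zc by (simp add: numeral_2_eq_2)
  have act_elt: "act z (?x i b a) = ?x i b (a + 1)" "act t (?x i b a) = ?x i (b + 1) (a + i)"
      "act s (?x i b a) = ?x (i + 1) b a" for i b a
    using act(3) zc s t elt_closed' by (simp_all only: z_elt[OF ctx] t_elt[OF ctx] s_elt[OF ctx])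
  \<comment> \<open>Rewrites the exponents 2 produced by the action, using that \<open>s\<close> and
    \<open>t\<close> square to \<open>z\<close> and \<open>z\<close> squares to
    \<open>\<one>\<close>.\<close>
  have red: "?e i b 2 = ?e i b 0" "?e 2 b 0 = ?e 0 b 1" "?e 2 b 1 = ?e 0 b 0"
      "?e i 2 0 = ?e i 0 1" "?e i 2 1 = ?e i 0 0" for i b
    using s t zc s_2 t_2 z2 z_pow_comm[OF ctx, of "t [^] b" 1]
    by (simp_all add: elt_def[OF ctx] numeral_2_eq_2 m_assoc)
  interpret A: quaternion_action "range const_fun" "act z" "act s" "act t"
    "?x 0 0 0" "?x 1 0 0" "?x 0 1 0" "?x 1 1 0" "?x 0 0 1" "?x 1 0 1" "?x 0 1 1" "?x 1 1 1"
  proof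
    show "is_subfield (range const_fun :: ('g, 'k) ratfun set)" by (rule is_subfield_const)
    show "(2 :: ('g, 'k) ratfun) \<noteq> 0" by (rule two)
    show "field_hom (act z)" "field_hom (act t)" "field_hom (act s)" using act(1) zc s t by auto
    let ?V = "carrier G - {\<one>}"
    have ne: "?e i b a \<in> ?V" if "i < 2" "b < 2" "a < 2" "(i, b, a) \<noteq> (0, 0, 0)" for i b a
      using inj_onD[OF elt_inj[OF ctx], of "(i, b, a)" "(0, 0, 0)"] that elt_closed' elt_1 by auto
    show "\<not> algebraic_over (gen_field (range const_fun \<union>
      {?x 1 0 0, ?x 0 1 0, ?x 1 1 0, ?x 0 0 1, ?x 1 0 1, ?x 0 1 1, ?x 1 1 1})) (?x 0 0 0)"
    proof
      assume "algebraic_over (gen_field (range const_fun \<union>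
        {?x 1 0 0, ?x 0 1 0, ?x 1 1 0, ?x 0 0 1, ?x 1 0 1, ?x 0 1 1, ?x 1 1 1})) (?x 0 0 0)"
      moreover have "{?x 1 0 0, ?x 0 1 0, ?x 1 1 0, ?x 0 0 1, ?x 1 0 1, ?x 0 1 1, ?x 1 1 1} \<subseteq> var_fun ` ?V"
        unfolding insert_subset by (intro conjI imageI ne empty_subsetI) simp_all
      ultimately have "algebraic_over (ratfuns_in ?V) (?x 0 0 0)"
        unfolding ratfuns_in_eq_gen_field by (elim algebraic_over_mono) (intro gen_field_mono, blast)
      then show False unfolding elt_1 using var_fun_transcendental[of "\<one>" ?V, where ?'k = 'k] by simp
    qed
  qed (use act(2) zc s t act_elt red in \<open>auto simp: numeral_2_eq_2\<close>)
  have L: "A.L = ratfuns_in (carrier G)"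
    unfolding A.L_def ratfuns_in_eq_gen_field carrier_eq by simp
  show ?thesis
  proof (rule rational_fixed_field[OF G fin act, of "{z, s, t}" A.gens])
    show "{z, s, t} \<subseteq> carrier G" using zc s t by simp
    show "carrier G \<subseteq> U" if U: "\<one> \<in> U" "{z, s, t} \<subseteq> U" "\<And>x y. x \<in> U \<Longrightarrow> y \<in> U \<Longrightarrow> x \<otimes> y \<in> U" for U
    proof -
      have "g [^] (n::nat) \<in> U" if "g \<in> {z, s, t}" for g n
        by (induction n) (use U that in auto)
      then have "?e i b a \<in> U" for i b a unfolding elt_def[OF ctx] using U(3) by simp
      then show ?thesis unfolding carrier_eq by blast
    qed
    show "card A.gens \<le> order G" using A.gens_card(2) ord by simp
    show "act h f = f" if "h \<in> {z, s, t}" "f \<in> A.gens" for h f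
      using A.gens_fixed[OF that(2)] that(1) by blast
    show "fin_ext (gen_field (range const_fun \<union> A.gens)) (ratfuns_in (carrier G))"
      using A.fin_ext_F0_L unfolding A.F0_def L .
    show "f \<in> gen_field (range const_fun \<union> A.gens)"
      if "f \<in> ratfuns_in (carrier G)" "\<And>h. h \<in> {z, s, t} \<Longrightarrow> act h f = f" for f
      using A.fixed_F0[of f] that unfolding A.F0_def L by blast
  qed (use A.gens_card A.gens_L L in auto)
qed

theorem mainTheorem2:
  fixes G :: "('g, 'b) monoid_scheme" and p :: nat
  assumes "Factorial_Ring.prime p"
    and "group G" and "order G = p ^ 3" and "\<not> comm_group G"
    and "\<exists>\<zeta>::'k::field. primitive_root_of_unity p \<zeta>"
  shows "rational_over_K (fixed_field G :: ('g, 'k) ratfun set)"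
proof -
  obtain \<zeta> :: 'k where \<zeta>: "primitive_root_of_unity p \<zeta>" using assms(5) by blast
  show ?thesis
  proof (rule group.order_p3_cases[OF assms(2) assms(1,3,4)])
    fix s t z
    assume "s \<in> carrier G" "t \<in> carrier G" "z \<in> center G" "t \<otimes>\<^bsub>G\<^esub> s = s \<otimes>\<^bsub>G\<^esub> t \<otimes>\<^bsub>G\<^esub> z"
      "z \<noteq> \<one>\<^bsub>G\<^esub>" "z [^]\<^bsub>G\<^esub> p = \<one>\<^bsub>G\<^esub>" "t [^]\<^bsub>G\<^esub> p = \<one>\<^bsub>G\<^esub>"
    then show ?thesis by (rule rational_modular_case[OF assms(2,1,3) _ _ _ _ _ _ _ \<zeta>])
  next
    fix s t z
    assume *: "s \<in> carrier G" "t \<in> carrier G" "z \<in> center G" "t \<otimes>\<^bsub>G\<^esub> s = s \<otimes>\<^bsub>G\<^esub> t \<otimes>\<^bsub>G\<^esub> z"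
      "z \<noteq> \<one>\<^bsub>G\<^esub>" "z [^]\<^bsub>G\<^esub> p = \<one>\<^bsub>G\<^esub>" "p = 2" "s \<otimes>\<^bsub>G\<^esub> s = z" "t \<otimes>\<^bsub>G\<^esub> t = z"
    \<comment> \<open>With \<open>p = 2\<close>, the existence of the primitive root excludes
      characteristic 2.\<close>
    have "(of_nat p :: ('g, 'k) ratfun) \<noteq> 0"
      by (rule root_of_unity_of_nat_neq_0[OF assms(1) primitive_root_const_fun[OF \<zeta>]])
    then have "(2 :: ('g, 'k) ratfun) \<noteq> 0" using *(7) by simp
    then show ?thesis
      using rational_quaternion_case[OF assms(2) _ *(1-5) _ *(8,9)] assms(3) *(6,7) by blast
  qed
qed

end
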